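(* Let $A\in\mathbb{C}^{n\times n}$ and $1\le k\le n$. Suppose $\dim(\Lambda_k(A))\in\{0,1\}$ and that $\lambda_k(\theta)\ne\lambda_{n-k+1}(\theta)$ for all $\theta\in[0,2\pi)$. Then $\Lambda_k(A)=\{a+ib\}$ for some $a,b\in\mathbb{R}$ such that $t+ax+by$ is either tritangent to $\mathcal{V}(f_A)$ or divides $f_A$.
   Context: For $A\in\mathbb{C}^{n\times n}$ put $\Re(A)=\frac12(A+A^* )$, $\Im(A)=\frac{1}{2i}(A-A^* )$, and let $f_A=\det(tI_n+x\Re(A)+y\Im(A))\in\mathbb{R}[t,x,y]$ be the Kippenhahn polynomial, with zero set $\mathcal{V}(f_A)\subset\mathbb{P}^2(\mathbb{C})$. For a Hermitian $n\times n$ matrix $M$, $\lambda_1(M)\ge\dots\ge\lambda_n(M)$ are its eigenvalues with multiplicity, and $\lambda_k(\theta)=\lambda_k(\cos(\theta)\Re(A)+\sin(\theta)\Im(A))$. The rank-$k$ numerical range is $\Lambda_k(A)=\{\mu\in\mathbb{C}: \exists X\in\mathbb{C}^{n\times k} \text{ with } X^*X=I_k,\ X^*AX=\mu I_k\}$, a convex compact subset of $\mathbb{C}\cong\mathbb{R}^2$; its dimension is the real dimension of its affine hull, with $\dim\emptyset=-1$. Tritangent: for a homogeneous $f\in\mathbb{C}[t,x,y]$ with square-free part $f^{\rm red}$ (the product of its distinct irreducible factors), the linear form $\ell=t+ax+by$ is tritangent to $\mathcal{V}(f)$ if the restriction to the line $\ell=0$ has at least three double points, that is, $f^{\rm red}(-ax-by,x,y)=(\ell_1\ell_2\ell_3)^2\,h$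 for some linear forms $\ell_1,\ell_2,\ell_3$ and some polynomial $h$ with complex coefficients. *)

theory Defs
  imports
    "HOL-Analysis.Affine"
    "HOL-Computational_Algebra.Computational_Algebra"
    "HOL-Computational_Algebra.Field_as_Ring"
    "Jordan_Normal_Form.Schur_Decomposition"
begin

text \<open>
  The ring $\mathbb{C}[x,y]$ is the iterated polynomial ring $(\mathbb{C}[y])[x]$ and
  $\mathbb{C}[t,x,y]$ is $((\mathbb{C}[y])[x])[t]$, so \<open>t\<close> is the outermost variable and
  substituting a polynomial in \<open>x\<close> and \<open>y\<close> for \<open>t\<close> is evaluation by \<^const>\<open>poly\<close>.
\<close>

type_synonym poly_xy = "complex poly poly"
type_synonym poly_txy = "poly_xy poly"

definition linear_form_xy :: "complex \<Rightarrow> complex \<Rightarrow> poly_xy" where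
  "linear_form_xy a b = [:[:a:]:] * [:0, 1:] + [:[:b:]:] * [:[:0, 1:]:]"

definition const_txy :: "complex \<Rightarrow> poly_txy" where
  "const_txy c = [:[:[:c:]:]:]"

definition var_t :: poly_txy where "var_t = [:0, 1:]"
definition var_x :: poly_txy where "var_x = [:[:0, 1:]:]"
definition var_y :: poly_txy where "var_y = [:[:[:0, 1:]:]:]"

definition re_mat :: "complex mat \<Rightarrow> complex mat" where
  "re_mat A = (1 / 2) \<cdot>\<^sub>m (A + mat_adjoint A)"

definition im_mat :: "complex mat \<Rightarrow> complex mat" where
  "im_mat A = (1 / (2 * \<i>)) \<cdot>\<^sub>m (A - mat_adjoint A)"

definition kippenhahn_poly :: "complex mat \<Rightarrow> poly_txy" where
  "kippenhahn_poly A =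
     Determinant.det (var_t \<cdot>\<^sub>m 1\<^sub>m (dim_row A)
        + var_x \<cdot>\<^sub>m map_mat const_txy (re_mat A)
        + var_y \<cdot>\<^sub>m map_mat const_txy (im_mat A))"

text \<open>
  For a Hermitian matrix \<open>M\<close>, \<open>eigval M k\<close> is the \<open>k\<close>-th largest eigenvalue, counting from
  \<open>1\<close> and with multiplicity. The roots of the characteristic polynomial are then real, so
  \<^const>\<open>Re\<close> merely changes their type.
\<close>

definition eigval :: "complex mat \<Rightarrow> nat \<Rightarrow> real" where
  "eigval M k = rev (sorted_list_of_multiset (image_mset Re (proots (char_poly M)))) ! (k - 1)"

definition eigval_dir :: "complex mat \<Rightarrow> nat \<Rightarrow> real \<Rightarrow> real" where
  "eigval_dir A k \<theta> =
     eigval (complex_of_real (cos \<theta>) \<cdot>\<^sub>m re_mat A + complex_of_real (sin \<theta>) \<cdot>\<^sub>m im_mat A) k"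

definition rank_numerical_range :: "nat \<Rightarrow> complex mat \<Rightarrow> complex set" where
  "rank_numerical_range k A =
     {\<mu>. \<exists>X \<in> carrier_mat (dim_row A) k.
        mat_adjoint X * X = 1\<^sub>m k \<and> mat_adjoint X * A * X = \<mu> \<cdot>\<^sub>m 1\<^sub>m k}"

definition line_form :: "complex \<Rightarrow> complex \<Rightarrow> poly_txy" where
  "line_form a b = var_t + const_txy a * var_x + const_txy b * var_y"

text \<open>
  Irreducible factors are determined up to a nonzero constant; \<^const>\<open>prime_factors\<close>
  contains exactly one representative of each, normalized.
\<close>

definition squarefree_part :: "poly_txy \<Rightarrow> poly_txy" where
  "squarefree_part f = \<Prod>(prime_factors f)"

text \<open>Tritangency of the line $t + ax + by = 0$ to the zero set of \<open>f\<close>.\<close>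

definition tritangent :: "complex \<Rightarrow> complex \<Rightarrow> poly_txy \<Rightarrow> bool" where
  "tritangent a b f \<longleftrightarrow>
     (\<exists>c1 d1 c2 d2 c3 d3 (h :: poly_xy).
        poly (squarefree_part f) (- linear_form_xy a b) =
          (linear_form_xy c1 d1 * linear_form_xy c2 d2 * linear_form_xy c3 d3)\<^sup>2 * h)"

end

theory Submission
  imports Defs "Jordan_Normal_Form.Spectral_Radius" "HOL-Library.Function_Algebras"
begin

text \<open>
  Write \<open>H \<theta> = cos \<theta> Re A + sin \<theta> Im A\<close> and let \<open>\<lambda>\<^sub>k \<theta>\<close> be its \<open>k\<close>-th eigenvalue. Every
  \<open>\<mu>\<close> in the rank-\<open>k\<close> numerical range satisfies \<open>Re (cis (- \<theta>) * \<mu>) \<le> \<lambda>\<^sub>k \<theta>\<close> for all \<open>\<theta>\<close>.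
  Conversely, strict inequality in all directions forces \<open>\<mu>\<close> into the range. For this one needs
  a \<open>k\<close>-dimensional isotropic subspace of the form of \<open>A - \<mu>\<close>, found by induction on the
  dimension. An isotropic \<open>x\<close> with \<open>A x\<close> and \<open>A\<^sup>* x\<close> proportional can be split off, lowering \<open>k\<close> by
  one. If there is none, the form is a diagonal one with entries \<open>d j\<close>, no two of them on opposite
  rays, and there is a hyperplane on which \<open>H \<theta>\<close> still has \<open>k\<close> positive eigenvalues for every \<open>\<theta>\<close>.
  It is the orthogonal complement of a vector whose squared entries are the residues of
  \<open>1 / (\<Prod>z\<in>Z. sin (z - s))\<close>, where \<open>Z\<close> picks one angle from each run of equally oriented \<open>d j\<close>.

  Consequently a range of dimension \<open>0\<close> or \<open>1\<close> admits no strictly feasible point, so by compactness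
  the tight directions at a point of the range meet every closed half-plane. They contain no
  antipodal pair by assumption; hence the range is a single point \<open>a + \<i> b\<close> with three pairwise
  nonparallel tight directions. In a tight direction the eigenvalue \<open>\<lambda>\<^sub>k\<close> minus its lower bound
  \<open>a x + b y\<close> has a local minimum with value \<open>0\<close>. A simple zero of the restriction of the
  square-free part to the line would make it locally injective, which is impossible. So the
  restriction is divisible by the squares of three independent linear forms. (If the line form
  divides the Kippenhahn polynomial, the restriction is zero and the line is tritangent as well.)
\<close>

section \<open>Weights on signed angles\<close>

text \<open>The residues answer a sign question. Whether the hyperplane orthogonal to
  \<open>v\<close> costs a nondegenerate \<open>H \<theta>\<close> a positive or a negative
  eigenvalue depends on the sign of the sum of \<open>|v j|^2 / h j\<close>, where
  \<open>h j\<close> is a multiple of \<open>sin (\<phi> j - s)\<close> and \<open>s\<close> encodes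
  \<theta>. So one wants a function of \<open>s\<close> with simple poles at some of the angles and
  a prescribed sign between them; the reciprocal of a product of sines changes sign exactly at its
  poles. Up to positive factors the residues times \<open>\<epsilon> j\<close> become
  \<open>|v j|^2\<close> and must not be negative, so neighbouring poles need opposite signs, and
  this dictates \<open>Z\<close>. A half-turn glues the two ends of \<open>{0..<pi}\<close> and
  flips all signs, so \<open>Z\<close> has odd size; oddness in turn makes the expansion into terms
  \<open>1 / sin (z - s)\<close> valid. Opposite rays would give one angle two signs, which is why
  they must be excluded beforehand. The strict form of the converse suffices since it serves only to
  refute strictly feasible points: points where some inequality is an equality are never shown to
  lie in the range.\<close>

text \<open>Gaussian elimination. Later intersections of spans of eigenvectors with kernels of
  functionals come from here; equations form a list so that they are counted by length and
  repetitions do no harm.\<close>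

lemma underdetermined_system:
  fixes rs :: "('j \<Rightarrow> complex) list"
  assumes "finite J" "length rs < card J"
  shows "\<exists>c. (\<exists>j\<in>J. c j \<noteq> 0) \<and> (\<forall>r\<in>set rs. (\<Sum>j\<in>J. c j * r j) = 0)"
  using assms
proof (induction "length rs" arbitrary: rs J)
  case 0
  then obtain j where "j \<in> J" by fastforce
  then show ?case using 0 by (intro exI[of _ "\<lambda>_. 1"]) auto
next
  case (Suc m)
  then obtain r rs' where rs: "rs = r # rs'" by (cases rs) auto
  show ?case
  proof (cases "\<exists>j0\<in>J. r j0 \<noteq> 0")
    case False
    have "m = length rs'" "length rs' < card J" using Suc.prems Suc.hyps(2) rs by auto
    from Suc.hyps(1)[OF this(1) Suc.prems(1) this(2)] obtain c where c: "\<exists>j\<in>J. c j \<noteq> 0"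
      "\<forall>r\<in>set rs'. (\<Sum>j\<in>J. c j * r j) = 0" by auto
    have "(\<Sum>j\<in>J. c j * r j) = 0" using False by (intro sum.neutral) auto
    then show ?thesis using c rs by auto
  next
    case True
    then obtain j0 where j0: "j0 \<in> J" "r j0 \<noteq> 0" by auto
    define J' where "J' = J - {j0}"
    \<comment> \<open>\<open>f q\<close> is the equation \<open>q\<close> after eliminating the
      unknown at the pivot \<open>j0\<close> by means of \<open>r\<close>.\<close>
    define f where "f = (\<lambda>q j. q j - q j0 * r j / r j0 :: complex)"
    have J': "finite J'" "j0 \<notin> J'" "J = insert j0 J'" using j0 Suc.prems by (auto simp: J'_def)
    then have "card J = Suc (card J')" by simp
    then have "length (map f rs') < card J'" "m = length (map f rs')"
      using Suc.prems Suc.hyps(2) rs by auto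
    from Suc.hyps(1)[OF this(2) J'(1) this(1)] obtain c where c: "\<exists>j\<in>J'. c j \<noteq> 0"
      "\<forall>q\<in>set (map f rs'). (\<Sum>j\<in>J'. c j * q j) = 0" by auto
    define c' where "c' = c(j0 := - (\<Sum>j\<in>J'. c j * r j) / r j0)"
    have eq: "(\<Sum>j\<in>J. c' j * q j) = (\<Sum>j\<in>J'. c j * f q j)" for q
    proof -
      have "(\<Sum>j\<in>J. c' j * q j) = - (\<Sum>j\<in>J'. c j * r j) / r j0 * q j0 + (\<Sum>j\<in>J'. c' j * q j)"
        using J' by (simp add: c'_def)
      also have "(\<Sum>j\<in>J'. c' j * q j) = (\<Sum>j\<in>J'. c j * q j)"
        using J' by (intro sum.cong) (auto simp: c'_def)
      also have "- (\<Sum>j\<in>J'. c j * r j) / r j0 * q j0 + (\<Sum>j\<in>J'. c j * q j) = (\<Sum>j\<in>J'. c j * f q j)"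
        by (simp add: f_def right_diff_distrib sum_subtractf sum_distrib_left sum_distrib_right
            sum_divide_distrib mult.assoc mult.commute mult.left_commute divide_inverse sum_negf)
      finally show ?thesis .
    qed
    have "f r j = 0" for j using j0 by (simp add: f_def)
    then have "\<forall>q\<in>set rs. (\<Sum>j\<in>J. c' j * q j) = 0" using c(2) rs eq by auto
    moreover have "\<exists>j\<in>J. c' j \<noteq> 0" using c(1) J' by (auto simp: c'_def)
    ultimately show ?thesis by blast
  qed
qed

section \<open>Partial fractions for the reciprocal of a product of sines\<close>

text \<open>Numerators and denominators are both negated compared with the usual form, to match the
  quotients \<open>sin (l - s) / sin (l - i)\<close>.\<close>

lemma lagrange_interpolation:
  fixes p :: "complex poly" and X :: "'i \<Rightarrow> complex"
  assumes "finite Z" "inj_on X Z" "degree p < card Z"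
  shows "(\<Sum>i\<in>Z. poly p (X i) * (\<Prod>l\<in>Z - {i}. (X l - y) / (X l - X i))) = poly p y"
proof -
  define q where "q = (\<Sum>i\<in>Z. Polynomial.smult (poly p (X i)) (\<Prod>l\<in>Z - {i}. [:X l / (X l - X i), - 1 / (X l - X i):]))"
  have pq: "poly q y = (\<Sum>i\<in>Z. poly p (X i) * (\<Prod>l\<in>Z - {i}. (X l - y) / (X l - X i)))" for y
    unfolding q_def by (simp add: poly_sum poly_prod diff_divide_distrib)
  have "p = q"
  proof (rule poly_eqI_degree[where A = "X ` Z"])
    fix x assume "x \<in> X ` Z"
    then obtain j where j: "j \<in> Z" "x = X j" by auto
    have "(\<Prod>l\<in>Z - {i}. (X l - X j) / (X l - X i)) = (if i = j then 1 else 0)" if "i \<in> Z" for i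
    proof (cases "i = j")
      case True
      then have "(\<Prod>l\<in>Z - {i}. (X l - X j) / (X l - X i)) = (\<Prod>l\<in>Z - {i}. 1)"
        using assms(2) j that by (intro prod.cong) (auto dest: inj_onD)
      then show ?thesis using True by simp
    next
      case False
      then have "j \<in> Z - {i}" using j by auto
      then show ?thesis using assms(1) False by (auto intro!: prod_zero)
    qed
    then have "poly q x = (\<Sum>i\<in>Z. poly p (X i) * (if i = j then 1 else 0))"
      unfolding pq j by (intro sum.cong) auto
    also have "\<dots> = (\<Sum>i\<in>Z. if i = j then poly p (X i) else 0)" by (intro sum.cong) auto
    also have "\<dots> = poly p x" using j assms(1) by simp
    finally show "poly p x = poly q x" ..
  next
    show "card (X ` Z) > degree p" using assms by (simp add: card_image)
    have "degree q \<le> card Z - 1"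
      unfolding q_def
    proof (rule degree_sum_le[OF assms(1)])
      fix i assume i: "i \<in> Z"
      have "degree (\<Prod>l\<in>Z - {i}. [:X l / (X l - X i), - 1 / (X l - X i):]) \<le>
        (\<Sum>l\<in>Z - {i}. 1)"
        using assms(1) by (intro order.trans[OF degree_prod_sum_le] sum_mono) auto
      also have "(\<Sum>l\<in>Z - {i}. 1) = card Z - 1" using i assms(1) by simp
      finally show "degree (Polynomial.smult (poly p (X i)) (\<Prod>l\<in>Z - {i}. [:X l / (X l - X i), - 1 / (X l - X i):])) \<le> card Z - 1"
        by (rule order.trans[OF degree_smult_le])
    qed
    then show "card (X ` Z) > degree q" using assms by (simp add: card_image)
  qed
  show ?thesis unfolding pq[symmetric] \<open>p = q\<close>[symmetric] ..
qed

text \<open>Up to a nonvanishing factor the sine of a difference is a difference of squares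
  \<open>cis a ^ 2\<close>; this turns products of sines into products of differences of
  interpolation nodes.\<close>

lemma sin_diff_cis:
  "complex_of_real (sin (a - b)) * (2 * \<i>) * (cis a * cis b) = cis a ^ 2 - cis b ^ 2"
proof -
  have "complex_of_real (sin (a - b)) * (2 * \<i>) = cis (a - b) - cis (b - a)"
    by (simp add: complex_eq_iff sin_diff cos_diff algebra_simps)
  then have "complex_of_real (sin (a - b)) * (2 * \<i>) * (cis a * cis b) =
      cis (a - b) * cis (a + b) - cis (b - a) * cis (a + b)"
    by (simp only: left_diff_distrib cis_mult)
  then show ?thesis by (simp add: cis_mult power2_eq_square)
qed

text \<open>Lagrange interpolation at the nodes \<open>cis z ^ 2\<close>. For
  \<open>card Z = 2 * m + 1\<close> each product has \<open>2 * m\<close> factors, so the surplus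
  factors \<open>E i / E s\<close> combine to the \<open>m\<close>-th power of a quotient of nodes,
  and the identity becomes the interpolation of the monomial of degree \<open>m\<close>. Parity is
  essential: under \<open>s + pi\<close> every term on the left changes sign, the right side only
  for odd size.\<close>

lemma inverse_prod_sin:
  assumes fin: "finite Z" and odd: "odd (card Z)" and "Z \<subseteq> {0..<pi}"
    and s: "\<And>z. z \<in> Z \<Longrightarrow> sin (z - s) \<noteq> 0"
  shows "(\<Sum>z\<in>Z. inverse (\<Prod>l\<in>Z - {z}. sin (l - z)) / sin (z - s)) = inverse (\<Prod>z\<in>Z. sin (z - s))"
proof -
  obtain m where m: "card Z = 2 * m + 1" using odd by (elim oddE)
  define E where "E = cis"
  define X where "X = (\<lambda>z. E z ^ 2)"
  have E0: "E z \<noteq> 0" for z by (simp add: E_def)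
  have sinE: "complex_of_real (sin (a - b)) = (X a - X b) / (2 * \<i> * (E a * E b))" for a b
    using sin_diff_cis[of a b] E0[of a] E0[of b] by (simp add: E_def X_def field_simps)
  have sin0: "sin (a - b) \<noteq> 0" if "a \<in> Z" "b \<in> Z" "a \<noteq> b" for a b
  proof -
    have "a \<in> {0..<pi}" "b \<in> {0..<pi}" using that assms by auto
    then show ?thesis using that sin_gt_zero[of "a - b"] sin_gt_zero[of "b - a"]
      by (cases "a > b") (force simp: sin_diff algebra_simps)+
  qed
  have inj: "inj_on X Z"
    using sin0 sinE by (intro inj_onI) (metis div_0 diff_self of_real_eq_0_iff)
  have "(\<Sum>i\<in>Z. poly (monom 1 m) (X i) * (\<Prod>l\<in>Z - {i}. (X l - X s) / (X l - X i))) = poly (monom 1 m) (X s)"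
    by (rule lagrange_interpolation[OF fin inj]) (use m in \<open>auto simp: degree_monom_eq\<close>)
  then have L: "(\<Sum>i\<in>Z. X i ^ m * (\<Prod>l\<in>Z - {i}. (X l - X s) / (X l - X i))) = X s ^ m"
    by (simp add: poly_monom)
  have "(\<Prod>l\<in>Z - {i}. complex_of_real (sin (l - s) / sin (l - i))) = X i ^ m / X s ^ m * (\<Prod>l\<in>Z - {i}. (X l - X s) / (X l - X i))"
    if "i \<in> Z" for i
  proof -
    have "complex_of_real (sin (l - s) / sin (l - i)) = E i / E s * ((X l - X s) / (X l - X i))" for l
    proof -
      have "A / (2 * \<i> * (p * q)) / (B / (2 * \<i> * (p * r))) = r / q * (A / B)"
        if "p \<noteq> 0" "q \<noteq> 0" "r \<noteq> 0" for A B p q r :: complex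
        using that by (cases "B = 0") (simp_all add: field_simps)
      then show ?thesis unfolding of_real_divide sinE using E0 by blast
    qed
    then have "(\<Prod>l\<in>Z - {i}. complex_of_real (sin (l - s) / sin (l - i))) = (E i / E s) ^ card (Z - {i}) * (\<Prod>l\<in>Z - {i}. (X l - X s) / (X l - X i))"
      by (simp only: prod.distrib prod_constant)
    also have "(E i / E s) ^ card (Z - {i}) = X i ^ m / X s ^ m"
      using that m fin by (simp add: X_def power_divide power_mult)
    finally show ?thesis .
  qed
  then have "complex_of_real (\<Sum>i\<in>Z. \<Prod>l\<in>Z - {i}. (sin (l - s) / sin (l - i))) = (\<Sum>i\<in>Z. X i ^ m / X s ^ m * (\<Prod>l\<in>Z - {i}. (X l - X s) / (X l - X i)))"
    by (simp only: of_real_sum of_real_prod cong: sum.cong)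
  also have "\<dots> = (\<Sum>i\<in>Z. X i ^ m * (\<Prod>l\<in>Z - {i}. (X l - X s) / (X l - X i))) / X s ^ m"
    by (simp add: sum_divide_distrib)
  also have "\<dots> = 1" unfolding L using E0 by (simp add: X_def)
  finally have one: "(\<Sum>i\<in>Z. \<Prod>l\<in>Z - {i}. (sin (l - s) / sin (l - i))) = 1" using of_real_eq_1_iff by blast
  have "inverse (\<Prod>l\<in>Z - {z}. sin (l - z)) / sin (z - s) =
      (\<Prod>l\<in>Z - {z}. (sin (l - s) / sin (l - z))) * inverse (\<Prod>z\<in>Z. sin (z - s))" if "z \<in> Z" for z
  proof -
    have "(\<Prod>z\<in>Z. sin (z - s)) = sin (z - s) * (\<Prod>l\<in>Z - {z}. sin (l - s))" using that fin by (simp add: prod.remove)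
    moreover have "(\<Prod>l\<in>Z - {z}. sin (l - s)) \<noteq> 0" using fin s by simp
    moreover have "inverse B / a = A / B * inverse (a * A)" if "A \<noteq> 0" for A B a :: real
      using that by (cases "a = 0"; cases "B = 0") (simp_all add: divide_simps)
    ultimately show ?thesis unfolding prod_dividef by metis
  qed
  then have "(\<Sum>z\<in>Z. inverse (\<Prod>l\<in>Z - {z}. sin (l - z)) / sin (z - s)) =
     (\<Sum>z\<in>Z. \<Prod>l\<in>Z - {z}. (sin (l - s) / sin (l - z))) * inverse (\<Prod>z\<in>Z. sin (z - s))"
    by (simp add: sum_distrib_right)
  then show ?thesis using one by simp
qed

section \<open>Signs of sine products and runs of equal signs\<close>

lemma sgn_sin_diff:
  assumes "a \<in> {0..<pi}" "b \<in> {0..<pi}"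
  shows "sgn (sin (a - b)) = sgn (a - b :: real)"
proof -
  consider "a = b" | "a < b" | "b < a" by linarith
  then show ?thesis
  proof cases
    case 2
    then have "sin (b - a) > 0" using assms by (intro sin_gt_zero) auto
    then have "sin (a - b) < 0" by (simp add: sin_diff algebra_simps)
    then show ?thesis using 2 by simp
  next
    case 3
    then have "sin (a - b) > 0" using assms by (intro sin_gt_zero) auto
    then show ?thesis using 3 by simp
  qed auto
qed

lemma sgn_prod_sin:
  assumes "finite Z" "Z \<subseteq> {0..<pi}" "s \<in> {0..<pi}" "s \<notin> Z"
  shows "sgn (\<Prod>z\<in>Z. sin (z - s)) = (- 1) ^ card {z\<in>Z. z < s}"
proof -
  have "sgn (\<Prod>z\<in>Z. sin (z - s)) = (\<Prod>z\<in>Z. sgn (sin (z - s)))"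
    using assms(1) by (induction Z) (auto simp: sgn_mult)
  also have "\<dots> = (\<Prod>z\<in>Z. if z < s then - 1 else 1)"
    using assms by (intro prod.cong refl) (subst sgn_sin_diff, auto simp: sgn_if)
  also have "\<dots> = (- 1) ^ card {z\<in>Z. z < s}"
    using assms(1) by (simp add: prod.If_cases Int_def)
  finally show ?thesis .
qed

text \<open>The set \<open>Z\<close> consists of the first points of the runs of equal signs.\<close>

lemma run_starts:
  fixes L :: "real set" and \<epsilon> :: "real \<Rightarrow> real"
  assumes "finite L" "\<And>l. l \<in> L \<Longrightarrow> \<epsilon> l \<in> {- 1, 1}" "e0 \<in> {- 1, 1 :: real}"
  shows "\<exists>Z\<subseteq>L. (\<forall>s. e0 * (- 1) ^ card {z\<in>Z. z < s} =
             (if {l\<in>L. l < s} = {} then e0 else - \<epsilon> (Max {l\<in>L. l < s})))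
       \<and> (\<forall>l\<in>L. l \<in> Z \<longleftrightarrow> \<epsilon> l = e0 * (- 1) ^ card {z\<in>Z. z < l})"
  using assms(1,2)
proof (induction L rule: finite_linorder_max_induct)
  case empty
  then show ?case by auto
next
  case (insert b A)
  then obtain Z where Z: "Z \<subseteq> A"
    and sgn: "\<And>s. e0 * (- 1) ^ card {z\<in>Z. z < s} =
             (if {l\<in>A. l < s} = {} then e0 else - \<epsilon> (Max {l\<in>A. l < s}))"
    and mem: "\<And>l. l \<in> A \<Longrightarrow> l \<in> Z \<longleftrightarrow> \<epsilon> l = e0 * (- 1) ^ card {z\<in>Z. z < l}" by auto
  have finZ: "finite Z" using Z insert(1) finite_subset by auto
  have bZ: "b \<notin> Z" "b \<notin> A" using Z insert(2) by auto
  \<comment> \<open>The value \<open>e0 * (- 1) ^ card {z\<in>Z. z < s}\<close> is a state that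
    flips at the members of \<open>Z\<close>. A point joins iff its sign agrees with the state, so
    in either case the state just after a point is the negative of its sign.\<close>
  define B where "B = (if \<epsilon> b = e0 * (- 1) ^ card {z\<in>Z. z < b} then insert b Z else Z)"
  have low: "{z\<in>B. z < s} = {z\<in>Z. z < s}" "{l\<in>insert b A. l < s} = {l\<in>A. l < s}" if "s \<le> b" for s
    using that by (auto simp: B_def)
  have Zall: "{z\<in>Z. z < s} = {z\<in>Z. z < b}" if "b < s" for s using that Z insert(2) by fastforce
  have high: "Max {l\<in>insert b A. l < s} = b" "{l\<in>insert b A. l < s} \<noteq> {}" if "b < s" for s
  proof -
    show "Max {l\<in>insert b A. l < s} = b"
      using that insert(1,2) by (intro Max_eqI) (auto intro: less_imp_le)
    show "{l\<in>insert b A. l < s} \<noteq> {}" using that by auto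
  qed
  have \<epsilon>b: "\<epsilon> b \<in> {- 1, 1}" using insert(4) by auto
  have pm: "e0 * (- 1) ^ m \<in> {- 1, 1}" for m using assms(3) by (cases "even m") auto
  show ?case
  proof (intro exI[of _ B] conjI allI ballI)
    show "B \<subseteq> insert b A" using Z by (auto simp: B_def)
  next
    fix s
    show "e0 * (- 1) ^ card {z\<in>B. z < s} =
       (if {l\<in>insert b A. l < s} = {} then e0 else - \<epsilon> (Max {l\<in>insert b A. l < s}))"
    proof (cases "s \<le> b")
      case True
      show ?thesis unfolding low[OF True] by (rule sgn)
    next
      case False
      then have bs: "b < s" by simp
      show ?thesis
      proof (cases "\<epsilon> b = e0 * (- 1) ^ card {z\<in>Z. z < b}")
        case True
        then have "{z\<in>B. z < s} = insert b {z\<in>Z. z < b}" using Zall[OF bs] bs by (auto simp: B_def)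
        then have "card {z\<in>B. z < s} = Suc (card {z\<in>Z. z < b})" using finZ by simp
        then show ?thesis using high[OF bs] True by (simp del: Max_less_iff Collect_empty_eq)
      next
        case False
        then have "{z\<in>B. z < s} = {z\<in>Z. z < b}" using Zall[OF bs] bs by (auto simp: B_def)
        moreover have "e0 * (- 1) ^ card {z\<in>Z. z < b} = - \<epsilon> b"
          using pm[of "card {z\<in>Z. z < b}"] \<epsilon>b False by auto
        ultimately show ?thesis using high[OF bs] by (simp del: Collect_empty_eq)
      qed
    qed
  next
    fix l assume l: "l \<in> insert b A"
    then have lb: "l \<le> b" using insert(2) by auto
    show "l \<in> B \<longleftrightarrow> \<epsilon> l = e0 * (- 1) ^ card {z\<in>B. z < l}"
      unfolding low[OF lb] using mem[of l] l bZ by (cases "l = b") (auto simp: B_def)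
  qed
qed

text \<open>The number \<open>\<rho> j * \<epsilon> j * cis (\<phi> j)\<close> lies in the open half-plane with parameters \<open>s\<close>, \<open>\<tau>\<close>
  (that is, in direction \<open>s + \<tau> * pi / 2\<close>) iff \<open>\<tau> * (\<epsilon> j * (\<phi> j - s)) > 0\<close>. If such a half-plane
  contains the minimal number \<open>K\<close> of points, then the last point before \<open>s\<close> has sign \<open>\<tau>\<close>, since
  otherwise turning the half-plane back to that point would lose a point.\<close>

lemma angle_weights:
  fixes \<phi> :: "'j \<Rightarrow> real" and \<epsilon> \<rho> :: "'j \<Rightarrow> real"
  assumes fin: "finite J" and ne: "J \<noteq> {}"
    and \<phi>: "\<And>j. j \<in> J \<Longrightarrow> \<phi> j \<in> {0..<pi}"
    and \<epsilon>: "\<And>j. j \<in> J \<Longrightarrow> \<epsilon> j \<in> {- 1, 1}"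
    and \<rho>: "\<And>j. j \<in> J \<Longrightarrow> \<rho> j > 0"
    and same: "\<And>i j. i \<in> J \<Longrightarrow> j \<in> J \<Longrightarrow> \<phi> i = \<phi> j \<Longrightarrow> \<epsilon> i = \<epsilon> j"
    and cnt: "\<And>s \<tau>. s \<in> {0..<pi} \<Longrightarrow> \<tau> \<in> {- 1, 1 :: real} \<Longrightarrow>
               K \<le> card {j\<in>J. \<tau> * (\<epsilon> j * (\<phi> j - s)) > 0}"
  shows "\<exists>w. (\<forall>j\<in>J. w j \<ge> 0) \<and> (\<exists>j\<in>J. w j \<noteq> 0) \<and>
     (\<forall>s \<tau>. s \<in> {0..<pi} \<longrightarrow> \<tau> \<in> {- 1, 1 :: real} \<longrightarrow> K = card {j\<in>J. \<tau> * (\<epsilon> j * (\<phi> j - s)) > 0} \<longrightarrow>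
        (\<exists>j\<in>J. w j \<noteq> 0 \<and> \<phi> j = s) \<or>
        \<tau> * (\<Sum>j\<in>J. w j / (\<rho> j * \<epsilon> j * sin (\<phi> j - s))) < 0)"
proof -
  define L where "L = \<phi> ` J"
  \<comment> \<open>One representative per angle carries the weight, so that coinciding angles are
    not counted repeatedly in the partial fraction sum.\<close>
  define r where "r = (\<lambda>l. SOME j. j \<in> J \<and> \<phi> j = l)"
  have r: "r l \<in> J" "\<phi> (r l) = l" if "l \<in> L" for l
    using that someI_ex[of "\<lambda>j. j \<in> J \<and> \<phi> j = l"] by (auto simp: L_def r_def)
  define \<epsilon>' where "\<epsilon>' = (\<lambda>l. \<epsilon> (r l))"
  have \<epsilon>': "\<epsilon>' (\<phi> j) = \<epsilon> j" if "j \<in> J" for j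
    using that r[of "\<phi> j"] same[of "r (\<phi> j)" j] by (auto simp: \<epsilon>'_def L_def)
  have L: "finite L" "L \<noteq> {}" "L \<subseteq> {0..<pi}" using fin ne \<phi> by (auto simp: L_def)
  have \<epsilon>'1: "\<epsilon>' l \<in> {- 1, 1}" if "l \<in> L" for l using r(1)[OF that] \<epsilon> by (auto simp: \<epsilon>'_def)
  define top where "top = Max L"
  have top: "top \<in> L" "\<And>l. l \<in> L \<Longrightarrow> l \<le> top" using L by (auto simp: top_def)
  \<comment> \<open>Seen cyclically, the point preceding the first angle is \<open>top\<close>
    shifted by \<open>- pi\<close>, with sign \<open>- \<epsilon>' top\<close>. The starting state
    is the negative of that sign, as it is after every point.\<close>
  define e0 where "e0 = \<epsilon>' top"
  have e0: "e0 \<in> {- 1, 1}" using \<epsilon>'1 top by (simp add: e0_def)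
  have "\<exists>Z\<subseteq>L. (\<forall>s. e0 * (- 1) ^ card {z\<in>Z. z < s} =
             (if {l\<in>L. l < s} = {} then e0 else - \<epsilon>' (Max {l\<in>L. l < s})))
       \<and> (\<forall>l\<in>L. l \<in> Z \<longleftrightarrow> \<epsilon>' l = e0 * (- 1) ^ card {z\<in>Z. z < l})"
    by (rule run_starts[OF L(1) _ e0]) (rule \<epsilon>'1)
  then obtain Z where Z: "Z \<subseteq> L"
    and sgn': "\<forall>s. e0 * (- 1) ^ card {z\<in>Z. z < s} =
             (if {l\<in>L. l < s} = {} then e0 else - \<epsilon>' (Max {l\<in>L. l < s}))"
    and mem': "\<forall>l\<in>L. l \<in> Z \<longleftrightarrow> \<epsilon>' l = e0 * (- 1) ^ card {z\<in>Z. z < l}"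
    by (elim exE conjE)
  note sgn = sgn'[rule_format] and mem = mem'[rule_format]
  have finZ: "finite Z" using Z L finite_subset by auto
  have Zpi: "Z \<subseteq> {0..<pi}" using Z L by auto
  \<comment> \<open>Beyond the last point the state is \<open>- \<epsilon>' top\<close>, the
    negative of its starting value, so it has been flipped an odd number of times.\<close>
  have odd: "odd (card Z)"
  proof -
    have "{z\<in>Z. z < top + 1} = Z" "{l\<in>L. l < top + 1} = L"
      using Z top by (auto simp: less_add_one intro: le_less_trans[OF _ less_add_one])
    then have "e0 * (- 1) ^ card Z = - e0" using sgn[of "top + 1"] L by (simp add: e0_def top_def)
    then show ?thesis using e0 by (cases "even (card Z)") auto
  qed
  define P where "P = (\<lambda>z. \<Prod>l\<in>Z - {z}. sin (l - z))"
  have sgnP: "sgn (P z) = (- 1) ^ card {l\<in>Z. l < z}" if "z \<in> Z" for z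
  proof -
    have "{l\<in>Z - {z}. l < z} = {l\<in>Z. l < z}" by auto
    moreover have "sgn (P z) = (- 1) ^ card {l\<in>Z - {z}. l < z}"
      unfolding P_def using finZ Zpi that by (intro sgn_prod_sin) auto
    ultimately show ?thesis by simp
  qed
  \<comment> \<open>The expansion has coefficients \<open>1 / P z\<close>; \<rho> cancels the
    modulus in the denominator. Taking absolute values is compensated by \<epsilon>, because
    membership in \<open>Z\<close> amounts to
    \<open>\<epsilon> (r z) = e0 * sgn (P z)\<close>.\<close>
  define w where "w = (\<lambda>j. if \<phi> j \<in> Z \<and> r (\<phi> j) = j then \<rho> j * \<bar>inverse (P (\<phi> j))\<bar> else 0)"
  have w0: "w j \<ge> 0" if "j \<in> J" for j using \<rho>[OF that] by (auto simp: w_def)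
  have wr: "w (r z) > 0" if "z \<in> Z" for z
  proof -
    have "P z \<noteq> 0" using sgnP[OF that] by (metis power_eq_0_iff sgn_zero zero_neq_neg_one)
    then show ?thesis using r[of z] that Z \<rho>[of "r z"] by (auto simp: w_def)
  qed
  have sumw: "(\<Sum>j\<in>J. w j / (\<rho> j * \<epsilon> j * sin (\<phi> j - s))) = e0 * inverse (\<Prod>z\<in>Z. sin (z - s))"
    if s: "s \<in> {0..<pi}" "s \<notin> Z" for s
  proof -
    have sin0: "sin (z - s) \<noteq> 0" if "z \<in> Z" for z
      using sgn_sin_diff[of z s] that s Zpi by (metis eq_iff_diff_eq_0 sgn_0_0 subsetD)
    have inj: "inj_on r Z" using r Z by (metis inj_on_inverseI subsetD)
    have "(\<Sum>j\<in>J. w j / (\<rho> j * \<epsilon> j * sin (\<phi> j - s))) = (\<Sum>j\<in>r ` Z. w j / (\<rho> j * \<epsilon> j * sin (\<phi> j - s)))"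
      using fin r Z by (intro sum.mono_neutral_right) (auto simp: w_def, metis image_eqI)
    also have "\<dots> = (\<Sum>z\<in>Z. w (r z) / (\<rho> (r z) * \<epsilon> (r z) * sin (\<phi> (r z) - s)))"
      by (simp add: sum.reindex[OF inj])
    also have "\<dots> = (\<Sum>z\<in>Z. e0 * (inverse (P z) / sin (z - s)))"
    proof (intro sum.cong refl)
      fix z assume z: "z \<in> Z"
      then have zL: "z \<in> L" using Z by auto
      have eps: "\<epsilon> (r z) = e0 * sgn (P z)" using mem[OF zL] z sgnP[OF z] by (simp add: \<epsilon>'_def)
      have "\<bar>inverse (P z)\<bar> = inverse (P z) * sgn (P z)"
        by (simp add: abs_sgn sgn_inverse)
      moreover have "e0 * e0 = 1" using e0 by auto
      moreover have "sgn (P z) * sgn (P z) = 1" using sgnP[OF z] by (simp flip: power_mult_distrib)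
      moreover have "\<rho> (r z) > 0" using r(1)[OF zL] \<rho> by simp
      ultimately show "w (r z) / (\<rho> (r z) * \<epsilon> (r z) * sin (\<phi> (r z) - s)) = e0 * (inverse (P z) / sin (z - s))"
        using r[OF zL] z sin0[OF z] e0 unfolding eps by (auto simp: w_def sgn_if field_simps split: if_splits)
    qed
    also have "\<dots> = e0 * inverse (\<Prod>z\<in>Z. sin (z - s))"
      using inverse_prod_sin[OF finZ odd Zpi sin0] by (simp only: P_def sum_distrib_left[symmetric])
    finally show ?thesis .
  qed
  show ?thesis
  proof (intro exI[of _ w] conjI ballI allI impI)
    show "w j \<ge> 0" if "j \<in> J" for j using w0 that .
    obtain z where "z \<in> Z" using odd by (metis card.empty even_zero ex_in_conv)
    then show "\<exists>j\<in>J. w j \<noteq> 0" using wr r Z by (metis less_irrefl subsetD)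
  next
    fix s \<tau> :: real
    assume s: "s \<in> {0..<pi}" and \<tau>: "\<tau> \<in> {- 1, 1}"
      and K: "K = card {j\<in>J. \<tau> * (\<epsilon> j * (\<phi> j - s)) > 0}"
    show "(\<exists>j\<in>J. w j \<noteq> 0 \<and> \<phi> j = s) \<or> \<tau> * (\<Sum>j\<in>J. w j / (\<rho> j * \<epsilon> j * sin (\<phi> j - s))) < 0"
    proof (cases "s \<in> Z")
      case True
      then show ?thesis using wr[OF True] r[of s] Z by (metis less_irrefl subsetD)
    next
      case False
      define \<sigma> where "\<sigma> = e0 * (- 1) ^ card {z\<in>Z. z < s}"
      have \<sigma>1: "\<sigma> \<in> {- 1, 1}" using e0 by (cases "even (card {z\<in>Z. z < s})") (auto simp: \<sigma>_def)
      have sgnsum: "sgn (e0 * inverse (\<Prod>z\<in>Z. sin (z - s))) = \<sigma>"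
        using sgn_prod_sin[OF finZ Zpi s False] e0 by (auto simp: sgn_mult sgn_inverse \<sigma>_def simp flip: power_inverse)
      have "\<sigma> \<noteq> \<tau>"
      proof
        assume \<sigma>\<tau>: "\<sigma> = \<tau>"
        let ?A = "{j\<in>J. \<tau> * (\<epsilon> j * (\<phi> j - s)) > 0}"
        \<comment> \<open>If \<open>s\<close> is itself one of the angles, its sign disagrees with
          the state because \<open>s\<close> is not in \<open>Z\<close>. So no point of sign \<tau>
          lies on the boundary, where turning the half-plane back would capture it.\<close>
        have sL: "\<epsilon>' s = - \<tau>" if "s \<in> L" using mem[OF that] False \<epsilon>'1[OF that] \<tau> \<sigma>\<tau> by (auto simp: \<sigma>_def)
        have sJ: "\<epsilon> j = - \<tau>" if "j \<in> J" "\<phi> j = s" for j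
          using sL \<epsilon>'[OF that(1)] that by (auto simp: L_def)
        have less: "card B < card ?A" if "B \<subset> ?A" for B using that fin by (intro psubset_card_mono) auto
        show False
        proof (cases "{l\<in>L. l < s} = {}")
          \<comment> \<open>No angle precedes \<open>s\<close>: turning back passes through 0 and
            arrives at \<open>top\<close> from above, which reverses the orientation \<tau>.\<close>
          case True
          then have "\<sigma> = e0" unfolding \<sigma>_def by (subst sgn) (rule if_P)
          then have "e0 = \<tau>" using \<sigma>\<tau> by simp
          then have et: "\<epsilon>' top = \<tau>" by (simp add: e0_def)
          have ge: "s \<le> \<phi> j" if "j \<in> J" for j using True that by (force simp: L_def not_less)
          have le: "\<phi> j \<le> top" if "j \<in> J" for j using top(2) that by (auto simp: L_def)
          have rt: "r top \<in> J" "\<phi> (r top) = top" "\<epsilon> (r top) = \<tau>" using r top et by (auto simp: \<epsilon>'_def)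
          have "s \<noteq> top" using sJ[of "r top"] rt \<tau> by auto
          have "{j\<in>J. (- \<tau>) * (\<epsilon> j * (\<phi> j - top)) > 0} \<subset> ?A"
          proof
            show "{j\<in>J. (- \<tau>) * (\<epsilon> j * (\<phi> j - top)) > 0} \<subseteq> ?A"
            proof safe
              fix j assume j: "j \<in> J" "(- \<tau>) * (\<epsilon> j * (\<phi> j - top)) > 0"
              have "\<epsilon> j = \<tau>" using j le[OF j(1)] \<epsilon>[OF j(1)] \<tau> by (auto simp: zero_less_mult_iff)
              moreover have "\<phi> j \<noteq> s" using sJ[OF j(1)] \<open>\<epsilon> j = \<tau>\<close> \<tau> by auto
              ultimately show "\<tau> * (\<epsilon> j * (\<phi> j - s)) > 0" using ge[OF j(1)] \<tau> by auto
            qed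
            have "r top \<in> ?A" using rt \<open>s \<noteq> top\<close> ge[OF rt(1)] \<tau> by auto
            moreover have "r top \<notin> {j\<in>J. (- \<tau>) * (\<epsilon> j * (\<phi> j - top)) > 0}" using rt by simp
            ultimately show "{j\<in>J. (- \<tau>) * (\<epsilon> j * (\<phi> j - top)) > 0} \<noteq> ?A" by blast
          qed
          then have "card {j\<in>J. (- \<tau>) * (\<epsilon> j * (\<phi> j - top)) > 0} < K" using less K by simp
          moreover have "K \<le> card {j\<in>J. (- \<tau>) * (\<epsilon> j * (\<phi> j - top)) > 0}"
            using cnt[of top "- \<tau>"] top L \<tau> by auto
          ultimately show False by simp
        next
          case ne': False
          define l where "l = Max {l\<in>L. l < s}"
          have "l \<in> {l\<in>L. l < s}" using L ne' unfolding l_def by (intro Max_in) auto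
          then have l: "l \<in> L" "l < s" by auto
          have lmax: "l' \<le> l" if "l' \<in> L" "l' < s" for l' using that L unfolding l_def by (intro Max_ge) auto
          have "\<sigma> = - \<epsilon>' l" unfolding \<sigma>_def l_def using ne' by (subst sgn) (rule if_not_P)
          then have el: "\<epsilon>' l = - \<tau>" using \<sigma>\<tau> by simp
          have rl: "r l \<in> J" "\<phi> (r l) = l" "\<epsilon> (r l) = - \<tau>" using r l el by (auto simp: \<epsilon>'_def)
          have "{j\<in>J. \<tau> * (\<epsilon> j * (\<phi> j - l)) > 0} \<subset> ?A"
          proof
            show "{j\<in>J. \<tau> * (\<epsilon> j * (\<phi> j - l)) > 0} \<subseteq> ?A"
            proof safe
              fix j assume j: "j \<in> J" "\<tau> * (\<epsilon> j * (\<phi> j - l)) > 0"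
              have lm: "\<phi> j < s \<Longrightarrow> \<phi> j \<le> l" using lmax[of "\<phi> j"] j by (auto simp: L_def)
              consider "\<epsilon> j = \<tau>" | "\<epsilon> j = - \<tau>" using \<epsilon>[OF j(1)] \<tau> by auto
              then show "\<tau> * (\<epsilon> j * (\<phi> j - s)) > 0"
              proof cases
                case 1
                then have "\<phi> j > l" using j(2) \<tau> by auto
                moreover have "\<phi> j \<noteq> s" using sJ[OF j(1)] 1 \<tau> by auto
                ultimately have "s < \<phi> j" using lm by fastforce
                then show ?thesis using 1 \<tau> by auto
              next
                case 2
                then have "\<phi> j < l" using j(2) \<tau> by auto
                then show ?thesis using 2 \<tau> l by auto
              qed
            qed
            have "r l \<in> ?A" using rl l \<tau> by auto
            moreover have "r l \<notin> {j\<in>J. \<tau> * (\<epsilon> j * (\<phi> j - l)) > 0}" using rl by simp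
            ultimately show "{j\<in>J. \<tau> * (\<epsilon> j * (\<phi> j - l)) > 0} \<noteq> ?A" by blast
          qed
          then have "card {j\<in>J. \<tau> * (\<epsilon> j * (\<phi> j - l)) > 0} < K" using less K by simp
          moreover have "K \<le> card {j\<in>J. \<tau> * (\<epsilon> j * (\<phi> j - l)) > 0}"
            using cnt[of l \<tau>] l L \<tau> by auto
          ultimately show False by simp
        qed
      qed
      then have "\<tau> * \<sigma> = - 1" using \<sigma>1 \<tau> by auto
      then have "sgn (\<tau> * (e0 * inverse (\<Prod>z\<in>Z. sin (z - s)))) = - 1"
        using sgnsum \<tau> by (auto simp: sgn_mult)
      then have "\<tau> * (\<Sum>j\<in>J. w j / (\<rho> j * \<epsilon> j * sin (\<phi> j - s))) < 0"
        unfolding sumw[OF s False] by (simp only: sgn_1_neg)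
      then show ?thesis by blast
    qed
  qed
qed

section \<open>Isotropic subspaces of sesquilinear forms\<close>

text \<open>If \<open>M2\<close> is invertible, an eigenvector of its inverse times
  \<open>M1\<close> works; otherwise a kernel vector of \<open>M2\<close>, which is the eigenvalue
  at infinity, \<open>\<alpha> = 0\<close>. The homogeneous pair treats both alike.\<close>

lemma pencil_kernel_vector:
  fixes M1 M2 :: "complex mat"
  assumes M: "M1 \<in> carrier_mat m m" "M2 \<in> carrier_mat m m" and "m > 0"
  shows "\<exists>c \<alpha> \<beta>. c \<in> carrier_vec m \<and> c \<noteq> 0\<^sub>v m \<and> (\<alpha> \<noteq> 0 \<or> \<beta> \<noteq> 0) \<and>
           \<alpha> \<cdot>\<^sub>v (M1 *\<^sub>v c) = \<beta> \<cdot>\<^sub>v (M2 *\<^sub>v c)"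
proof (cases "Determinant.det M2 = 0")
  case True
  then obtain c where "c \<in> carrier_vec m" "c \<noteq> 0\<^sub>v m" "M2 *\<^sub>v c = 0\<^sub>v m"
    using det_0_iff_vec_prod_zero_field[OF M(2)] by auto
  then show ?thesis using M by (intro exI[of _ c] exI[of _ 0] exI[of _ 1]) auto
next
  case False
  from det_non_zero_imp_unit[OF M(2) this] obtain N where
    N: "N \<in> carrier_mat m m" "N * M2 = 1\<^sub>m m" "M2 * N = 1\<^sub>m m"
    by (auto simp: Units_def ring_mat_def)
  have NM: "N * M1 \<in> carrier_mat m m" using N M by auto
  from spectrum_non_empty[OF NM] \<open>m > 0\<close> obtain ev where "eigenvalue (N * M1) ev"
    by (auto simp: spectrum_def)
  then obtain c where c: "c \<in> carrier_vec m" "c \<noteq> 0\<^sub>v m" "(N * M1) *\<^sub>v c = ev \<cdot>\<^sub>v c"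
    using NM by (auto simp: eigenvalue_def eigenvector_def)
  have "M1 *\<^sub>v c = (M2 * N) *\<^sub>v (M1 *\<^sub>v c)" using N M c by simp
  also have "\<dots> = M2 *\<^sub>v (N *\<^sub>v (M1 *\<^sub>v c))"
    by (rule assoc_mult_mat_vec[OF M(2) N(1)]) (use M c in simp)
  also have "N *\<^sub>v (M1 *\<^sub>v c) = (N * M1) *\<^sub>v c"
    by (rule assoc_mult_mat_vec[OF N(1) M(1) c(1), symmetric])
  also have "M2 *\<^sub>v ((N * M1) *\<^sub>v c) = M2 *\<^sub>v (ev \<cdot>\<^sub>v c)" using c by simp
  also have "\<dots> = ev \<cdot>\<^sub>v (M2 *\<^sub>v c)" using c M by (simp add: mult_mat_vec[OF M(2)])
  finally show ?thesis using c by (intro exI[of _ c] exI[of _ 1] exI[of _ ev]) auto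
qed

lemma signed_angle:
  fixes d :: complex
  assumes "d \<noteq> 0"
  shows "\<exists>\<phi> \<epsilon>. \<phi> \<in> {0..<pi} \<and> \<epsilon> \<in> {- 1, 1 :: real} \<and> d = complex_of_real (cmod d * \<epsilon>) * cis \<phi>"
proof -
  have d: "d = complex_of_real (cmod d) * cis (Arg d)"
    using rcis_cmod_Arg[of d] by (simp add: rcis_def)
  have b: "- pi < Arg d" "Arg d \<le> pi" using Arg_bounded by auto
  consider "0 \<le> Arg d" "Arg d < pi" | "Arg d = pi" | "Arg d < 0" using b by linarith
  then show ?thesis
  proof cases
    case 1
    then show ?thesis using d by (intro exI[of _ "Arg d"] exI[of _ 1]) auto
  next
    case 2
    then show ?thesis using d by (intro exI[of _ 0] exI[of _ "- 1"]) auto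
  next
    case 3
    have "cis (Arg d + pi) = - cis (Arg d)" by (simp add: complex_eq_iff)
    then show ?thesis using d b 3 by (intro exI[of _ "Arg d + pi"] exI[of _ "- 1"]) auto
  qed
qed

text \<open>\<open>s\<close> is \<theta> turned back by a quarter turn and reduced modulo
  \<open>pi\<close>; \<tau> is the parity of the removed half-turns.\<close>

lemma direction_reduction:
  "\<exists>s \<tau>. s \<in> {0..<pi} \<and> \<tau> \<in> {- 1, 1 :: real} \<and> (\<forall>\<phi>. cos (\<phi> - \<theta>) = \<tau> * sin (\<phi> - s))"
proof -
  define m where "m = \<lfloor>(\<theta> - pi / 2) / pi\<rfloor>"
  define s where "s = \<theta> - pi / 2 - of_int m * pi"
  define \<tau> where "\<tau> = (if even m then 1 else - 1 :: real)"
  have "of_int m \<le> (\<theta> - pi / 2) / pi" "(\<theta> - pi / 2) / pi < of_int m + 1"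
    unfolding m_def by linarith+
  then have "of_int m * pi \<le> \<theta> - pi / 2" "\<theta> - pi / 2 < (of_int m + 1) * pi"
    by (simp_all add: pos_le_divide_eq pos_divide_less_eq)
  then have "s \<in> {0..<pi}" by (auto simp: s_def algebra_simps)
  moreover have "cos (\<phi> - \<theta>) = \<tau> * sin (\<phi> - s)" for \<phi>
  proof -
    have "cos (\<phi> - \<theta>) = cos ((\<phi> - s - pi / 2) - pi * of_int m)" by (simp add: s_def algebra_simps)
    also have "\<dots> = cos (\<phi> - s - pi / 2) * cos (pi * of_int m)"
      by (simp add: cos_diff[of "\<phi> - s - pi / 2"] sin_npi_int)
    also have "\<dots> = \<tau> * sin (\<phi> - s)"
      by (simp add: cos_npi_int \<tau>_def cos_diff[of "\<phi> - s"])
    finally show ?thesis .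
  qed
  moreover have "\<tau> \<in> {- 1, 1}" by (auto simp: \<tau>_def)
  ultimately show ?thesis by blast
qed

section \<open>Sesquilinear forms and eigenvectors of their pencils\<close>

text \<open>No symmetry is assumed, because the form of \<open>A - \<mu>\<close> has none. The
  abstract space lets inductions pass to subspaces without choosing coordinates.\<close>

locale sesquilinear_form = vector_space scale
  for scale :: "complex \<Rightarrow> 'v::ab_group_add \<Rightarrow> 'v" +
  fixes a :: "'v \<Rightarrow> 'v \<Rightarrow> complex"
  assumes add_left: "a (x + y) z = a x z + a y z"
    and add_right: "a x (y + z) = a x y + a x z"
    and scale_left: "a (scale c x) y = cnj c * a x y"
    and scale_right: "a x (scale c y) = c * a x y"
begin

lemma zero_left [simp]: "a 0 y = 0" using scale_left[of 0 0 y] by simp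
lemma zero_right [simp]: "a x 0 = 0" using scale_right[of x 0 0] by simp

lemma diff_left: "a (x - y) z = a x z - a y z"
  using add_left[of "x - y" y z] by simp
lemma diff_right: "a x (y - z) = a x y - a x z"
  using add_right[of x "y - z" z] by simp

lemma sum_left: "a (sum f J) y = (\<Sum>j\<in>J. a (f j) y)"
  by (induction J rule: infinite_finite_induct) (auto simp: add_left)
lemma sum_right: "a x (sum f J) = (\<Sum>j\<in>J. a x (f j))"
  by (induction J rule: infinite_finite_induct) (auto simp: add_right)

lemmas sesq = add_left add_right scale_left scale_right diff_left diff_right

definition functional :: "('v \<Rightarrow> complex) \<Rightarrow> bool" where
  "functional \<phi> \<longleftrightarrow> (\<forall>x y. \<phi> (x + y) = \<phi> x + \<phi> y) \<and> (\<forall>c x. \<phi> (scale c x) = c * \<phi> x)"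

lemma functional_sum: "functional \<phi> \<Longrightarrow> \<phi> (\<Sum>j\<in>J. scale (c j) (f j)) = (\<Sum>j\<in>J. c j * \<phi> (f j))"
proof (induction J rule: infinite_finite_induct)
  case (infinite J)
  then show ?case by (metis functional_def mult_zero_left scale_zero_left sum.infinite)
next
  case empty
  then show ?case by (metis functional_def mult_zero_left scale_zero_left sum.empty)
next
  case (insert x F)
  then show ?case by (simp add: functional_def)
qed

text \<open>The hermitian form \<open>h\<close> has at least \<open>k\<close> positive eigenvalues on \<open>W\<close>, in the
  Courant--Fischer form that restricts well to hyperplanes.\<close>

definition positive_rank :: "('v \<Rightarrow> real) \<Rightarrow> 'v set \<Rightarrow> nat \<Rightarrow> bool" where
  "positive_rank h W k \<longleftrightarrow> (\<forall>\<phi>s. length \<phi>s < k \<longrightarrow> (\<forall>\<phi>\<in>set \<phi>s. functional \<phi>) \<longrightarrow>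
     (\<exists>u\<in>W. (\<forall>\<phi>\<in>set \<phi>s. \<phi> u = 0) \<and> h u > 0))"

text \<open>If \<open>a\<close> is the form of \<open>A\<close>, this is the quadratic form of
  \<open>H \<theta>\<close>, the hermitian part of \<open>cis (- \<theta>)\<close> times
  \<open>A\<close>.\<close>

definition rot :: "real \<Rightarrow> 'v \<Rightarrow> real" where
  "rot \<theta> u = Re (cis (- \<theta>) * a u u)"

text \<open>The functionals \<open>a x\<close> and \<open>\<lambda>y. cnj (a y x)\<close> are
  dependent on \<open>W\<close>, so their common kernel has codimension at most one there. Allowing
  one of \<alpha>, \<beta> to vanish covers the eigenvalues zero and infinity.\<close>

definition pencil_eigenvector :: "'v set \<Rightarrow> 'v \<Rightarrow> bool" where
  "pencil_eigenvector W x \<longleftrightarrow> x \<in> W \<and> x \<noteq> 0 \<and>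
     (\<exists>\<alpha> \<beta>. (\<alpha> \<noteq> 0 \<or> \<beta> \<noteq> 0) \<and> (\<forall>y\<in>W. \<alpha> * a x y = \<beta> * cnj (a y x)))"

definition finite_dim :: "'v set \<Rightarrow> bool" where
  "finite_dim W \<longleftrightarrow> subspace W \<and> (\<exists>F. finite F \<and> W \<subseteq> span F)"

lemma finite_dim_subset: "finite_dim W \<Longrightarrow> subspace U \<Longrightarrow> U \<subseteq> W \<Longrightarrow> finite_dim U"
  unfolding finite_dim_def by blast

lemma finite_dim_basis:
  assumes "finite_dim W"
  obtains B where "B \<subseteq> W" "independent B" "W = span B" "finite B" "card B = dim W"
proof -
  obtain F where F: "finite F" "W \<subseteq> span F" "subspace W" using assms by (auto simp: finite_dim_def)
  obtain B where B: "B \<subseteq> W" "independent B" "W \<subseteq> span B" "card B = dim W"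
    using basis_exists by blast
  have "finite B" using independent_span_bound[OF F(1) B(2)] B F by blast
  moreover have "W = span B" using B F span_minimal by blast
  ultimately show ?thesis using that B by blast
qed

lemma dim_psubset:
  assumes "finite_dim W" "subspace U" "U \<subset> W"
  shows "dim U < dim W"
proof -
  obtain B where B: "B \<subseteq> W" "independent B" "W = span B" "finite B" "card B = dim W"
    using finite_dim_basis[OF assms(1)] .
  have "finite_dim U" using finite_dim_subset assms by blast
  then obtain C where C: "C \<subseteq> U" "independent C" "U = span C" "finite C" "card C = dim U"
    using finite_dim_basis by blast
  obtain x where x: "x \<in> W" "x \<notin> U" using assms by auto
  then have "independent (insert x C)" using C independent_insertI by blast
  moreover have "insert x C \<subseteq> span B" using x C B assms by blast
  ultimately have "card (insert x C) \<le> card B" using independent_span_bound[OF B(4)] by blast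
  moreover have "x \<notin> C" using x C by blast
  ultimately show ?thesis using B C by simp
qed

lemma pencil_eigenvector_exists:
  assumes W: "finite_dim W" and "W \<noteq> {0}"
  shows "\<exists>x. pencil_eigenvector W x"
proof -
  obtain B where B: "B \<subseteq> W" "independent B" "W = span B" "finite B"
    using finite_dim_basis[OF W] by blast
  define m where "m = card B"
  obtain b where b: "bij_betw b {..<m} B"
    using ex_bij_betw_nat_finite[OF B(4)] by (auto simp: m_def atLeast0LessThan)
  have "B \<noteq> {}" using B assms by auto
  then have m: "m > 0" using B by (auto simp: m_def card_gt_0_iff)
  \<comment> \<open>Conjugation makes this side linear in the coefficients \<open>c\<close>, like
    \<open>M2\<close>; undoing it leads to the witnesses \<open>cnj \<alpha>\<close> and
    \<open>cnj \<beta>\<close>.\<close>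
  define M1 where "M1 = mat m m (\<lambda>(j, i). cnj (a (b i) (b j)))"
  define M2 where "M2 = mat m m (\<lambda>(j, i). a (b j) (b i))"
  have "M1 \<in> carrier_mat m m" "M2 \<in> carrier_mat m m" by (auto simp: M1_def M2_def)
  from pencil_kernel_vector[OF this m] obtain c \<alpha> \<beta> where
    c: "c \<in> carrier_vec m" "c \<noteq> 0\<^sub>v m" and ab: "\<alpha> \<noteq> 0 \<or> \<beta> \<noteq> 0"
    and eq: "\<alpha> \<cdot>\<^sub>v (M1 *\<^sub>v c) = \<beta> \<cdot>\<^sub>v (M2 *\<^sub>v c)" by blast
  define x where "x = (\<Sum>i<m. scale (c $ i) (b i))"
  have e1: "cnj (a x (b j)) = (M1 *\<^sub>v c) $ j" if "j < m" for j
    using that c by (simp add: x_def M1_def sum_left scale_left scalar_prod_def mult.commute atLeast0LessThan)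
  have e2: "a (b j) x = (M2 *\<^sub>v c) $ j" if "j < m" for j
    using that c by (simp add: x_def M2_def sum_right scale_right scalar_prod_def mult.commute atLeast0LessThan)
  have e: "\<alpha> * cnj (a x (b j)) = \<beta> * a (b j) x" if "j < m" for j
  proof -
    have "(\<alpha> \<cdot>\<^sub>v (M1 *\<^sub>v c)) $ j = (\<beta> \<cdot>\<^sub>v (M2 *\<^sub>v c)) $ j" using eq by simp
    then show ?thesis using that e1 e2 by (simp add: M1_def M2_def)
  qed
  have eB: "cnj \<alpha> * a x y = cnj \<beta> * cnj (a y x)" if "y \<in> B" for y
  proof -
    have "y \<in> b ` {..<m}" using that b by (simp add: bij_betw_def)
    then obtain j where "j < m" "y = b j" by auto
    then show ?thesis using arg_cong[OF e, of j cnj] by simp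
  qed
  have eW: "cnj \<alpha> * a x y = cnj \<beta> * cnj (a y x)" if "y \<in> W" for y
    using that unfolding B(3)
  proof (induction rule: span_induct_alt)
    case base
    then show ?case by simp
  next
    case (step t z y)
    then show ?case using eB[of z] by (simp add: sesq distrib_left mult.left_commute)
  qed
  have "x \<noteq> 0"
  proof
    assume "x = 0"
    have inj: "inj_on b {..<m}" and im: "b ` {..<m} = B" using b by (auto simp: bij_betw_def)
    have "x = (\<Sum>v\<in>B. scale (c $ (the_inv_into {..<m} b v)) v)"
      unfolding x_def im[symmetric] sum.reindex[OF inj]
      by (intro sum.cong) (auto simp: the_inv_into_f_f[OF inj])
    then have "(\<Sum>v\<in>B. scale (c $ (the_inv_into {..<m} b v)) v) = 0" using \<open>x = 0\<close> by simp
    then have z: "c $ (the_inv_into {..<m} b v) = 0" if "v \<in> B" for v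
      using independentD[OF B(2) B(4) order.refl, where u = "\<lambda>v. c $ (the_inv_into {..<m} b v)"] that by blast
    have "c $ i = 0" if "i < m" for i
      using z[of "b i"] that im by (auto simp: the_inv_into_f_f[OF inj])
    then show False using c by (metis carrier_vecD eq_vecI index_zero_vec)
  qed
  moreover have "x \<in> W" unfolding x_def B(3) 
    using b by (intro span_sum span_scale span_base) (auto simp: bij_betw_def)
  ultimately show ?thesis unfolding pencil_eigenvector_def using eW ab
    by (intro exI[of _ x] conjI exI[of _ "cnj \<alpha>"] exI[of _ "cnj \<beta>"]) auto
qed

text \<open>For a nonisotropic eigenvector \<open>x\<close> both multipliers are nonzero, so its
  left and right complements in \<open>W\<close> agree and \<open>x\<close> splits off. An isotropic
  eigenvector of the complement stays one for \<open>W\<close>, since it is orthogonal to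
  \<open>x\<close> on both sides; if none appears, the vectors split off form the basis.\<close>

lemma isotropic_eigenvector_or_orthogonal_basis:
  assumes "finite_dim W"
  shows "(\<exists>x. pencil_eigenvector W x \<and> a x x = 0) \<or>
    (\<exists>N e. (\<forall>j<N. e j \<in> W \<and> a (e j) (e j) \<noteq> 0) \<and> (\<forall>i<N. \<forall>j<N. i \<noteq> j \<longrightarrow> a (e i) (e j) = 0) \<and>
       (\<forall>y\<in>W. y = (\<Sum>j<N::nat. scale (a (e j) y / a (e j) (e j)) (e j))))"
  using assms
proof (induction "dim W" arbitrary: W rule: less_induct)
  case less
  note W = less.prems
  have sub: "subspace W" using W by (simp add: finite_dim_def)
  show ?case
  proof (cases "W = {0}")
    case True
    then show ?thesis by (intro disjI2 exI[of _ 0]) auto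
  next
    case False
    obtain x where x: "pencil_eigenvector W x" using pencil_eigenvector_exists[OF W False] by blast
    show ?thesis
    proof (cases "a x x = 0")
      case True
      then show ?thesis using x by blast
    next
      case d: False
      obtain \<alpha> \<beta> where xW: "x \<in> W" "x \<noteq> 0" and ab: "\<alpha> \<noteq> 0 \<or> \<beta> \<noteq> 0"
        and eig: "\<And>y. y \<in> W \<Longrightarrow> \<alpha> * a x y = \<beta> * cnj (a y x)"
        using x by (auto simp: pencil_eigenvector_def)
      have ab': "\<alpha> \<noteq> 0" "\<beta> \<noteq> 0" using ab eig[OF xW(1)] d by auto
      define U where "U = {y\<in>W. a x y = 0}"
      have Uleft: "a y x = 0" if "y \<in> U" for y using that eig[of y] ab' by (auto simp: U_def)
      have Usub: "subspace U" using sub unfolding U_def subspace_def by (auto simp: sesq)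
      have UW: "U \<subset> W" using xW d by (auto simp: U_def)
      have proj: "y - scale (a x y / a x x) x \<in> U" if "y \<in> W" for y
        using that xW sub d by (auto simp: U_def sesq intro!: subspace_diff subspace_scale)
      have "finite_dim U" using finite_dim_subset[OF W Usub] UW by blast
      from less.hyps[OF dim_psubset[OF W Usub UW] this] show ?thesis
      proof (elim disjE exE conjE)
        fix z assume z: "pencil_eigenvector U z" "a z z = 0"
        obtain \<alpha>' \<beta>' where zU: "z \<in> U" "z \<noteq> 0" and ab2: "\<alpha>' \<noteq> 0 \<or> \<beta>' \<noteq> 0"
          and eig2: "\<And>y. y \<in> U \<Longrightarrow> \<alpha>' * a z y = \<beta>' * cnj (a y z)"
          using z by (auto simp: pencil_eigenvector_def)
        have "\<alpha>' * a z y = \<beta>' * cnj (a y z)" if "y \<in> W" for y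
          using eig2[OF proj[OF that]] zU Uleft[OF zU(1)] by (simp add: sesq U_def)
        then have "pencil_eigenvector W z" using zU UW ab2 by (auto simp: pencil_eigenvector_def)
        then show ?thesis using z by blast
      next
        fix N :: nat and e
        assume e: "\<forall>j<N. e j \<in> U \<and> a (e j) (e j) \<noteq> 0"
          "\<forall>i<N. \<forall>j<N. i \<noteq> j \<longrightarrow> a (e i) (e j) = 0"
          "\<forall>y\<in>U. y = (\<Sum>j<N. scale (a (e j) y / a (e j) (e j)) (e j))"
        define f where "f = e(N := x)"
        have f: "f j = e j" if "j < N" for j using that by (simp add: f_def)
        have fN: "f N = x" by (simp add: f_def)
        have o1: "a (e j) x = 0" "a x (e j) = 0" if "j < N" for j
          using e(1) that Uleft by (auto simp: U_def)
        have exp: "y = (\<Sum>j<Suc N. scale (a (f j) y / a (f j) (f j)) (f j))" if "y \<in> W" for y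
        proof -
          have "y - scale (a x y / a x x) x = (\<Sum>j<N. scale (a (e j) (y - scale (a x y / a x x) x) / a (e j) (e j)) (e j))"
            using e(3) proj[OF that] by blast
          also have "\<dots> = (\<Sum>j<N. scale (a (f j) y / a (f j) (f j)) (f j))"
            using o1 f by (intro sum.cong) (auto simp: sesq)
          finally show ?thesis by (simp add: fN algebra_simps)
        qed
        have "\<forall>j<Suc N. f j \<in> W \<and> a (f j) (f j) \<noteq> 0"
          using e(1) f fN xW d UW by (metis less_Suc_eq psubsetD)
        moreover have "\<forall>i<Suc N. \<forall>j<Suc N. i \<noteq> j \<longrightarrow> a (f i) (f j) = 0"
          using e(2) f fN o1 by (metis less_Suc_eq)
        ultimately show ?thesis using exp by blast
      qed
    qed
  qed
qed

lemma orthogonal_combination: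
  fixes N :: nat
  assumes "\<forall>i<N. \<forall>j<N. i \<noteq> j \<longrightarrow> a (e i) (e j) = 0" and "i < N"
  shows "a (e i) (\<Sum>j<N. scale (x j) (e j)) = x i * a (e i) (e i)"
proof -
  have "a (e i) (\<Sum>j<N. scale (x j) (e j)) = (\<Sum>j<N. x j * a (e i) (e j))"
    by (simp add: sum_right scale_right)
  also have "\<dots> = (\<Sum>j<N. if i = j then x j * a (e i) (e j) else 0)"
    using assms by (intro sum.cong) auto
  finally show ?thesis using assms(2) by simp
qed

lemma rot_combination:
  fixes N :: nat
  assumes "\<forall>i<N. \<forall>j<N. i \<noteq> j \<longrightarrow> a (e i) (e j) = 0"
  shows "rot \<theta> (\<Sum>j<N. scale (x j) (e j)) = (\<Sum>j<N. (cmod (x j))\<^sup>2 * rot \<theta> (e j))"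
proof -
  have "a (\<Sum>j<N. scale (x j) (e j)) (\<Sum>j<N. scale (x j) (e j)) = (\<Sum>i<N. cnj (x i) * (x i * a (e i) (e i)))"
    unfolding sum_left scale_left
    by (intro sum.cong refl) (simp add: orthogonal_combination[OF assms])
  also have "\<dots> = (\<Sum>i<N. of_real ((cmod (x i))\<^sup>2) * a (e i) (e i))"
    by (intro sum.cong refl) (simp only: complex_norm_square mult_ac)
  finally have "rot \<theta> (\<Sum>j<N. scale (x j) (e j)) =
      Re (cis (- \<theta>) * (\<Sum>i<N. of_real ((cmod (x i))\<^sup>2) * a (e i) (e i)))"
    by (simp only: rot_def)
  also have "\<dots> = (\<Sum>i<N. Re (cis (- \<theta>) * (of_real ((cmod (x i))\<^sup>2) * a (e i) (e i))))"
    by (simp only: sum_distrib_left Re_sum)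
  also have "\<dots> = (\<Sum>j<N. (cmod (x j))\<^sup>2 * rot \<theta> (e j))"
    by (intro sum.cong refl) (simp add: rot_def algebra_simps flip: of_real_power)
  finally show ?thesis .
qed

lemma functional_a: "functional (\<lambda>y. c * a x y)"
  by (simp add: functional_def sesq distrib_left)

lemma functional_sum_fun: "(\<And>j. j \<in> J \<Longrightarrow> functional (f j)) \<Longrightarrow> functional (\<lambda>y. \<Sum>j\<in>J. c j * f j y)"
  by (simp add: functional_def sum.distrib distrib_left sum_distrib_left mult.left_commute)

lemma rot_cos:
  assumes "a u u = complex_of_real r * cis \<phi>"
  shows "rot \<theta> u = r * cos (\<phi> - \<theta>)"
proof -
  have "cis (- \<theta>) * a u u = of_real r * cis (\<phi> - \<theta>)"
    by (simp add: assms cis_mult mult.left_commute)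
  then show ?thesis by (simp add: rot_def)
qed

text \<open>If \<open>d i\<close> and \<open>d j\<close> lie on opposite rays then a combination of the two basis vectors is an
  isotropic eigenvector of the pencil.\<close>

lemma no_antipodal:
  assumes W: "finite_dim W" and no: "\<And>x. pencil_eigenvector W x \<Longrightarrow> a x x \<noteq> 0"
    and e: "\<forall>j<N. e j \<in> W \<and> a (e j) (e j) \<noteq> 0"
    and orth: "\<forall>i<N. \<forall>j<N. i \<noteq> j \<longrightarrow> a (e i) (e j) = 0"
    and exp: "\<forall>y\<in>W. y = (\<Sum>j<N::nat. scale (a (e j) y / a (e j) (e j)) (e j))"
    and ij: "i < N" "j < N" and opp: "a (e i) (e i) = - of_real \<rho> * a (e j) (e j)" and "\<rho> > 0"
  shows False
proof -
  \<comment> \<open>The coefficient \<open>sqrt \<rho>\<close> makes the two diagonal entries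
    cancel. As these entries are real multiples of \<open>D\<close>, the multipliers
    \<open>cnj D\<close> and \<open>D\<close> work on every basis vector.\<close>
  define x where "x = e i + scale (sqrt \<rho>) (e j)"
  have neq: "i \<noteq> j"
  proof
    assume "i = j"
    then have "a (e j) (e j) + of_real \<rho> * a (e j) (e j) = 0"
      using arg_cong[OF opp, of "\<lambda>z. z + of_real \<rho> * a (e j) (e j)"] by simp
    then have "a (e j) (e j) * (1 + of_real \<rho>) = 0" by (simp add: algebra_simps)
    moreover have "1 + complex_of_real \<rho> \<noteq> 0" using \<open>\<rho> > 0\<close>
      by (simp add: complex_eq_iff)
    ultimately show False using e ij by simp
  qed
  have o: "a (e i) (e j) = 0" "a (e j) (e i) = 0" using orth ij neq by auto
  have sq: "complex_of_real (sqrt \<rho>) * complex_of_real (sqrt \<rho>) = of_real \<rho>"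
    using \<open>\<rho> > 0\<close> by (simp flip: of_real_mult)
  have iso: "a x x = 0" by (simp add: x_def sesq o opp sq flip: mult.assoc)
  define D where "D = a (e j) (e j)"
  have basis: "cnj D * a x y = D * cnj (a y x)" if "y = e l" "l < N" for y l
  proof -
    consider "l = i" | "l = j" | "l \<noteq> i" "l \<noteq> j" by blast
    then show ?thesis
    proof cases
      case 1
      then show ?thesis using that by (simp add: x_def sesq o opp D_def)
    next
      case 2
      then show ?thesis using that by (simp add: x_def sesq o D_def)
    next
      case 3
      then have "a (e l) (e i) = 0" "a (e l) (e j) = 0" "a (e i) (e l) = 0" "a (e j) (e l) = 0"
        using orth ij that by auto
      then show ?thesis using that by (simp add: x_def sesq)
    qed
  qed
  have "cnj D * a x y = D * cnj (a y x)" if "y \<in> W" for y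
  proof -
    define t where "t = (\<lambda>j. a (e j) y / a (e j) (e j))"
    have y: "y = (\<Sum>j<N. scale (t j) (e j))" using exp that by (simp add: t_def)
    have "cnj D * a x y = (\<Sum>l<N. t l * (cnj D * a x (e l)))"
      by (subst y) (simp add: sum_right scale_right sum_distrib_left mult.left_commute)
    also have "\<dots> = (\<Sum>l<N. t l * (D * cnj (a (e l) x)))" using basis by simp
    also have "\<dots> = D * cnj (a y x)"
      by (subst y) (simp add: sum_left scale_left sum_distrib_left mult.left_commute)
    finally show ?thesis .
  qed
  moreover have "x \<noteq> 0"
  proof
    assume "x = 0"
    then have "a (e i) x = 0" by simp
    then show False using e ij by (simp add: x_def sesq o)
  qed
  moreover have "x \<in> W" unfolding x_def using W e ij
    by (intro subspace_add subspace_scale) (auto simp: finite_dim_def)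
  moreover have "D \<noteq> 0" using e ij by (simp add: D_def)
  ultimately have "pencil_eigenvector W x" unfolding pencil_eigenvector_def
    by (intro conjI exI[of _ "cnj D"] exI[of _ D]) auto
  then show False using no iso by blast
qed

section \<open>Positive rank and its restriction to hyperplanes\<close>

text \<open>Half of Sylvester's law of inertia: once the coordinates with positive entries are
  required to vanish, the form is nonpositive, so there must be at least \<open>k\<close> of
  them.\<close>

lemma positive_rank_card:
  assumes e: "\<forall>j<N. e j \<in> W \<and> a (e j) (e j) \<noteq> 0"
    and orth: "\<forall>i<N. \<forall>j<N. i \<noteq> j \<longrightarrow> a (e i) (e j) = 0"
    and exp: "\<forall>y\<in>W. y = (\<Sum>j<N::nat. scale (a (e j) y / a (e j) (e j)) (e j))"
    and pos: "positive_rank (rot \<theta>) W k"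
  shows "k \<le> card {j\<in>{..<N}. rot \<theta> (e j) > 0}"
proof (rule ccontr)
  let ?P = "{j\<in>{..<N}. rot \<theta> (e j) > 0}"
  define \<phi>s where "\<phi>s = map (\<lambda>j y. 1 / a (e j) (e j) * a (e j) y) (sorted_list_of_set ?P)"
  assume "\<not> k \<le> card ?P"
  then have "length \<phi>s < k" by (simp add: \<phi>s_def)
  moreover have "\<forall>\<phi>\<in>set \<phi>s. functional \<phi>" unfolding \<phi>s_def set_map using functional_a by blast
  ultimately obtain u where u: "u \<in> W" "\<forall>\<phi>\<in>set \<phi>s. \<phi> u = 0" "rot \<theta> u > 0"
    using pos unfolding positive_rank_def by blast
  have z: "a (e j) u = 0" if "j \<in> ?P" for j
    using u(2) that e by (auto simp: \<phi>s_def)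
  define t where "t = (\<lambda>j. a (e j) u / a (e j) (e j))"
  have "u = (\<Sum>j<N. scale (t j) (e j))" using exp u(1) by (simp add: t_def)
  then have "rot \<theta> u = (\<Sum>j<N. (cmod (t j))\<^sup>2 * rot \<theta> (e j))" using rot_combination[OF orth] by metis
  also have "\<dots> \<le> 0"
  proof (rule sum_nonpos)
    fix j assume "j \<in> {..<N}"
    then show "(cmod (t j))\<^sup>2 * rot \<theta> (e j) \<le> 0"
      using z[of j] by (cases "rot \<theta> (e j) > 0") (auto simp: t_def mult_nonneg_nonpos)
  qed
  finally show False using u(3) by simp
qed

text \<open>Where \<open>H \<theta>\<close> is nondegenerate, restricting it to the hyperplane costs a negative instead of a
  positive eigenvalue iff \<open>\<Sum>j<N. w j / rot \<theta> (e j)\<close> is negative; this is needed only if the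
  number of positive eigenvalues is critical.\<close>

lemma positive_rank_hyperplane:
  fixes N :: nat
  assumes e: "\<forall>j<N. e j \<in> W \<and> a (e j) (e j) \<noteq> 0" and W: "subspace W"
    and orth: "\<forall>i<N. \<forall>j<N. i \<noteq> j \<longrightarrow> a (e i) (e j) = 0"
    and w: "\<And>j. j < N \<Longrightarrow> w j \<ge> (0::real)"
    and U: "U = {y\<in>W. (\<Sum>j<N. of_real (sqrt (w j)) * (1 / a (e j) (e j) * a (e j) y)) = 0}"
    and k: "k \<le> card {j\<in>{..<N}. rot \<theta> (e j) > 0}"
    and crit: "k = card {j\<in>{..<N}. rot \<theta> (e j) > 0} \<Longrightarrow>
        (\<exists>z<N. w z \<noteq> 0 \<and> rot \<theta> (e z) = 0) \<or> (\<Sum>j<N. w j / rot \<theta> (e j)) < 0"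
  shows "positive_rank (rot \<theta>) U k"
  unfolding positive_rank_def
proof (intro allI impI)
  fix \<phi>s :: "('v \<Rightarrow> complex) list"
  assume len: "length \<phi>s < k" and fn: "\<forall>\<phi>\<in>set \<phi>s. functional \<phi>"
  define h where "h = (\<lambda>j. rot \<theta> (e j))"
  define v where "v = (\<lambda>j. complex_of_real (sqrt (w j)))"
  define P where "P = {j\<in>{..<N}. h j > 0}"
  have P: "finite P" "P \<subseteq> {..<N}" by (auto simp: P_def intro: finite_subset[of _ "{..<N}"])
  have memU: "(\<Sum>j<N. scale (x j) (e j)) \<in> U \<longleftrightarrow> (\<Sum>j<N. v j * x j) = 0" for x
  proof -
    have "(\<Sum>j<N. scale (x j) (e j)) \<in> W" using e W by (intro subspace_sum subspace_scale) auto
    moreover have "(\<Sum>j<N. of_real (sqrt (w j)) * (1 / a (e j) (e j) * a (e j) (\<Sum>i<N. scale (x i) (e i)))) =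
        (\<Sum>j<N. v j * x j)"
      using e by (intro sum.cong refl) (simp add: orthogonal_combination[OF orth] v_def)
    ultimately show ?thesis unfolding U by simp
  qed
  have rotx: "rot \<theta> (\<Sum>j<N. scale (x j) (e j)) = (\<Sum>j<N. (cmod (x j))\<^sup>2 * h j)" for x
    using rot_combination[OF orth] by (simp add: h_def)
  have \<phi>x: "\<phi> (\<Sum>j<N. scale (x j) (e j)) = (\<Sum>j<N. x j * \<phi> (e j))" if "\<phi> \<in> set \<phi>s" for \<phi> x
    using functional_sum fn that by blast
  have crest: "(\<Sum>j<N. (if j \<in> P then c j else 0) * f j) = (\<Sum>j\<in>P. c j * f j)" for c f :: "nat \<Rightarrow> complex"
    using P(2) by (subst sum.mono_neutral_right[of "{..<N}" P]) auto
  have pos: "(\<Sum>j\<in>P. (cmod (c j))\<^sup>2 * h j) > 0" if "\<exists>j\<in>P. c j \<noteq> 0" for c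
    using that P(1) by (auto simp: P_def intro!: sum_pos2)
  show "\<exists>u\<in>U. (\<forall>\<phi>\<in>set \<phi>s. \<phi> u = 0) \<and> rot \<theta> u > 0"
  proof (cases "k = card P")
    case False
    \<comment> \<open>One positive coordinate is to spare, so the equation of \<open>U\<close> is
      imposed along with the functionals.\<close>
    then have "length (map (\<lambda>\<phi> j. \<phi> (e j)) \<phi>s @ [v]) < card P"
      using k len by (simp add: P_def h_def)
    from underdetermined_system[OF P(1) this] obtain c where c: "\<exists>j\<in>P. c j \<noteq> 0"
      "\<forall>r\<in>set (map (\<lambda>\<phi> j. \<phi> (e j)) \<phi>s @ [v]). (\<Sum>j\<in>P. c j * r j) = 0" by blast
    define x where "x = (\<lambda>j. if j \<in> P then c j else 0)"
    have "(\<Sum>j<N. v j * x j) = 0" using c(2) crest[of c v] by (simp add: x_def mult.commute)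
    moreover have "(\<Sum>j<N. x j * \<phi> (e j)) = 0" if "\<phi> \<in> set \<phi>s" for \<phi>
      using c(2) crest[of c "\<lambda>j. \<phi> (e j)"] that by (simp add: x_def)
    moreover have "(\<Sum>j<N. (cmod (x j))\<^sup>2 * h j) = (\<Sum>j\<in>P. (cmod (c j))\<^sup>2 * h j)"
      unfolding x_def using P(2) by (subst sum.mono_neutral_right[of "{..<N}" P]) auto
    ultimately show ?thesis using pos[OF c(1)] memU rotx \<phi>x
      by (intro bexI[of _ "\<Sum>j<N. scale (x j) (e j)"]) auto
  next
    case True
    text \<open>The correction term \<open>f\<close> pushes a vector supported on \<open>P\<close> into \<open>U\<close> without decreasing
      the form.\<close>
    obtain f :: "nat \<Rightarrow> complex" where f: "(\<Sum>j<N. v j * f j) = 1"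
      and inc: "\<And>c. \<exists>j\<in>P. c j \<noteq> 0 \<Longrightarrow>
        (\<Sum>j<N. (cmod ((if j \<in> P then c j else 0) - (\<Sum>j\<in>P. c j * v j) * f j))\<^sup>2 * h j) > 0"
    proof -
      have "(\<exists>z<N. w z \<noteq> 0 \<and> h z = 0) \<or> (\<Sum>j<N. w j / h j) < 0"
        using crit True by (simp add: h_def P_def)
      then show ?thesis
      proof (elim disjE exE conjE)
        fix z assume z: "z < N" "w z \<noteq> 0" "h z = 0"
        define f where "f = (\<lambda>j. if j = z then 1 / v z else 0)"
        have zP: "z \<notin> P" using z by (simp add: P_def)
        have "v z \<noteq> 0" using z by (simp add: v_def)
        have "(\<Sum>j<N. v j * f j) = (\<Sum>j<N. if j = z then 1 else 0)"
          using \<open>v z \<noteq> 0\<close> by (intro sum.cong) (auto simp: f_def)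
        then have "(\<Sum>j<N. v j * f j) = 1" using z by simp
        moreover have "(\<Sum>j<N. (cmod ((if j \<in> P then c j else 0) - (\<Sum>j\<in>P. c j * v j) * f j))\<^sup>2 * h j) > 0"
          if "\<exists>j\<in>P. c j \<noteq> 0" for c
        proof -
          have "(\<Sum>j<N. (cmod ((if j \<in> P then c j else 0) - (\<Sum>j\<in>P. c j * v j) * f j))\<^sup>2 * h j)
              = (\<Sum>j\<in>P. (cmod (c j))\<^sup>2 * h j)"
            using P(2) zP z(3)
            by (subst sum.mono_neutral_right[of "{..<N}" P]) (auto simp: f_def intro!: sum.cong)
          then show ?thesis using pos[OF that] by simp
        qed
        ultimately show ?thesis using that by blast
      next
        define R where "R = (\<Sum>j<N. w j / h j)"
        assume "(\<Sum>j<N. w j / h j) < 0"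
        then have R: "R < 0" by (simp add: R_def)
        \<comment> \<open>If no \<open>h j\<close> vanishes, this is the vector
          \<open>h\<close>-orthogonal to \<open>U\<close>, scaled so that the equation of
          \<open>U\<close> takes the value 1 on it. Its form value is \<open>1 / R\<close>, which is
          negative, so removing the multiple \<open>T\<close> of it raises the form by
          \<open>- |T|^2 / R\<close>. Where \<open>h j = 0\<close>, division by zero drops the index
          consistently from \<open>f\<close> and \<open>R\<close>.\<close>
        define f where "f = (\<lambda>j. v j / (of_real (h j) * of_real R))"
        have v2: "v j * v j = of_real (w j)" if "j < N" for j
          using w[OF that] by (simp add: v_def flip: of_real_mult)
        have "(\<Sum>j<N. v j * f j) = (\<Sum>j<N. of_real (w j / h j)) / of_real R"
          unfolding sum_divide_distrib by (intro sum.cong refl) (simp add: f_def v2)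
        also have "\<dots> = of_real (R / R)" unfolding R_def of_real_sum of_real_divide ..
        finally have f1: "(\<Sum>j<N. v j * f j) = 1" using R by simp
        have "(\<Sum>j<N. (cmod ((if j \<in> P then c j else 0) - (\<Sum>j\<in>P. c j * v j) * f j))\<^sup>2 * h j) > 0"
          if "\<exists>j\<in>P. c j \<noteq> 0" for c
        proof -
          define T where "T = (\<Sum>j\<in>P. c j * v j)"
          define x where "x = (\<lambda>j. if j \<in> P then c j else 0)"
          have vr: "cnj (v j) = v j" for j by (simp add: v_def)
          have tm: "(cmod (x j - T * f j))\<^sup>2 * h j = (cmod (x j))\<^sup>2 * h j
              - 2 * Re (cnj T * (x j * v j)) / R + (cmod T)\<^sup>2 * (w j / h j) / R\<^sup>2"
            if "j < N" for j
          proof (cases "h j = 0")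
            case True
            then have "x j = 0" by (simp add: x_def P_def)
            then show ?thesis using True by simp
          next
            case False
            have m: "(cmod (p - q))\<^sup>2 = (cmod p)\<^sup>2 - 2 * Re (cnj q * p) + (cmod q)\<^sup>2" for p q :: complex
              unfolding cmod_power2 by (simp add: power2_eq_square algebra_simps)
            have f': "f j = of_real (sqrt (w j) / (h j * R))" by (simp add: f_def v_def)
            have "(cmod (T * f j))\<^sup>2 = (cmod T)\<^sup>2 * (w j / (h j * R)\<^sup>2)"
              using w[OF that] by (simp add: f' norm_mult power_mult_distrib power_divide norm_divide)
            moreover have "Re (cnj (T * f j) * x j) = Re (cnj T * (x j * v j)) / (h j * R)"
              by (simp add: f' v_def field_simps)
            moreover have "(X - 2 * (C / (h j * R)) + S * (u / (h j * R)\<^sup>2)) * h j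
                = X * h j - 2 * C / R + S * (u / h j) / R\<^sup>2" for X C S u
              using False R by (simp add: field_simps power2_eq_square)
            ultimately show ?thesis unfolding m by (simp only:)
          qed
          have "(\<Sum>j<N. (cmod (x j - T * f j))\<^sup>2 * h j) = (\<Sum>j<N. (cmod (x j))\<^sup>2 * h j
              - 2 * Re (cnj T * (x j * v j)) / R + (cmod T)\<^sup>2 * (w j / h j) / R\<^sup>2)"
            by (intro sum.cong refl tm) simp
          also have "\<dots> = (\<Sum>j<N. (cmod (x j))\<^sup>2 * h j)
              - 2 * (\<Sum>j<N. Re (cnj T * (x j * v j))) / R + (cmod T)\<^sup>2 * (\<Sum>j<N. w j / h j) / R\<^sup>2"
            by (simp only: sum.distrib sum_subtractf sum_distrib_left sum_divide_distrib)
          also have "(\<Sum>j<N. Re (cnj T * (x j * v j))) = Re (cnj T * (\<Sum>j<N. x j * v j))"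
            by (simp only: sum_distrib_left Re_sum)
          also have "(\<Sum>j<N. x j * v j) = T" using crest[of c v] by (simp add: x_def T_def)
          also have "(\<Sum>j<N. w j / h j) = R" by (simp add: R_def)
          also have "Re (cnj T * T) = (cmod T)\<^sup>2"
            unfolding cmod_power2 by (simp add: power2_eq_square)
          also have "(\<Sum>j<N. (cmod (x j))\<^sup>2 * h j) = (\<Sum>j\<in>P. (cmod (c j))\<^sup>2 * h j)"
            unfolding x_def using P(2) by (subst sum.mono_neutral_right[of "{..<N}" P]) auto
          finally have "(\<Sum>j<N. (cmod (x j - T * f j))\<^sup>2 * h j) = (\<Sum>j\<in>P. (cmod (c j))\<^sup>2 * h j) - (cmod T)\<^sup>2 / R"
            using R by (simp add: field_simps power2_eq_square)
          moreover have "(cmod T)\<^sup>2 / R \<le> 0" using R by (simp add: divide_nonneg_neg)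
          ultimately show ?thesis using pos[OF that] by (simp add: x_def T_def)
        qed
        then show ?thesis using that f1 by blast
      qed
    qed
    \<comment> \<open>The functionals are pulled back along the map from \<open>c\<close> to
      \<open>c - T * f\<close>, which lands in \<open>U\<close> by itself. No equation is spent on
      \<open>U\<close>, as there is none to spare.\<close>
    have "length (map (\<lambda>\<phi> j. \<phi> (e j) - v j * (\<Sum>i<N. f i * \<phi> (e i))) \<phi>s) < card P" using True len by simp
    from underdetermined_system[OF P(1) this] obtain c where c: "\<exists>j\<in>P. c j \<noteq> 0"
      "\<forall>r\<in>set (map (\<lambda>\<phi> j. \<phi> (e j) - v j * (\<Sum>i<N. f i * \<phi> (e i))) \<phi>s). (\<Sum>j\<in>P. c j * r j) = 0" by blast
    define T where "T = (\<Sum>j\<in>P. c j * v j)"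
    define x where "x = (\<lambda>j. (if j \<in> P then c j else 0) - T * f j)"
    have sumx: "(\<Sum>j<N. x j * g j) = (\<Sum>j\<in>P. c j * g j) - T * (\<Sum>j<N. f j * g j)" for g
      using crest[of c g] by (simp add: x_def left_diff_distrib sum_subtractf sum_distrib_left mult.assoc)
    have "(\<Sum>j<N. v j * x j) = 0" using sumx[of v] f by (simp add: T_def mult.commute)
    moreover have "(\<Sum>j<N. x j * \<phi> (e j)) = 0" if "\<phi> \<in> set \<phi>s" for \<phi>
    proof -
      have "(\<Sum>j\<in>P. c j * (\<phi> (e j) - v j * (\<Sum>i<N. f i * \<phi> (e i)))) = 0" using c(2) that by auto
      then show ?thesis unfolding sumx
        by (simp add: T_def right_diff_distrib sum_subtractf sum_distrib_right mult.assoc)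
    qed
    moreover have "(\<Sum>j<N. (cmod (x j))\<^sup>2 * h j) > 0" using inc[OF c(1)] by (simp add: x_def T_def)
    ultimately show ?thesis using memU rotx \<phi>x
      by (intro bexI[of _ "\<Sum>j<N. scale (x j) (e j)"]) auto
  qed
qed

text \<open>The absence of isotropic eigenvectors is used twice: it yields the orthogonal basis, and
  it rules out opposite rays, so that each angle has a single sign as \<open>angle_weights\<close>
  requires.\<close>

lemma hyperplane_keeping_rank:
  assumes W: "finite_dim W" and no: "\<And>x. pencil_eigenvector W x \<Longrightarrow> a x x \<noteq> 0"
    and pos: "\<And>\<theta>. positive_rank (rot \<theta>) W k" and k: "k > 0"
  shows "\<exists>U. subspace U \<and> U \<subset> W \<and> (\<forall>\<theta>. positive_rank (rot \<theta>) U k)"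
proof -
  obtain N :: nat and e where
    e: "\<forall>j<N. e j \<in> W \<and> a (e j) (e j) \<noteq> 0"
    and orth: "\<forall>i<N. \<forall>j<N. i \<noteq> j \<longrightarrow> a (e i) (e j) = 0"
    and exp: "\<forall>y\<in>W. y = (\<Sum>j<N. scale (a (e j) y / a (e j) (e j)) (e j))"
    using isotropic_eigenvector_or_orthogonal_basis[OF W] no by blast
  have sub: "subspace W" using W by (simp add: finite_dim_def)
  define \<rho> where "\<rho> = (\<lambda>j. cmod (a (e j) (e j)))"
  have "\<forall>j\<in>{..<N}. \<exists>p. fst p \<in> {0..<pi} \<and> snd p \<in> {- 1, 1 :: real} \<and>
      a (e j) (e j) = of_real (\<rho> j * snd p) * cis (fst p)"
    using signed_angle e unfolding \<rho>_def by (metis fst_conv lessThan_iff snd_conv)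
  then obtain p where p: "\<forall>j\<in>{..<N}. fst (p j) \<in> {0..<pi} \<and> snd (p j) \<in> {- 1, 1 :: real} \<and>
      a (e j) (e j) = of_real (\<rho> j * snd (p j)) * cis (fst (p j))"
    by (rule bchoice[THEN exE])
  define \<phi> where "\<phi> = (\<lambda>j. fst (p j))"
  define \<epsilon> where "\<epsilon> = (\<lambda>j. snd (p j))"
  have \<phi>: "\<phi> j \<in> {0..<pi}" and \<epsilon>: "\<epsilon> j \<in> {- 1, 1}"
    and d: "a (e j) (e j) = of_real (\<rho> j * \<epsilon> j) * cis (\<phi> j)" if "j \<in> {..<N}" for j
    using bspec[OF p that] by (auto simp: \<phi>_def \<epsilon>_def)
  have \<rho>: "\<rho> j > 0" if "j \<in> {..<N}" for j using e that by (simp add: \<rho>_def)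
  have rot_e: "rot \<theta> (e j) = \<rho> j * \<epsilon> j * (\<tau> * sin (\<phi> j - s))"
    if "j \<in> {..<N}" "\<forall>\<phi>. cos (\<phi> - \<theta>) = \<tau> * sin (\<phi> - s)" for j \<theta> \<tau> s
    using rot_cos[OF d[OF that(1)]] that(2) by simp
  have sgn_rot: "rot \<theta> (e j) > 0 \<longleftrightarrow> \<tau> * (\<epsilon> j * (\<phi> j - s)) > 0"
    if j: "j \<in> {..<N}" and ts: "\<forall>\<phi>. cos (\<phi> - \<theta>) = \<tau> * sin (\<phi> - s)" "s \<in> {0..<pi}" for j \<theta> \<tau> s
  proof -
    have "sgn (rot \<theta> (e j)) = sgn (\<tau> * (\<epsilon> j * (\<phi> j - s)))"
      using rot_e[OF j ts(1)] sgn_sin_diff[OF \<phi>[OF j] ts(2)] \<rho>[OF j] by (simp add: sgn_mult mult_ac)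
    then show ?thesis by (metis sgn_greater)
  qed
  have card_eq: "{j\<in>{..<N}. rot \<theta> (e j) > 0} = {j\<in>{..<N}. \<tau> * (\<epsilon> j * (\<phi> j - s)) > 0}"
    if "\<forall>\<phi>. cos (\<phi> - \<theta>) = \<tau> * sin (\<phi> - s)" "s \<in> {0..<pi}" for \<theta> \<tau> s
    using sgn_rot[OF _ that] by blast
  have kc: "k \<le> card {j\<in>{..<N}. rot \<theta> (e j) > 0}" for \<theta>
    by (rule positive_rank_card[OF e orth exp pos])
  have "{j\<in>{..<N}. rot 0 (e j) > 0} \<noteq> {}" using kc[of 0] k by (metis card.empty not_le)
  then have "N > 0" by auto
  have same: "\<epsilon> i = \<epsilon> j" if "i \<in> {..<N}" "j \<in> {..<N}" "\<phi> i = \<phi> j" for i j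
  proof (rule ccontr)
    assume "\<epsilon> i \<noteq> \<epsilon> j"
    then have "\<epsilon> i = - \<epsilon> j" using \<epsilon>[OF that(1)] \<epsilon>[OF that(2)] by auto
    then have "a (e i) (e i) = - of_real (\<rho> i / \<rho> j) * a (e j) (e j)"
      using d[OF that(1)] d[OF that(2)] that \<rho>[OF that(2)] by simp
    moreover have "\<rho> i / \<rho> j > 0" using \<rho> that by simp
    ultimately show False using no_antipodal[OF W no e orth exp] that by blast
  qed
  have cnt: "k \<le> card {j\<in>{..<N}. \<tau> * (\<epsilon> j * (\<phi> j - s)) > 0}"
    if "s \<in> {0..<pi}" "\<tau> \<in> {- 1, 1}" for s \<tau> :: real
  proof -
    define \<theta> where "\<theta> = s + \<tau> * (pi / 2)"
    have "cos (x - \<theta>) = \<tau> * sin (x - s)" for x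
    proof -
      have "cos (x - \<theta>) = cos ((x - s) - \<tau> * (pi / 2))" by (simp add: \<theta>_def algebra_simps)
      then show ?thesis using that(2) by (auto simp: cos_diff cos_add)
    qed
    then show ?thesis using kc[of \<theta>] card_eq[of \<theta> \<tau> s] that by simp
  qed
  have ne: "{..<N} \<noteq> {}" using \<open>N > 0\<close> by auto
  have "\<exists>w. (\<forall>j\<in>{..<N}. w j \<ge> 0) \<and> (\<exists>j\<in>{..<N}. w j \<noteq> 0) \<and>
      (\<forall>s \<tau>. s \<in> {0..<pi} \<longrightarrow> \<tau> \<in> {- 1, 1 :: real} \<longrightarrow>
        k = card {j\<in>{..<N}. \<tau> * (\<epsilon> j * (\<phi> j - s)) > 0} \<longrightarrow>
        (\<exists>j\<in>{..<N}. w j \<noteq> 0 \<and> \<phi> j = s) \<or>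
        \<tau> * (\<Sum>j<N. w j / (\<rho> j * \<epsilon> j * sin (\<phi> j - s))) < 0)"
    by (rule angle_weights[OF finite_lessThan ne])
      ((erule \<phi> \<epsilon> \<rho> | erule (2) same | erule (1) cnt)+)
  then
  obtain w where w0: "\<forall>j\<in>{..<N}. w j \<ge> 0" and w1: "\<exists>j\<in>{..<N}. w j \<noteq> 0"
    and w: "\<forall>s \<tau>. s \<in> {0..<pi} \<longrightarrow> \<tau> \<in> {- 1, 1 :: real} \<longrightarrow>
        k = card {j\<in>{..<N}. \<tau> * (\<epsilon> j * (\<phi> j - s)) > 0} \<longrightarrow>
        (\<exists>j\<in>{..<N}. w j \<noteq> 0 \<and> \<phi> j = s) \<or>
        \<tau> * (\<Sum>j<N. w j / (\<rho> j * \<epsilon> j * sin (\<phi> j - s))) < 0"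
    by (elim exE conjE)
  \<comment> \<open>The criterion sees the squared coefficients of the equation of \<open>U\<close>,
    hence square roots of the weights.\<close>
  define l where "l = (\<lambda>y. \<Sum>j<N. of_real (sqrt (w j)) * (1 / a (e j) (e j) * a (e j) y))"
  have l: "functional l" unfolding l_def by (rule functional_sum_fun) (rule functional_a)
  define U where "U = {y\<in>W. l y = 0}"
  have "subspace U" using sub l by (auto simp: U_def subspace_def functional_def)
    (metis functional_def mult_zero_left scale_zero_left)
  moreover have "U \<subset> W"
  proof -
    obtain j where j: "j < N" "w j \<noteq> 0" using w1 by auto
    have "l (e j) = (\<Sum>i<N. if i = j then of_real (sqrt (w j)) else 0)"
      unfolding l_def using orth e j by (intro sum.cong refl) auto
    also have "\<dots> \<noteq> 0" using j by simp
    finally have "e j \<notin> U" by (simp add: U_def)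
    then show ?thesis using e j by (auto simp: U_def)
  qed
  moreover have "positive_rank (rot \<theta>) U k" for \<theta>
  proof (rule positive_rank_hyperplane[OF e sub orth, of w])
    show "w j \<ge> 0" if "j < N" for j using w0 that by simp
    show "U = {y\<in>W. (\<Sum>j<N. of_real (sqrt (w j)) * (1 / a (e j) (e j) * a (e j) y)) = 0}"
      by (simp add: U_def l_def)
    show "k \<le> card {j\<in>{..<N}. rot \<theta> (e j) > 0}" by (rule kc)
    assume kk: "k = card {j\<in>{..<N}. rot \<theta> (e j) > 0}"
    obtain s \<tau> where st: "s \<in> {0..<pi}" "\<tau> \<in> {- 1, 1 :: real}"
      "\<forall>\<phi>. cos (\<phi> - \<theta>) = \<tau> * sin (\<phi> - s)" using direction_reduction by blast
    have "k = card {j\<in>{..<N}. \<tau> * (\<epsilon> j * (\<phi> j - s)) > 0}" using kk card_eq[OF st(3,1)] by simp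
    from w[rule_format, OF st(1,2) this] show "(\<exists>z<N. w z \<noteq> 0 \<and> rot \<theta> (e z) = 0) \<or> (\<Sum>j<N. w j / rot \<theta> (e j)) < 0"
    proof
      assume "\<exists>j\<in>{..<N}. w j \<noteq> 0 \<and> \<phi> j = s"
      then show ?thesis using rot_e[OF _ st(3)] by auto
    next
      assume neg: "\<tau> * (\<Sum>j<N. w j / (\<rho> j * \<epsilon> j * sin (\<phi> j - s))) < 0"
      have "(\<Sum>j<N. w j / rot \<theta> (e j)) = (\<Sum>j<N. \<tau> * (w j / (\<rho> j * \<epsilon> j * sin (\<phi> j - s))))"
        using st(2) by (intro sum.cong refl) (auto simp: rot_e[OF _ st(3)])
      then show ?thesis using neg by (simp add: sum_distrib_left)
    qed
  qed
  ultimately show ?thesis by blast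
qed

end

section \<open>Orthonormal isotropic families by induction on the dimension\<close>

text \<open>Only semidefiniteness is assumed: the later inner product on sequences sees the first
  \<open>n\<close> entries. Definiteness is required on the subspace under consideration.\<close>

locale form_with_inner_product = sesquilinear_form scale a + ip: sesquilinear_form scale ip
  for scale :: "complex \<Rightarrow> 'v::ab_group_add \<Rightarrow> 'v" and a ip :: "'v \<Rightarrow> 'v \<Rightarrow> complex" +
  assumes ip_sym: "ip y x = cnj (ip x y)"
    and ip_nonneg: "\<exists>r\<ge>0. ip x x = of_real r"
begin

text \<open>Splitting off an isotropic eigenvector of the pencil costs one positive eigenvalue in
  every direction, so the induction on the dimension can proceed with \<open>k - 1\<close>.\<close>

lemma positive_rank_split:
  assumes x: "pencil_eigenvector W x" "a x x = 0" and W: "subspace W" and ipx: "ip x x \<noteq> 0"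
    and pos: "positive_rank (rot \<theta>) W k"
  shows "positive_rank (rot \<theta>) {y\<in>W. a x y = 0 \<and> a y x = 0 \<and> ip x y = 0} (k - 1)"
  unfolding positive_rank_def
proof (intro allI impI)
  fix \<phi>s assume len: "length \<phi>s < k - 1" and fn: "\<forall>\<phi>\<in>set \<phi>s. functional \<phi>"
  obtain \<alpha> \<beta> where xW: "x \<in> W" "x \<noteq> 0" and ab: "\<alpha> \<noteq> 0 \<or> \<beta> \<noteq> 0"
    and eig: "\<And>y. y \<in> W \<Longrightarrow> \<alpha> * a x y = \<beta> * cnj (a y x)"
    using x by (auto simp: pencil_eigenvector_def)
  \<comment> \<open>A single functional forces orthogonality to \<open>x\<close> on both sides; this
    is why only one unit of \<open>k\<close> is lost.\<close>
  have "\<exists>\<psi>. functional \<psi> \<and> (\<forall>y\<in>W. \<psi> y = 0 \<longrightarrow> a x y = 0 \<and> a y x = 0)"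
  proof (cases "\<alpha> = 0")
    case True
    then have "a y x = 0" if "y \<in> W" for y using eig[OF that] ab by simp
    then show ?thesis using functional_a[of 1 x] by (intro exI[of _ "a x"]) simp
  next
    case False
    have "functional (\<lambda>y. cnj (a y x))" by (simp add: functional_def sesq)
    moreover have "a x y = 0 \<and> a y x = 0" if "y \<in> W" "cnj (a y x) = 0" for y
      using eig[OF that(1)] that False by simp
    ultimately show ?thesis by (intro exI[of _ "\<lambda>y. cnj (a y x)"]) blast
  qed
  then obtain \<psi> where \<psi>: "functional \<psi>" "\<And>y. y \<in> W \<Longrightarrow> \<psi> y = 0 \<Longrightarrow> a x y = 0 \<and> a y x = 0" by blast
  \<comment> \<open>Making \<open>u\<close> orthogonal to \<open>x\<close> for \<open>ip\<close> is
    free: \<open>x\<close> is isotropic and \<open>a\<close>-orthogonal to \<open>u\<close> on both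
    sides, so the form value does not change, and the functionals are composed with the projection
    in advance.\<close>
  define pr where "pr = (\<lambda>y. y - scale (ip x y / ip x x) x)"
  have pr_add: "pr (y + z) = pr y + pr z" and pr_scale: "pr (scale c y) = scale c (pr y)" for y z c
    by (simp_all add: pr_def ip.sesq add_divide_distrib scale_left_distrib scale_right_diff_distrib)
  have "length (\<psi> # map (\<lambda>\<phi>. \<phi> \<circ> pr) \<phi>s) < k" using len by simp
  moreover have "\<forall>\<phi>\<in>set (\<psi> # map (\<lambda>\<phi>. \<phi> \<circ> pr) \<phi>s). functional \<phi>"
    using \<psi>(1) fn by (auto simp: functional_def pr_add pr_scale)
  ultimately obtain u where u: "u \<in> W" "\<forall>\<phi>\<in>set (\<psi> # map (\<lambda>\<phi>. \<phi> \<circ> pr) \<phi>s). \<phi> u = 0" "rot \<theta> u > 0"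
    using pos unfolding positive_rank_def by blast
  have ux: "a x u = 0" "a u x = 0" using \<psi>(2)[OF u(1)] u(2) by auto
  have "a (pr u) (pr u) = a u u" by (simp add: pr_def sesq ux x(2))
  then have "rot \<theta> (pr u) > 0" using u(3) by (simp add: rot_def)
  moreover have "pr u \<in> W" unfolding pr_def using u(1) xW W by (intro subspace_diff subspace_scale)
  moreover have "a x (pr u) = 0" "a (pr u) x = 0" by (simp_all add: pr_def sesq ux x(2))
  moreover have "ip x (pr u) = 0" using ipx by (simp add: pr_def ip.sesq)
  ultimately show "\<exists>u\<in>{y\<in>W. a x y = 0 \<and> a y x = 0 \<and> ip x y = 0}. (\<forall>\<phi>\<in>set \<phi>s. \<phi> u = 0) \<and> rot \<theta> u > 0"
    using u(2) by (intro bexI[of _ "pr u"]) auto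
qed

text \<open>Each step lowers the dimension, either together with \<open>k\<close> or at unchanged
  \<open>k\<close>. Positive rank \<open>k > 0\<close> is impossible on the zero space, so
  \<open>k\<close> is exhausted before the space is.\<close>

theorem orthonormal_isotropic_family:
  assumes "finite_dim W" and "\<And>x. x \<in> W \<Longrightarrow> x \<noteq> 0 \<Longrightarrow> ip x x \<noteq> 0"
    and "\<And>\<theta>. positive_rank (rot \<theta>) W k"
  shows "\<exists>u. (\<forall>i<k. u i \<in> W) \<and> (\<forall>i<k. \<forall>j<k. ip (u i) (u j) = (if i = j then 1 else 0) \<and> a (u i) (u j) = 0)"
  using assms
proof (induction "dim W" arbitrary: W k rule: less_induct)
  case less
  note W = less.prems(1) and def = less.prems(2) and pos = less.prems(3)
  have sub: "subspace W" using W by (simp add: finite_dim_def)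
  show ?case
  proof (cases k)
    case 0
    then show ?thesis by simp
  next
    case (Suc m)
    show ?thesis
    proof (cases "\<exists>x. pencil_eigenvector W x \<and> a x x = 0")
      case True
      then obtain x where x: "pencil_eigenvector W x" "a x x = 0" by blast
      then have xW: "x \<in> W" "x \<noteq> 0" by (auto simp: pencil_eigenvector_def)
      have ipx: "ip x x \<noteq> 0" using def xW by blast
      define U where "U = {y\<in>W. a x y = 0 \<and> a y x = 0 \<and> ip x y = 0}"
      have Usub: "subspace U" using sub by (auto simp: U_def subspace_def sesq ip.sesq)
      have UW: "U \<subset> W" using xW ipx by (auto simp: U_def)
      have Uf: "finite_dim U" using finite_dim_subset[OF W Usub] UW by blast
      have "positive_rank (rot \<theta>) U m" for \<theta>
        using positive_rank_split[OF x sub ipx pos] Suc by (simp add: U_def)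
      moreover have "\<And>x. x \<in> U \<Longrightarrow> x \<noteq> 0 \<Longrightarrow> ip x x \<noteq> 0" using def UW by blast
      ultimately obtain u where u: "\<forall>i<m. u i \<in> U"
        "\<forall>i<m. \<forall>j<m. ip (u i) (u j) = (if i = j then 1 else 0) \<and> a (u i) (u j) = 0"
        using less.hyps[OF dim_psubset[OF W Usub UW] Uf, of m] by blast
      obtain r where r: "r \<ge> 0" "ip x x = of_real r" using ip_nonneg by blast
      have r0: "r > 0" using r ipx by (cases "r = 0") auto
      define v where "v = u(m := scale (of_real (1 / sqrt r)) x)"
      have vm: "v m = scale (of_real (1 / sqrt r)) x" by (simp add: v_def)
      have vi: "v i = u i" if "i < m" for i using that by (simp add: v_def)
      have rr: "complex_of_real (sqrt r) * complex_of_real (sqrt r) = of_real r"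
        using r0 by (simp flip: of_real_mult)
      have vmm: "ip (v m) (v m) = 1" "a (v m) (v m) = 0"
        using r0 by (simp_all add: vm ip.sesq sesq r x(2) rr)
      have cross: "ip (v m) (v i) = 0" "ip (v i) (v m) = 0" "a (v m) (v i) = 0" "a (v i) (v m) = 0"
        if "i < m" for i
      proof -
        have "u i \<in> U" using u that by blast
        then have "a x (u i) = 0" "a (u i) x = 0" "ip x (u i) = 0" "ip (u i) x = 0"
          using ip_sym[of "u i" x] by (auto simp: U_def)
        then show "ip (v m) (v i) = 0" "ip (v i) (v m) = 0" "a (v m) (v i) = 0" "a (v i) (v m) = 0"
          using that by (simp_all add: vm vi ip.sesq sesq)
      qed
      have "ip (v i) (v j) = (if i = j then 1 else 0) \<and> a (v i) (v j) = 0"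
        if "i < k" "j < k" for i j
        using that Suc vmm cross u(2) vi by (cases "i = m"; cases "j = m") auto
      moreover have "v i \<in> W" if "i < k" for i
      proof (cases "i = m")
        case True
        then show ?thesis using vm xW sub by (simp add: subspace_scale)
      next
        case False
        then have "i < m" using that Suc by simp
        then have "u i \<in> U" "v i = u i" using u(1) vi by auto
        then show ?thesis using UW by auto
      qed
      ultimately show ?thesis by blast
    next
      case False
      then have no: "\<And>x. pencil_eigenvector W x \<Longrightarrow> a x x \<noteq> 0" by blast
      obtain U where U: "subspace U" "U \<subset> W" "\<And>\<theta>. positive_rank (rot \<theta>) U k"
        using hyperplane_keeping_rank[OF W no pos] Suc by blast
      have "finite_dim U" using finite_dim_subset[OF W U(1)] U(2) by blast
      moreover have "\<And>x. x \<in> U \<Longrightarrow> x \<noteq> 0 \<Longrightarrow> ip x x \<noteq> 0" using def U(2) by blast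
      ultimately obtain u where "\<forall>i<k. u i \<in> U"
        "\<forall>i<k. \<forall>j<k. ip (u i) (u j) = (if i = j then 1 else 0) \<and> a (u i) (u j) = 0"
        using less.hyps[OF dim_psubset[OF W U(1,2)], of k] U(3) by blast
      then show ?thesis using U(2) by (intro exI[of _ u]) auto
    qed
  qed
qed

end

section \<open>Eigenvalues of hermitian matrices\<close>

text \<open>Vectors are sequences, so one type serves all dimensions; \<open>supported n\<close>
  plays the role of complex \<open>n\<close>-space.\<close>

definition fscale :: "complex \<Rightarrow> (nat \<Rightarrow> complex) \<Rightarrow> nat \<Rightarrow> complex" where
  "fscale c f = (\<lambda>i. c * f i)"

definition mform :: "nat \<Rightarrow> (nat \<Rightarrow> nat \<Rightarrow> complex) \<Rightarrow> (nat \<Rightarrow> complex) \<Rightarrow> (nat \<Rightarrow> complex) \<Rightarrow> complex" where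
  "mform n B u v = (\<Sum>i<n. \<Sum>j<n. cnj (u i) * B i j * v j)"

definition ip :: "nat \<Rightarrow> (nat \<Rightarrow> complex) \<Rightarrow> (nat \<Rightarrow> complex) \<Rightarrow> complex" where
  "ip n u v = (\<Sum>i<n. cnj (u i) * v i)"

definition sqnorm :: "nat \<Rightarrow> (nat \<Rightarrow> complex) \<Rightarrow> real" where
  "sqnorm n u = (\<Sum>i<n. (cmod (u i))\<^sup>2)"

definition supported :: "nat \<Rightarrow> (nat \<Rightarrow> complex) set" where
  "supported n = {f. \<forall>i\<ge>n. f i = 0}"

lemma sum_fun_apply: "(\<Sum>j\<in>J. f j) i = (\<Sum>j\<in>J. f j i :: complex)"
  by (induction J rule: infinite_finite_induct) auto

lemma vector_space_fscale: "vector_space fscale"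
  by unfold_locales (auto simp: fscale_def fun_eq_iff algebra_simps)

lemma sesquilinear_mform: "sesquilinear_form fscale (mform n B)"
proof -
  interpret vector_space fscale by (rule vector_space_fscale)
  show ?thesis
    by unfold_locales
      (auto simp: mform_def fscale_def algebra_simps sum.distrib sum_distrib_left)
qed

lemma sesquilinear_ip: "sesquilinear_form fscale (ip n)"
proof -
  interpret vector_space fscale by (rule vector_space_fscale)
  show ?thesis
    by unfold_locales
      (auto simp: ip_def fscale_def algebra_simps sum.distrib sum_distrib_left)
qed

lemma ip_self: "ip n u u = of_real (sqnorm n u)"
  unfolding ip_def sqnorm_def of_real_sum
  by (intro sum.cong refl) (simp only: complex_norm_square mult.commute)

lemma ip_cnj: "ip n v u = cnj (ip n u v)"
  by (simp add: ip_def mult.commute)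

lemma sqnorm_nonneg: "sqnorm n u \<ge> 0"
  by (simp add: sqnorm_def sum_nonneg)

lemma sqnorm_eq_0_iff: "u \<in> supported n \<Longrightarrow> sqnorm n u = 0 \<longleftrightarrow> u = 0"
  by (auto simp: sqnorm_def supported_def sum_nonneg_eq_0_iff fun_eq_iff) (meson lessThan_iff not_less)

lemma form_with_inner_product_ip: "form_with_inner_product fscale (mform n B) (ip n)"
proof -
  interpret A: sesquilinear_form fscale "mform n B" by (rule sesquilinear_mform)
  interpret I: sesquilinear_form fscale "ip n" by (rule sesquilinear_ip)
  show ?thesis
    by unfold_locales (use ip_cnj ip_self sqnorm_nonneg in blast)+
qed

lemma mform_cnj: "mform n (\<lambda>i j. cnj (B j i)) u v = cnj (mform n B v u)"
  unfolding mform_def by (subst sum.swap) (simp add: mult_ac)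

lemma mform_add: "mform n (\<lambda>i j. B i j + C i j) u v = mform n B u v + mform n C u v"
  by (simp add: mform_def algebra_simps sum.distrib)

lemma mform_cmult: "mform n (\<lambda>i j. c * B i j) u v = c * mform n B u v"
  by (simp add: mform_def algebra_simps sum_distrib_left)

lemma mform_delta: "mform n (\<lambda>i j. if i = j then 1 else 0) u v = ip n u v"
  unfolding mform_def ip_def
proof (intro sum.cong refl)
  fix i assume "i \<in> {..<n}"
  then have "(\<Sum>j<n. cnj (u i) * (if i = j then 1 else 0) * v j) = (\<Sum>j<n. if i = j then cnj (u i) * v j else 0)"
    by (intro sum.cong) auto
  then show "(\<Sum>j<n. cnj (u i) * (if i = j then 1 else 0) * v j) = cnj (u i) * v i"
    using \<open>i \<in> {..<n}\<close> by simp
qed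

lemma finite_dim_supported: "sesquilinear_form.finite_dim fscale (supported n)"
proof -
  interpret sesquilinear_form fscale "ip n" by (rule sesquilinear_ip)
  define E where "E = (\<lambda>i j. if j = i then 1 else 0 :: complex) ` {..<n}"
  have "f \<in> span E" if "f \<in> supported n" for f
  proof -
    have "f = (\<Sum>i<n. fscale (f i) (\<lambda>j. if j = i then 1 else 0))"
    proof
      fix j
      have "(\<Sum>i<n. fscale (f i) (\<lambda>j. if j = i then 1 else 0)) j = (\<Sum>i<n. if j = i then f i else 0)"
        unfolding sum_fun_apply by (intro sum.cong) (auto simp: fscale_def)
      then show "f j = (\<Sum>i<n. fscale (f i) (\<lambda>j. if j = i then 1 else 0)) j"
        using that by (auto simp: supported_def)
    qed
    also have "\<dots> \<in> span E" unfolding E_def by (intro span_sum span_scale span_base) auto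
    finally show ?thesis .
  qed
  moreover have "subspace (supported n)" by (auto simp: subspace_def supported_def fscale_def)
  ultimately show ?thesis unfolding finite_dim_def by (intro conjI exI[of _ E]) (auto simp: E_def)
qed

text \<open>For \<open>h\<close> hermitian, an orthogonal basis of the form \<open>ip + \<i> h\<close> diagonalises both \<open>ip\<close> and \<open>h\<close>.\<close>

lemma hermitian_diagonalisation:
  assumes herm: "\<And>i j. i < n \<Longrightarrow> j < n \<Longrightarrow> B j i = cnj (B i j)"
  shows "\<exists>e l. (\<forall>i<n. e i \<in> supported n) \<and>
     (\<forall>i<n. \<forall>j<n. ip n (e i) (e j) = (if i = j then 1 else 0)) \<and>
     (\<forall>i<n. \<forall>j<n. mform n B (e i) (e j) = (if i = j then complex_of_real (l i) else 0)) \<and>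
     (\<forall>y\<in>supported n. y = (\<Sum>j<n. fscale (ip n (e j) y) (e j)))"
proof -
  interpret I: sesquilinear_form fscale "ip n" by (rule sesquilinear_ip)
  interpret H: sesquilinear_form fscale "mform n B" by (rule sesquilinear_mform)
  define C where "C = (\<lambda>i j. (if i = j then 1 else 0) + \<i> * B i j)"
  interpret A: sesquilinear_form fscale "mform n C" by (rule sesquilinear_mform)
  have C: "mform n C u v = ip n u v + \<i> * mform n B u v" for u v
    by (simp only: C_def mform_add mform_cmult mform_delta)
  have hc: "mform n B v u = cnj (mform n B u v)" for u v
  proof -
    have "mform n B v u = mform n (\<lambda>i j. cnj (B j i)) v u"
      unfolding mform_def by (intro sum.cong refl) (simp add: herm[symmetric])
    then show ?thesis by (simp only: mform_cnj)
  qed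
  have hreal: "mform n B u u \<in> \<real>" for u using hc[of u u] by (simp add: Reals_cnj_iff)
  have nz: "mform n C u u \<noteq> 0" if "u \<in> supported n" "u \<noteq> 0" for u
  proof
    assume "mform n C u u = 0"
    then have "Re (mform n C u u) = 0" by simp
    moreover obtain r where "mform n B u u = of_real r" using hreal by (auto elim: Reals_cases)
    ultimately have "sqnorm n u = 0" by (simp add: C ip_self)
    then show False using that sqnorm_eq_0_iff by blast
  qed
  have "\<not> (\<exists>x. A.pencil_eigenvector (supported n) x \<and> mform n C x x = 0)"
    using nz by (auto simp: A.pencil_eigenvector_def)
  then obtain N :: nat and e where
    e: "\<forall>j<N. e j \<in> supported n \<and> mform n C (e j) (e j) \<noteq> 0"
    and orth: "\<forall>i<N. \<forall>j<N. i \<noteq> j \<longrightarrow> mform n C (e i) (e j) = 0"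
    and exp: "\<forall>y\<in>supported n. y = (\<Sum>j<N. fscale (mform n C (e j) y / mform n C (e j) (e j)) (e j))"
    using A.isotropic_eigenvector_or_orthogonal_basis[OF finite_dim_supported] by blast
  \<comment> \<open>Both forms are hermitian, so conjugating the relation with swapped arguments
    replaces \<open>\<i>\<close> by \<open>- \<i>\<close>. The two relations together separate
    \<open>ip\<close> from the form of \<open>B\<close>.\<close>
  have o: "ip n (e i) (e j) = 0" "mform n B (e i) (e j) = 0" if "i < N" "j < N" "i \<noteq> j" for i j
  proof -
    have 1: "ip n (e i) (e j) + \<i> * mform n B (e i) (e j) = 0" using orth that C by metis
    have "cnj (ip n (e j) (e i) + \<i> * mform n B (e j) (e i)) = 0"
      using orth that C by (metis complex_cnj_zero)
    then have 2: "ip n (e i) (e j) - \<i> * mform n B (e i) (e j) = 0"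
      by (simp add: ip_cnj[of n "e i"] hc[of "e i"])
    have "2 * ip n (e i) (e j) = 0" using arg_cong2[OF 1 2, of "(+)"] by simp
    then show "ip n (e i) (e j) = 0" by simp
    then show "mform n B (e i) (e j) = 0" using 1 by simp
  qed
  define r where "r = (\<lambda>j. sqnorm n (e j))"
  have r: "r j > 0" if "j < N" for j
  proof -
    have "e j \<noteq> 0" using e that by auto
    then show ?thesis using sqnorm_eq_0_iff[of "e j" n] sqnorm_nonneg[of n "e j"] e that
      by (auto simp: r_def less_le)
  qed
  define f where "f = (\<lambda>j. fscale (of_real (1 / sqrt (r j))) (e j))"
  have rr: "complex_of_real (sqrt (r j)) * complex_of_real (sqrt (r j)) = of_real (r j)" if "j < N" for j
    using r[OF that] by (simp flip: of_real_mult)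
  have fo: "ip n (f i) (f j) = (if i = j then 1 else 0)" if "i < N" "j < N" for i j
  proof (cases "i = j")
    case True
    have "ip n (f j) (f j) = cnj (of_real (1 / sqrt (r j))) * (of_real (1 / sqrt (r j)) * of_real (r j))"
      by (simp only: f_def I.scale_left I.scale_right) (simp only: ip_self r_def mult.left_commute)
    then show ?thesis using True r[OF that(2)] rr[OF that(2)] by simp
  next
    case False
    then show ?thesis using o[OF that] by (simp add: f_def I.sesq)
  qed
  define l where "l = (\<lambda>j. Re (mform n B (f j) (f j)))"
  have fl: "mform n B (f i) (f j) = (if i = j then complex_of_real (l i) else 0)" if "i < N" "j < N" for i j
  proof (cases "i = j")
    case True
    then show ?thesis using hreal[of "f j"] by (simp add: l_def)
  next
    case False
    then show ?thesis using o[OF that] by (simp add: f_def H.sesq)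
  qed
  have fs: "f j \<in> supported n" if "j < N" for j
    using e that by (auto simp: f_def supported_def fscale_def)
  have fexp: "y = (\<Sum>j<N. fscale (ip n (f j) y) (f j))" if "y \<in> supported n" for y
  proof -
    define t where "t = (\<lambda>j. mform n C (e j) y / mform n C (e j) (e j))"
    define s where "s = (\<lambda>j. t j * of_real (sqrt (r j)))"
    have "y = (\<Sum>j<N. fscale (t j) (e j))" using exp that by (simp add: t_def)
    also have "\<dots> = (\<Sum>j<N. fscale (s j) (f j))"
    proof (intro sum.cong refl)
      fix j assume "j \<in> {..<N}"
      then show "fscale (t j) (e j) = fscale (s j) (f j)"
        using r[of j] by (auto simp: s_def f_def fscale_def fun_eq_iff)
    qed
    finally have y: "y = (\<Sum>j<N. fscale (s j) (f j))" .
    have "ip n (f i) y = s i" if "i < N" for i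
    proof -
      have "ip n (f i) y = (\<Sum>j<N. s j * ip n (f i) (f j))"
        by (subst y) (simp add: I.sum_right I.scale_right)
      also have "\<dots> = (\<Sum>j<N. if i = j then s j else 0)" using fo that by (intro sum.cong) auto
      finally show ?thesis using that by simp
    qed
    then show ?thesis by (subst y) (auto intro!: sum.cong)
  qed
  \<comment> \<open>Too many orthonormal vectors would be dependent; too few would leave a nonzero
    vector orthogonal to all, against the expansion.\<close>
  have "N = n"
  proof (rule ccontr)
    assume "N \<noteq> n"
    then consider "n < N" | "N < n" by linarith
    then show False
    proof cases
      case 1
      have "length (map (\<lambda>i j. f j i) [0..<n]) < card {..<N}" using 1 by simp
      from underdetermined_system[OF finite_lessThan this] obtain c where
        c: "\<exists>j\<in>{..<N}. c j \<noteq> 0" "\<forall>i<n. (\<Sum>j<N. c j * f j i) = 0" by (auto simp: atLeast0LessThan)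
      define u where "u = (\<Sum>j<N. fscale (c j) (f j))"
      have "u i = 0" for i
      proof (cases "i < n")
        case True
        then show ?thesis using c(2) by (simp add: u_def sum_fun_apply fscale_def)
      next
        case False
        then have "f j i = 0" if "j < N" for j using fs[OF that] by (simp add: supported_def)
        then show ?thesis by (simp add: u_def sum_fun_apply fscale_def)
      qed
      then have "u = 0" by (simp add: fun_eq_iff)
      have "c i = 0" if "i < N" for i
      proof -
        have "ip n (f i) u = (\<Sum>j<N. c j * ip n (f i) (f j))"
          by (simp add: u_def I.sum_right I.scale_right)
        also have "\<dots> = (\<Sum>j<N. if i = j then c j else 0)" using fo that by (intro sum.cong) auto
        finally show ?thesis using that \<open>u = 0\<close> by simp
      qed
      then show False using c(1) by auto
    next
      case 2
      have "length (map (\<lambda>j i. cnj (f j i)) [0..<N]) < card {..<n}" using 2 by simp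
      from underdetermined_system[OF finite_lessThan this] obtain c where
        c: "\<exists>i\<in>{..<n}. c i \<noteq> 0" "\<forall>j<N. (\<Sum>i<n. c i * cnj (f j i)) = 0" by (auto simp: atLeast0LessThan)
      define y where "y = (\<lambda>i. if i < n then c i else 0)"
      have "y \<in> supported n" by (simp add: y_def supported_def)
      have "ip n (f j) y = 0" if "j < N" for j
      proof -
        have "ip n (f j) y = (\<Sum>i<n. c i * cnj (f j i))"
          unfolding ip_def by (intro sum.cong) (auto simp: y_def)
        then show ?thesis using c(2) that by simp
      qed
      then have "y = 0" by (subst fexp[OF \<open>y \<in> supported n\<close>]) (simp add: fscale_def zero_fun_def sum_fun_apply fun_eq_iff)
      then show False using c(1) by (auto simp: y_def fun_eq_iff split: if_splits)
    qed
  qed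
  then show ?thesis using fo fl fs fexp by (intro exI[of _ f] exI[of _ l]) blast
qed

section \<open>Ordered eigenbases and the Courant--Fischer principle\<close>

definition mq :: "nat \<Rightarrow> complex mat \<Rightarrow> (nat \<Rightarrow> complex) \<Rightarrow> real" where
  "mq n M u = Re (mform n (\<lambda>i j. M $$ (i, j)) u u)"

definition hermitian :: "nat \<Rightarrow> complex mat \<Rightarrow> bool" where
  "hermitian n M \<longleftrightarrow> M \<in> carrier_mat n n \<and> (\<forall>i<n. \<forall>j<n. M $$ (j, i) = cnj (M $$ (i, j)))"

text \<open>Basis vectors are indexed from 0 and eigenvalues from 1, hence \<open>Suc\<close>. Being
  an eigenvector is expressed by values of the form, which determine the matrix on a full
  orthonormal system.\<close>

definition eigenbasis :: "nat \<Rightarrow> complex mat \<Rightarrow> (nat \<Rightarrow> nat \<Rightarrow> complex) \<Rightarrow> bool" where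
  "eigenbasis n M e \<longleftrightarrow> (\<forall>i<n. e i \<in> supported n) \<and>
     (\<forall>i<n. \<forall>j<n. ip n (e i) (e j) = (if i = j then 1 else 0)) \<and>
     (\<forall>i<n. \<forall>j<n. mform n (\<lambda>i j. M $$ (i, j)) (e i) (e j) =
        (if i = j then complex_of_real (eigval M (Suc i)) else 0)) \<and>
     (\<forall>y\<in>supported n. y = (\<Sum>j<n. fscale (ip n (e j) y) (e j))) \<and>
     (\<forall>i j. i \<le> j \<longrightarrow> j < n \<longrightarrow> eigval M (Suc j) \<le> eigval M (Suc i))"

text \<open>The matrix of the basis columns is unitary and conjugates \<open>M\<close> to a diagonal
  matrix. This ties \<open>eigval\<close>, which is defined by roots, to the form.\<close>

lemma char_poly_orthonormal_eigenbasis: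
  assumes M: "M \<in> carrier_mat n n"
    and ortho: "\<And>i j. i < n \<Longrightarrow> j < n \<Longrightarrow> ip n (e i) (e j) = (if i = j then 1 else 0)"
    and diag: "\<And>i j. i < n \<Longrightarrow> j < n \<Longrightarrow>
       mform n (\<lambda>i j. M $$ (i, j)) (e i) (e j) = (if i = j then complex_of_real (l i) else 0)"
  shows "char_poly M = (\<Prod>i\<leftarrow>[0..<n]. [:- complex_of_real (l i), 1:])"
proof -
  define P where "P = mat n n (\<lambda>(i, j). e j i)"
  define Q where "Q = mat n n (\<lambda>(i, j). cnj (e i j))"
  define D where "D = mat n n (\<lambda>(i, j). if i = j then complex_of_real (l i) else 0)"
  have c: "P \<in> carrier_mat n n" "Q \<in> carrier_mat n n" "D \<in> carrier_mat n n"
    by (auto simp: P_def Q_def D_def)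
  have QP: "Q * P = 1\<^sub>m n"
  proof (rule eq_matI)
    fix i j assume "i < dim_row (1\<^sub>m n)" "j < dim_col (1\<^sub>m n)"
    then have ij: "i < n" "j < n" by auto
    then have "(Q * P) $$ (i, j) = ip n (e i) (e j)"
      by (simp add: P_def Q_def scalar_prod_def ip_def atLeast0LessThan)
    then show "(Q * P) $$ (i, j) = 1\<^sub>m n $$ (i, j)" using ortho ij by simp
  qed (use c in auto)
  then have PQ: "P * Q = 1\<^sub>m n" using mat_mult_left_right_inverse c by blast
  have D: "D = Q * M * P"
  proof (rule eq_matI)
    fix i j assume "i < dim_row (Q * M * P)" "j < dim_col (Q * M * P)"
    then have ij: "i < n" "j < n" using c by auto
    have "(Q * M * P) $$ (i, j) = (\<Sum>k<n. (\<Sum>h<n. cnj (e i h) * M $$ (h, k)) * e j k)"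
      using ij c M by (simp add: P_def Q_def scalar_prod_def atLeast0LessThan)
    also have "\<dots> = mform n (\<lambda>i j. M $$ (i, j)) (e i) (e j)"
      unfolding mform_def sum_distrib_right by (rule sum.swap)
    finally show "D $$ (i, j) = (Q * M * P) $$ (i, j)" using diag ij by (simp add: D_def)
  qed (use c in auto)
  have "P * D * Q = M"
  proof -
    have "P * D * Q = (P * Q) * M * (P * Q)"
      unfolding D using c M by (simp add: assoc_mult_mat[of _ n n _ n _ n])
    then show ?thesis using PQ M by simp
  qed
  then have "similar_mat_wit M D P Q" using c M QP PQ by (intro similar_mat_witI[of _ _ n]) auto
  then have "char_poly M = char_poly D" by (intro char_poly_similar) (auto simp: similar_mat_def)
  also have "\<dots> = (\<Prod>a\<leftarrow>diag_mat D. [:- a, 1:])"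
    by (rule char_poly_upper_triangular[OF c(3)]) (auto simp: D_def)
  also have "diag_mat D = map (\<lambda>i. complex_of_real (l i)) [0..<n]"
    by (auto simp: diag_mat_def D_def)
  finally show ?thesis by (simp add: comp_def)
qed

lemma eigval_orthonormal_eigenbasis:
  assumes "M \<in> carrier_mat n n"
    and "\<And>i j. i < n \<Longrightarrow> j < n \<Longrightarrow> ip n (e i) (e j) = (if i = j then 1 else 0)"
    and "\<And>i j. i < n \<Longrightarrow> j < n \<Longrightarrow>
       mform n (\<lambda>i j. M $$ (i, j)) (e i) (e j) = (if i = j then complex_of_real (l i) else 0)"
  shows "eigval M (Suc i) = rev (sort (map l [0..<n])) ! i"
proof -
  have "proots (\<Prod>p\<leftarrow>map (\<lambda>i. [:- complex_of_real (l i), 1:]) xs. p) = mset (map (\<lambda>i. complex_of_real (l i)) xs)" for xs :: "nat list"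
  proof (induction xs)
    case (Cons x xs)
    have "(\<Prod>p\<leftarrow>map (\<lambda>i. [:- complex_of_real (l i), 1:]) xs. p) \<noteq> 0"
      by (auto simp: prod_list_zero_iff)
    then show ?case using Cons by (simp add: proots_mult del: mult_pCons_left mult_pCons_right)
  qed simp
  then have "proots (char_poly M) = mset (map (\<lambda>i. complex_of_real (l i)) [0..<n])"
    using char_poly_orthonormal_eigenbasis[OF assms] by simp
  then have "image_mset Re (proots (char_poly M)) = mset (map l [0..<n])"
    by (simp add: multiset.map_comp comp_def)
  then show ?thesis unfolding eigval_def by (simp only: sorted_list_of_multiset_mset diff_Suc_1)
qed

lemma eigenbasis_exists:
  assumes "hermitian n M"
  shows "\<exists>e. eigenbasis n M e"
proof -
  have M: "M \<in> carrier_mat n n" and herm: "\<And>i j. i < n \<Longrightarrow> j < n \<Longrightarrow> M $$ (j, i) = cnj (M $$ (i, j))"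
    using assms unfolding hermitian_def by blast+
  obtain e l where e: "\<And>i. i < n \<Longrightarrow> e i \<in> supported n"
    and ortho: "\<And>i j. i < n \<Longrightarrow> j < n \<Longrightarrow> ip n (e i) (e j) = (if i = j then 1 else 0)"
    and diag: "\<And>i j. i < n \<Longrightarrow> j < n \<Longrightarrow> mform n (\<lambda>i j. M $$ (i, j)) (e i) (e j) = (if i = j then complex_of_real (l i) else 0)"
    and exp: "\<And>y. y \<in> supported n \<Longrightarrow> y = (\<Sum>j<n. fscale (ip n (e j) y) (e j))"
    using hermitian_diagonalisation[of n "\<lambda>i j. M $$ (i, j)", OF herm] by blast
  \<comment> \<open>Reindexing by decreasing \<open>l\<close> aligns the basis with the reversed
    sorted list in \<open>eigval\<close>.\<close>
  define js where "js = rev (sort_key l [0..<n])"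
  have js: "distinct js" "set js = {..<n}" "length js = n" by (auto simp: js_def atLeast0LessThan)
  have jslt: "js ! i < n" if "i < n" for i using js that by (metis lessThan_iff nth_mem)
  have inj: "js ! i = js ! j \<longleftrightarrow> i = j" if "i < n" "j < n" for i j
    using js that by (simp add: nth_eq_iff_index_eq)
  have "sort (map l [0..<n]) = map l (sort_key l [0..<n])"
    by (rule properties_for_sort) simp_all
  then have mapjs: "rev (sort (map l [0..<n])) = map l js" by (simp add: js_def rev_map)
  have ev: "eigval M (Suc i) = l (js ! i)" if "i < n" for i
    using eigval_orthonormal_eigenbasis[OF M ortho diag, of i] mapjs that js by simp
  have bij: "bij_betw (\<lambda>i. js ! i) {..<n} {..<n}"
    by (rule bij_betw_nth) (simp_all only: js)
  have mono: "eigval M (Suc j) \<le> eigval M (Suc i)" if "i \<le> j" "j < n" for i j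
  proof -
    have "sorted (rev (map l js))" by (simp add: js_def rev_map[symmetric])
    then have "map l js ! j \<le> map l js ! i" using that js by (intro sorted_rev_nth_mono) auto
    then show ?thesis using that ev js by simp
  qed
  have "y = (\<Sum>j<n. fscale (ip n (e (js ! j)) y) (e (js ! j)))" if "y \<in> supported n" for y
    using exp[OF that] sum.reindex_bij_betw[OF bij, of "\<lambda>j. fscale (ip n (e j) y) (e j)"] by simp
  then have "eigenbasis n M (\<lambda>i. e (js ! i))"
    unfolding eigenbasis_def using e ortho diag ev mono jslt inj by (intro conjI) auto
  then show ?thesis by blast
qed

lemma eigenbasis_combination:
  assumes e: "eigenbasis n M e" and u: "u = (\<Sum>j<n. fscale (x j) (e j))"
  shows "u \<in> supported n" "mq n M u = (\<Sum>j<n. (cmod (x j))\<^sup>2 * eigval M (Suc j))"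
    "sqnorm n u = (\<Sum>j<n. (cmod (x j))\<^sup>2)" "i < n \<Longrightarrow> ip n (e i) u = x i"
proof -
  interpret I: sesquilinear_form fscale "ip n" by (rule sesquilinear_ip)
  interpret H: sesquilinear_form fscale "mform n (\<lambda>i j. M $$ (i, j))" by (rule sesquilinear_mform)
  have 1: "\<forall>i<n. \<forall>j<n. i \<noteq> j \<longrightarrow> ip n (e i) (e j) = 0"
    and 2: "\<forall>i<n. \<forall>j<n. i \<noteq> j \<longrightarrow> mform n (\<lambda>i j. M $$ (i, j)) (e i) (e j) = 0"
    using e unfolding eigenbasis_def by auto
  show "u \<in> supported n" using e unfolding u eigenbasis_def
    by (auto simp: supported_def sum_fun_apply fscale_def)
  have "H.rot 0 u = (\<Sum>j<n. (cmod (x j))\<^sup>2 * H.rot 0 (e j))" unfolding u by (rule H.rot_combination[OF 2])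
  also have "\<dots> = (\<Sum>j<n. (cmod (x j))\<^sup>2 * eigval M (Suc j))"
    using e by (intro sum.cong) (auto simp: H.rot_def eigenbasis_def)
  finally show "mq n M u = (\<Sum>j<n. (cmod (x j))\<^sup>2 * eigval M (Suc j))" by (simp add: H.rot_def mq_def)
  have "I.rot 0 u = (\<Sum>j<n. (cmod (x j))\<^sup>2 * I.rot 0 (e j))" unfolding u by (rule I.rot_combination[OF 1])
  also have "\<dots> = (\<Sum>j<n. (cmod (x j))\<^sup>2)"
    using e by (intro sum.cong) (auto simp: I.rot_def eigenbasis_def)
  finally show "sqnorm n u = (\<Sum>j<n. (cmod (x j))\<^sup>2)" by (simp add: I.rot_def ip_self)
  show "ip n (e i) u = x i" if "i < n"
    unfolding u I.orthogonal_combination[OF 1 that] using e that by (simp add: eigenbasis_def)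
qed

text \<open>The vector is a combination of eigenvectors whose eigenvalues all lie on one side of
  \<open>eigval M (Suc k)\<close>; here \<open>k\<close> counts from 0.\<close>

lemma rayleigh:
  assumes e: "eigenbasis n M e" and u: "u \<in> supported n" and k: "k < n"
  shows "(\<And>i. k < i \<Longrightarrow> i < n \<Longrightarrow> ip n (e i) u = 0) \<Longrightarrow> eigval M (Suc k) * sqnorm n u \<le> mq n M u"
    and "(\<And>i. i < k \<Longrightarrow> ip n (e i) u = 0) \<Longrightarrow> mq n M u \<le> eigval M (Suc k) * sqnorm n u"
proof -
  define x where "x = (\<lambda>j. ip n (e j) u)"
  have ux: "u = (\<Sum>j<n. fscale (x j) (e j))" using e u by (simp add: eigenbasis_def x_def)
  note c = eigenbasis_combination[OF e ux]
  have mono: "eigval M (Suc j) \<le> eigval M (Suc i)" if "i \<le> j" "j < n" for i j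
    using e that by (simp add: eigenbasis_def)
  show "eigval M (Suc k) * sqnorm n u \<le> mq n M u" if "\<And>i. k < i \<Longrightarrow> i < n \<Longrightarrow> ip n (e i) u = 0"
    unfolding c(2,3) sum_distrib_left
  proof (intro sum_mono)
    fix j assume "j \<in> {..<n}"
    then show "eigval M (Suc k) * (cmod (x j))\<^sup>2 \<le> (cmod (x j))\<^sup>2 * eigval M (Suc j)"
      using that[of j] mono[of j k] k
      by (cases "k < j") (auto simp: x_def mult.commute[of _ "eigval _ _"] intro!: mult_right_mono)
  qed
  show "mq n M u \<le> eigval M (Suc k) * sqnorm n u" if "\<And>i. i < k \<Longrightarrow> ip n (e i) u = 0"
    unfolding c(2,3) sum_distrib_left
  proof (intro sum_mono)
    fix j assume "j \<in> {..<n}"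
    then show "(cmod (x j))\<^sup>2 * eigval M (Suc j) \<le> eigval M (Suc k) * (cmod (x j))\<^sup>2"
      using that[of j] mono[of k j] k
      by (cases "j < k") (auto simp: x_def mult.commute[of _ "eigval _ _"] intro!: mult_right_mono)
  qed
qed

lemma eigenbasis_kernel_vector:
  assumes e: "eigenbasis n M e" and J: "J \<subseteq> {..<n}" "length \<phi>s < card J"
    and lin: "\<And>\<phi> x f. \<phi> \<in> set \<phi>s \<Longrightarrow> \<phi> (\<Sum>j<n. fscale (x j) (f j)) = (\<Sum>j<n. x j * \<phi> (f j))"
  shows "\<exists>u\<in>supported n. sqnorm n u > 0 \<and> (\<forall>\<phi>\<in>set \<phi>s. \<phi> u = 0) \<and> (\<forall>i<n. i \<notin> J \<longrightarrow> ip n (e i) u = 0)"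
proof -
  have fin: "finite J" using J finite_subset by blast
  have "length (map (\<lambda>\<phi> j. \<phi> (e j)) \<phi>s) < card J" using J by simp
  from underdetermined_system[OF fin this] obtain c where c: "\<exists>j\<in>J. c j \<noteq> 0"
    "\<forall>\<phi>\<in>set \<phi>s. (\<Sum>j\<in>J. c j * \<phi> (e j)) = 0" by auto
  define x where "x = (\<lambda>j. if j \<in> J then c j else 0)"
  define u where "u = (\<Sum>j<n. fscale (x j) (e j))"
  note comb = eigenbasis_combination[OF e u_def]
  have "\<phi> u = 0" if "\<phi> \<in> set \<phi>s" for \<phi>
  proof -
    have "\<phi> u = (\<Sum>j<n. x j * \<phi> (e j))" unfolding u_def by (rule lin[OF that])
    also have "\<dots> = (\<Sum>j\<in>J. c j * \<phi> (e j))"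
      using J(1) by (subst sum.mono_neutral_right[of "{..<n}" J]) (auto simp: x_def)
    finally show ?thesis using c that by simp
  qed
  moreover have "sqnorm n u > 0"
  proof -
    obtain j where "j \<in> J" "c j \<noteq> 0" using c by blast
    then show ?thesis unfolding comb(3) using J by (intro sum_pos2[of _ j]) (auto simp: x_def)
  qed
  moreover have "ip n (e i) u = 0" if "i < n" "i \<notin> J" for i using comb(4)[OF that(1)] that by (simp add: x_def)
  ultimately show ?thesis using comb(1) by blast
qed

lemma ip_linear: "ip n v (\<Sum>j\<in>J. fscale (x j) (f j)) = (\<Sum>j\<in>J. x j * ip n v (f j))"
proof -
  interpret I: sesquilinear_form fscale "ip n" by (rule sesquilinear_ip)
  show ?thesis by (simp add: I.sum_right I.scale_right)
qed

lemma eigenbasis_common_vector: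
  assumes e: "eigenbasis n M e" and J: "J \<subseteq> {..<n}" and I: "finite I" "card I < card J"
  shows "\<exists>u\<in>supported n. sqnorm n u > 0 \<and> (\<forall>i\<in>I. ip n (f i) u = 0) \<and> (\<forall>i<n. i \<notin> J \<longrightarrow> ip n (e i) u = 0)"
proof -
  obtain ks where "set ks = I" "length ks = card I"
    using I(1) finite_distinct_list distinct_card by metis
  then have len: "length (map (\<lambda>i. ip n (f i)) ks) < card J" using I(2) by simp
  have "\<phi> (\<Sum>j<n. fscale (x j) (g j)) = (\<Sum>j<n. x j * \<phi> (g j))"
    if "\<phi> \<in> set (map (\<lambda>i. ip n (f i)) ks)" for \<phi> x g
    using that by (auto simp: ip_linear)
  from eigenbasis_kernel_vector[OF e J len this] show ?thesis using \<open>set ks = I\<close> by simp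
qed

text \<open>The span of the first \<open>k\<close> eigenvectors of \<open>M\<close> meets the
  complement of the first \<open>k - 1\<close> of \<open>M'\<close>. With \<open>r = 1\<close> this
  gives perturbation bounds, with \<open>\<delta> = 0\<close> positive homogeneity.\<close>

lemma eigval_compare:
  assumes M: "hermitian n M" "hermitian n M'" and k: "1 \<le> k" "k \<le> n" and "r > 0"
    and le: "\<And>u. u \<in> supported n \<Longrightarrow> r * mq n M u \<le> mq n M' u + \<delta> * sqnorm n u"
  shows "r * eigval M k \<le> eigval M' k + \<delta>"
proof -
  obtain e e' where e: "eigenbasis n M e" "eigenbasis n M' e'" using M eigenbasis_exists by blast
  obtain m where m: "k = Suc m" "m < n" using k by (cases k) auto
  obtain u where u: "u \<in> supported n" "sqnorm n u > 0" "\<forall>i<m. ip n (e' i) u = 0"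
    "\<forall>i<n. i \<notin> {..<k} \<longrightarrow> ip n (e i) u = 0"
    using eigenbasis_common_vector[OF e(1), of "{..<k}" "{..<m}" e'] m k by auto
  have "r * (eigval M k * sqnorm n u) \<le> r * mq n M u"
    using rayleigh(1)[OF e(1) u(1) m(2)] u(4) m \<open>r > 0\<close> by (intro mult_left_mono) auto
  also have "\<dots> \<le> mq n M' u + \<delta> * sqnorm n u" by (rule le[OF u(1)])
  also have "\<dots> \<le> eigval M' k * sqnorm n u + \<delta> * sqnorm n u"
    using rayleigh(2)[OF e(2) u(1) m(2)] u(3) m by simp
  finally have "(r * eigval M k) * sqnorm n u \<le> (eigval M' k + \<delta>) * sqnorm n u" by (simp add: algebra_simps)
  then show ?thesis using u(2) by simp
qed

text \<open>A common vector compares both eigenvalues: dimension \<open>k\<close> against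
  \<open>k - 1\<close> conditions for one inequality, \<open>n - k + 1\<close> against
  \<open>n - k\<close> for the other.\<close>

lemma eigval_negate:
  assumes M: "hermitian n M" "hermitian n M'" and k: "1 \<le> k" "k \<le> n"
    and neg: "\<And>u. u \<in> supported n \<Longrightarrow> mq n M' u = - mq n M u"
  shows "eigval M' (n - k + 1) = - eigval M k"
proof -
  obtain e e' where e: "eigenbasis n M e" "eigenbasis n M' e'" using M eigenbasis_exists by blast
  obtain m where m: "k = Suc m" "m < n" using k by (cases k) auto
  have nk: "n - k < n" using k by auto
  show ?thesis
  proof (rule antisym)
    obtain u where u: "u \<in> supported n" "sqnorm n u > 0" "\<forall>i\<in>{n - k<..<n}. ip n (e' i) u = 0"
      "\<forall>i<n. i \<notin> {..<k} \<longrightarrow> ip n (e i) u = 0"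
      using eigenbasis_common_vector[OF e(1), of "{..<k}" "{n - k<..<n}" e'] k by auto
    have "eigval M k * sqnorm n u \<le> mq n M u" "eigval M' (n - k + 1) * sqnorm n u \<le> mq n M' u"
      using rayleigh(1)[OF e(1) u(1) m(2)] rayleigh(1)[OF e(2) u(1) nk] u(3,4) m by auto
    then have "eigval M' (n - k + 1) * sqnorm n u \<le> (- eigval M k) * sqnorm n u" using neg[OF u(1)] by simp
    then show "eigval M' (n - k + 1) \<le> - eigval M k" using u(2) by (metis mult_le_cancel_right_pos)
  next
    obtain u where u: "u \<in> supported n" "sqnorm n u > 0" "\<forall>i\<in>{..<n - k}. ip n (e' i) u = 0"
      "\<forall>i<n. i \<notin> {m..<n} \<longrightarrow> ip n (e i) u = 0"
    proof -
      have "{m..<n} \<subseteq> {..<n}" "card {..<n - k} < card {m..<n}" using m by auto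
      then show thesis
        using eigenbasis_common_vector[OF e(1), of "{m..<n}" "{..<n - k}" e'] that by blast
    qed
    have "mq n M u \<le> eigval M k * sqnorm n u" "mq n M' u \<le> eigval M' (n - k + 1) * sqnorm n u"
      using rayleigh(2)[OF e(1) u(1) m(2)] rayleigh(2)[OF e(2) u(1) nk] u(3,4) m by auto
    then have "(- eigval M k) * sqnorm n u \<le> eigval M' (n - k + 1) * sqnorm n u" using neg[OF u(1)] by simp
    then show "- eigval M k \<le> eigval M' (n - k + 1)" using u(2) by (metis mult_le_cancel_right_pos)
  qed
qed

text \<open>The span of the family has dimension \<open>k\<close> and therefore meets the complement
  of the first \<open>k - 1\<close> eigenvectors.\<close>

lemma eigval_ge_of_family:
  assumes M: "hermitian n M" and k: "1 \<le> k" "k \<le> n"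
    and w: "\<And>j. j < k \<Longrightarrow> w j \<in> supported n"
    and ortho: "\<And>i j. i < k \<Longrightarrow> j < k \<Longrightarrow> ip n (w i) (w j) = (if i = j then 1 else 0)"
    and ge: "\<And>x. c * sqnorm n (\<Sum>j<k. fscale (x j) (w j)) \<le> mq n M (\<Sum>j<k. fscale (x j) (w j))"
  shows "c \<le> eigval M k"
proof -
  interpret I: sesquilinear_form fscale "ip n" by (rule sesquilinear_ip)
  obtain e where e: "eigenbasis n M e" using M eigenbasis_exists by blast
  obtain m where m: "k = Suc m" "m < n" using k by (cases k) auto
  have "length (map (\<lambda>i j. ip n (e i) (w j)) [0..<m]) < card {..<k}" using m by simp
  from underdetermined_system[OF finite_lessThan this] obtain x where x: "\<exists>j\<in>{..<k}. x j \<noteq> 0"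
    "\<forall>i<m. (\<Sum>j<k. x j * ip n (e i) (w j)) = 0" by (auto simp: atLeast0LessThan)
  define u where "u = (\<Sum>j<k. fscale (x j) (w j))"
  have us: "u \<in> supported n" using w by (auto simp: u_def supported_def sum_fun_apply fscale_def)
  have "I.rot 0 u = (\<Sum>j<k. (cmod (x j))\<^sup>2 * I.rot 0 (w j))"
    unfolding u_def by (rule I.rot_combination) (use ortho in auto)
  also have "\<dots> = (\<Sum>j<k. (cmod (x j))\<^sup>2)"
    using ortho by (intro sum.cong) (auto simp: I.rot_def)
  finally have "sqnorm n u = (\<Sum>j<k. (cmod (x j))\<^sup>2)" by (simp add: I.rot_def ip_self)
  moreover obtain j where "j < k" "x j \<noteq> 0" using x by auto
  ultimately have pos: "sqnorm n u > 0" by (auto intro!: sum_pos2[of _ j])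
  have "c * sqnorm n u \<le> mq n M u" using ge[of x] by (simp add: u_def)
  also have "\<dots> \<le> eigval M k * sqnorm n u"
  proof -
    have "ip n (e i) u = 0" if "i < m" for i using x(2) that by (simp only: u_def ip_linear)
    then show ?thesis using rayleigh(2)[OF e us m(2)] m by simp
  qed
  finally show ?thesis using pos by simp
qed

section \<open>The Li--Sze inequalities\<close>

text \<open>Arbitrary real coefficients are allowed, because the tangency argument moves along
  straight lines off the unit circle.\<close>

definition pencil :: "complex mat \<Rightarrow> real \<Rightarrow> real \<Rightarrow> complex mat" where
  "pencil A x y = complex_of_real x \<cdot>\<^sub>m re_mat A + complex_of_real y \<cdot>\<^sub>m im_mat A"

lemma mat_adjoint_index [simp]:
  "i < dim_col A \<Longrightarrow> j < dim_row A \<Longrightarrow> mat_adjoint A $$ (i, j) = cnj (A $$ (j, i) :: complex)"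
  by (simp add: mat_adjoint_def mat_of_rows_index)

lemma mat_adjoint_dim [simp]:
  "dim_row (mat_adjoint A) = dim_col A" "dim_col (mat_adjoint A) = dim_row A"
  by (simp_all add: mat_adjoint_def)

lemma re_mat_carrier [simp]: "A \<in> carrier_mat n n \<Longrightarrow> re_mat A \<in> carrier_mat n n"
  and im_mat_carrier [simp]: "A \<in> carrier_mat n n \<Longrightarrow> im_mat A \<in> carrier_mat n n"
  by (auto simp: re_mat_def im_mat_def)

lemma re_mat_index: "A \<in> carrier_mat n n \<Longrightarrow> i < n \<Longrightarrow> j < n \<Longrightarrow>
    re_mat A $$ (i, j) = (A $$ (i, j) + cnj (A $$ (j, i))) / 2"
  and im_mat_index: "A \<in> carrier_mat n n \<Longrightarrow> i < n \<Longrightarrow> j < n \<Longrightarrow>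
    im_mat A $$ (i, j) = (A $$ (i, j) - cnj (A $$ (j, i))) / (2 * \<i>)"
  by (auto simp: re_mat_def im_mat_def)

lemma pencil_carrier [simp]: "A \<in> carrier_mat n n \<Longrightarrow> pencil A x y \<in> carrier_mat n n"
  by (simp add: pencil_def)

lemma pencil_index: "A \<in> carrier_mat n n \<Longrightarrow> i < n \<Longrightarrow> j < n \<Longrightarrow>
    pencil A x y $$ (i, j) = of_real x * re_mat A $$ (i, j) + of_real y * im_mat A $$ (i, j)"
  by (simp add: pencil_def carrier_matD[OF re_mat_carrier] carrier_matD[OF im_mat_carrier])

lemma eigval_dir_pencil: "eigval_dir A k \<theta> = eigval (pencil A (cos \<theta>) (sin \<theta>)) k"
  by (simp add: eigval_dir_def pencil_def)

lemma hermitian_pencil: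
  assumes "A \<in> carrier_mat n n"
  shows "hermitian n (pencil A x y)"
  unfolding hermitian_def
proof (intro conjI allI impI)
  fix i j assume "i < n" "j < n"
  then show "pencil A x y $$ (j, i) = cnj (pencil A x y $$ (i, j))"
    using assms by (simp add: pencil_index re_mat_index im_mat_index field_simps)
qed (use assms in simp)

lemma mform_cong: "(\<And>i j. i < n \<Longrightarrow> j < n \<Longrightarrow> B i j = C i j) \<Longrightarrow> mform n B u v = mform n C u v"
  unfolding mform_def by (intro sum.cong refl) simp

lemma mq_pencil:
  assumes "A \<in> carrier_mat n n"
  shows "mq n (pencil A x y) u = x * Re (mform n (\<lambda>i j. A $$ (i, j)) u u) + y * Im (mform n (\<lambda>i j. A $$ (i, j)) u u)"
proof -
  let ?q = "mform n (\<lambda>i j. A $$ (i, j)) u u"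
  \<comment> \<open>The coefficients of \<open>A\<close> and of its adjoint in
    \<open>x Re A + y Im A\<close>.\<close>
  let ?a = "(of_real x + of_real y / \<i>) / 2" and ?b = "(of_real x - of_real y / \<i>) / 2"
  have "mform n (\<lambda>i j. pencil A x y $$ (i, j)) u u = mform n (\<lambda>i j. ?a * A $$ (i, j) + ?b * cnj (A $$ (j, i))) u u"
    by (rule mform_cong) (use assms in \<open>simp add: pencil_index re_mat_index im_mat_index field_simps\<close>)
  also have "\<dots> = ?a * ?q + ?b * cnj ?q" by (simp only: mform_add mform_cmult mform_cnj)
  finally show ?thesis by (simp add: mq_def divide_i algebra_simps)
qed

lemma pencil_rot:
  assumes "A \<in> carrier_mat n n"
  shows "mq n (pencil A (cos \<theta>) (sin \<theta>)) u = Re (cis (- \<theta>) * mform n (\<lambda>i j. A $$ (i, j)) u u)"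
  using mq_pencil[OF assms] by simp

lemma mform_bounded:
  "\<exists>C\<ge>0. \<forall>u. cmod (mform n B u u) \<le> C * sqnorm n u"
proof (intro exI[of _ "\<Sum>i<n. \<Sum>j<n. cmod (B i j)"] conjI allI)
  show "0 \<le> (\<Sum>i<n. \<Sum>j<n. cmod (B i j))" by (intro sum_nonneg) auto
  fix u :: "nat \<Rightarrow> complex"
  have le: "cmod (u i) * cmod (u j) \<le> sqnorm n u" if "i < n" "j < n" for i j
  proof -
    have s: "(cmod (u l))\<^sup>2 \<le> sqnorm n u" if "l < n" for l
      unfolding sqnorm_def using that by (intro member_le_sum) auto
    have "2 * (cmod (u i) * cmod (u j)) \<le> (cmod (u i))\<^sup>2 + (cmod (u j))\<^sup>2"
      using sum_squares_bound[of "cmod (u i)" "cmod (u j)"] by simp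
    then show ?thesis using s[OF that(1)] s[OF that(2)] by simp
  qed
  have "cmod (mform n B u u) \<le> (\<Sum>i<n. \<Sum>j<n. cmod (cnj (u i) * B i j * u j))"
    unfolding mform_def by (intro order.trans[OF norm_sum] sum_mono norm_sum)
  also have "\<dots> \<le> (\<Sum>i<n. \<Sum>j<n. cmod (B i j) * sqnorm n u)"
  proof (intro sum_mono)
    fix i j assume "i \<in> {..<n}" "j \<in> {..<n}"
    then have "cmod (B i j) * (cmod (u i) * cmod (u j)) \<le> cmod (B i j) * sqnorm n u"
      using le by (intro mult_left_mono) auto
    then show "cmod (cnj (u i) * B i j * u j) \<le> cmod (B i j) * sqnorm n u"
      by (simp add: norm_mult mult_ac)
  qed
  finally show "cmod (mform n B u u) \<le> (\<Sum>i<n. \<Sum>j<n. cmod (B i j)) * sqnorm n u"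
    by (simp add: sum_distrib_right)
qed

lemma eigval_pencil_lipschitz:
  assumes A: "A \<in> carrier_mat n n" and k: "1 \<le> k" "k \<le> n"
  shows "\<exists>C\<ge>0. \<forall>x y x' y'. eigval (pencil A x y) k \<le> eigval (pencil A x' y') k + C * (\<bar>x - x'\<bar> + \<bar>y - y'\<bar>)"
proof -
  obtain C where C: "C \<ge> 0" "\<And>u. cmod (mform n (\<lambda>i j. A $$ (i, j)) u u) \<le> C * sqnorm n u"
    using mform_bounded[of n "\<lambda>i j. A $$ (i, j)"] by blast
  have "1 * eigval (pencil A x y) k \<le> eigval (pencil A x' y') k + C * (\<bar>x - x'\<bar> + \<bar>y - y'\<bar>)" for x y x' y'
  proof (rule eigval_compare[OF hermitian_pencil[OF A] hermitian_pencil[OF A] k])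
    fix u :: "nat \<Rightarrow> complex"
    let ?q = "mform n (\<lambda>i j. A $$ (i, j)) u u"
    have "(x - x') * Re ?q \<le> \<bar>x - x'\<bar> * (C * sqnorm n u)"
      using order.trans[OF abs_Re_le_cmod C(2)[of u]]
      by (metis abs_ge_zero abs_le_D1 abs_mult mult_left_mono)
    moreover have "(y - y') * Im ?q \<le> \<bar>y - y'\<bar> * (C * sqnorm n u)"
      using order.trans[OF abs_Im_le_cmod C(2)[of u]]
      by (metis abs_ge_zero abs_le_D1 abs_mult mult_left_mono)
    ultimately show "1 * mq n (pencil A x y) u \<le> mq n (pencil A x' y') u + C * (\<bar>x - x'\<bar> + \<bar>y - y'\<bar>) * sqnorm n u"
      unfolding mq_pencil[OF A] by (simp add: algebra_simps)
  qed simp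
  then show ?thesis using C(1) by (intro exI[of _ C]) auto
qed

lemma continuous_eigval_pencil:
  fixes f g :: "real \<Rightarrow> real"
  assumes A: "A \<in> carrier_mat n n" and k: "1 \<le> k" "k \<le> n"
    and f: "continuous_on S f" "continuous_on S g"
  shows "continuous_on S (\<lambda>t. eigval (pencil A (f t) (g t)) k)"
proof -
  obtain C where C: "C \<ge> 0" "\<And>x y x' y'. eigval (pencil A x y) k \<le> eigval (pencil A x' y') k + C * (\<bar>x - x'\<bar> + \<bar>y - y'\<bar>)"
    using eigval_pencil_lipschitz[OF A k] by blast
  let ?h = "\<lambda>t. eigval (pencil A (f t) (g t)) k"
  show ?thesis unfolding continuous_on_def
  proof
    fix t assume t: "t \<in> S"
    have "((\<lambda>s. C * (\<bar>f s - f t\<bar> + \<bar>g s - g t\<bar>)) \<longlongrightarrow> C * (\<bar>f t - f t\<bar> + \<bar>g t - g t\<bar>)) (at t within S)"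
      using f t unfolding continuous_on_def by (intro tendsto_intros) auto
    then have lim: "((\<lambda>s. C * (\<bar>f s - f t\<bar> + \<bar>g s - g t\<bar>)) \<longlongrightarrow> 0) (at t within S)" by simp
    have bd: "\<bar>?h s - ?h t\<bar> \<le> C * (\<bar>f s - f t\<bar> + \<bar>g s - g t\<bar>)" for s
      using C(2)[of "f s" "g s" "f t" "g t"] C(2)[of "f t" "g t" "f s" "g s"] by (simp add: abs_minus_commute)
    have "((\<lambda>s. ?h s - ?h t) \<longlongrightarrow> 0) (at t within S)"
      by (rule tendsto_0_le[OF lim, where K = 1])
        (intro always_eventually allI, simp, rule order.trans[OF bd abs_ge_self])
    then show "(?h \<longlongrightarrow> ?h t) (at t within S)" by (simp add: LIM_zero_iff)
  qed
qed

text \<open>A negative factor would reverse the order of the eigenvalues; hence rays, not lines,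
  appear in the tangency argument.\<close>

lemma eigval_pencil_scale:
  assumes A: "A \<in> carrier_mat n n" and k: "1 \<le> k" "k \<le> n" and "r > 0"
  shows "eigval (pencil A (r * x) (r * y)) k = r * eigval (pencil A x y) k"
proof (rule antisym)
  have "r * eigval (pencil A x y) k \<le> eigval (pencil A (r * x) (r * y)) k + 0"
    by (rule eigval_compare[OF hermitian_pencil[OF A] hermitian_pencil[OF A] k \<open>r > 0\<close>])
      (simp add: mq_pencil[OF A] algebra_simps)
  then show "r * eigval (pencil A x y) k \<le> eigval (pencil A (r * x) (r * y)) k" by simp
  have "(1 / r) * eigval (pencil A (r * x) (r * y)) k \<le> eigval (pencil A x y) k + 0"
    by (rule eigval_compare[OF hermitian_pencil[OF A] hermitian_pencil[OF A] k])
      (use \<open>r > 0\<close> in \<open>simp_all add: mq_pencil[OF A] field_simps\<close>)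
  then show "eigval (pencil A (r * x) (r * y)) k \<le> r * eigval (pencil A x y) k"
    using \<open>r > 0\<close> by (simp add: field_simps)
qed

lemma eigval_pencil_opposite:
  assumes A: "A \<in> carrier_mat n n" and k: "1 \<le> k" "k \<le> n"
  shows "eigval (pencil A x y) (n - k + 1) = - eigval (pencil A (- x) (- y)) k"
  by (rule eigval_negate[OF hermitian_pencil[OF A] hermitian_pencil[OF A] k])
    (simp add: mq_pencil[OF A])

section \<open>Compressions to orthonormal columns and the two inclusions\<close>

lemma columns_isometry:
  assumes X: "X \<in> carrier_mat n k"
  shows "(mat_adjoint X * X = 1\<^sub>m k) \<longleftrightarrow>
      (\<forall>i<k. \<forall>j<k. ip n (\<lambda>l. if l < n then X $$ (l, i) else 0) (\<lambda>l. if l < n then X $$ (l, j) else 0) = (if i = j then 1 else 0))"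
proof -
  have "(mat_adjoint X * X) $$ (i, j) = ip n (\<lambda>l. if l < n then X $$ (l, i) else 0) (\<lambda>l. if l < n then X $$ (l, j) else 0)"
    if "i < k" "j < k" for i j
    using that X by (simp add: scalar_prod_def ip_def atLeast0LessThan)
  moreover have "mat_adjoint X * X = 1\<^sub>m k \<longleftrightarrow> (\<forall>i<k. \<forall>j<k. (mat_adjoint X * X) $$ (i, j) = (if i = j then 1 else 0))"
    using X by (auto simp: mat_eq_iff)
  ultimately show ?thesis by simp
qed

lemma columns_compression:
  assumes X: "X \<in> carrier_mat n k" and A: "A \<in> carrier_mat n n"
  shows "(mat_adjoint X * A * X = \<mu> \<cdot>\<^sub>m 1\<^sub>m k) \<longleftrightarrow>
      (\<forall>i<k. \<forall>j<k. mform n (\<lambda>i j. A $$ (i, j)) (\<lambda>l. if l < n then X $$ (l, i) else 0) (\<lambda>l. if l < n then X $$ (l, j) else 0) = (if i = j then \<mu> else 0))"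
proof -
  have "(mat_adjoint X * A * X) $$ (i, j) = mform n (\<lambda>i j. A $$ (i, j)) (\<lambda>l. if l < n then X $$ (l, i) else 0) (\<lambda>l. if l < n then X $$ (l, j) else 0)"
    if "i < k" "j < k" for i j
  proof -
    have "(mat_adjoint X * A * X) $$ (i, j) = (\<Sum>m<n. (\<Sum>h<n. cnj (X $$ (h, i)) * A $$ (h, m)) * X $$ (m, j))"
      using that X A by (simp add: scalar_prod_def atLeast0LessThan)
    also have "\<dots> = (\<Sum>h<n. \<Sum>m<n. cnj (X $$ (h, i)) * A $$ (h, m) * X $$ (m, j))"
      unfolding sum_distrib_right by (rule sum.swap)
    finally show ?thesis by (simp add: mform_def)
  qed
  moreover have "mat_adjoint X * A * X = \<mu> \<cdot>\<^sub>m 1\<^sub>m k \<longleftrightarrow> (\<forall>i<k. \<forall>j<k. (mat_adjoint X * A * X) $$ (i, j) = (if i = j then \<mu> else 0))"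
    using X by (auto simp: mat_eq_iff)
  ultimately show ?thesis by simp
qed

text \<open>On the \<open>k\<close>-dimensional span of the columns of \<open>X\<close> the form of
  \<open>A\<close> is \<mu> times the squared norm, so every matrix of the pencil is constant
  there.\<close>

lemma rank_numerical_range_le_eigval:
  assumes A: "A \<in> carrier_mat n n" and k: "1 \<le> k" "k \<le> n" and \<mu>: "\<mu> \<in> rank_numerical_range k A"
  shows "x * Re \<mu> + y * Im \<mu> \<le> eigval (pencil A x y) k"
proof -
  let ?B = "\<lambda>i j. A $$ (i, j)"
  interpret F: sesquilinear_form fscale "mform n ?B" by (rule sesquilinear_mform)
  interpret I: sesquilinear_form fscale "ip n" by (rule sesquilinear_ip)
  obtain X where X: "X \<in> carrier_mat n k" "mat_adjoint X * X = 1\<^sub>m k" "mat_adjoint X * A * X = \<mu> \<cdot>\<^sub>m 1\<^sub>m k"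
    using \<mu> A by (auto simp: rank_numerical_range_def)
  define w where "w = (\<lambda>j l. if l < n then X $$ (l, j) else 0)"
  have o: "ip n (w i) (w j) = (if i = j then 1 else 0)" if "i < k" "j < k" for i j
    using columns_isometry[OF X(1)] X(2) that unfolding w_def by blast
  have m: "mform n ?B (w i) (w j) = (if i = j then \<mu> else 0)" if "i < k" "j < k" for i j
    using columns_compression[OF X(1) A] X(3) that unfolding w_def by blast
  show ?thesis
  proof (rule eigval_ge_of_family[OF hermitian_pencil[OF A] k, of w])
    show "w j \<in> supported n" for j by (simp add: w_def supported_def)
    show "ip n (w i) (w j) = (if i = j then 1 else 0)" if "i < k" "j < k" for i j by (rule o[OF that])
    fix c :: "nat \<Rightarrow> complex"
    define u where "u = (\<Sum>j<k. fscale (c j) (w j))"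
    have "mform n ?B u u = \<mu> * ip n u u"
    proof -
      have "mform n ?B u u = (\<Sum>j<k. \<Sum>i<k. c j * (cnj (c i) * mform n ?B (w i) (w j)))"
        unfolding u_def F.sum_left F.scale_left F.sum_right F.scale_right sum_distrib_left ..
      also have "\<dots> = (\<Sum>j<k. \<Sum>i<k. \<mu> * (c j * (cnj (c i) * ip n (w i) (w j))))"
        using o m by (intro sum.cong refl) simp
      also have "\<dots> = \<mu> * ip n u u"
        unfolding u_def I.sum_left I.scale_left I.sum_right I.scale_right sum_distrib_left ..
      finally show ?thesis .
    qed
    then have "mq n (pencil A x y) u = (x * Re \<mu> + y * Im \<mu>) * sqnorm n u"
      by (simp add: mq_pencil[OF A] ip_self algebra_simps)
    then show "(x * Re \<mu> + y * Im \<mu>) * sqnorm n (\<Sum>j<k. fscale (c j) (w j)) \<le> mq n (pencil A x y) (\<Sum>j<k. fscale (c j) (w j))"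
      by (simp add: u_def)
  qed
qed

text \<open>The hard half of the Li--Sze description of the higher rank numerical range, for points
  satisfying the eigenvalue inequalities strictly.\<close>

lemma rank_numerical_range_strict:
  assumes A: "A \<in> carrier_mat n n" and k: "1 \<le> k" "k \<le> n"
    and strict: "\<And>\<theta>. cos \<theta> * Re \<mu> + sin \<theta> * Im \<mu> < eigval (pencil A (cos \<theta>) (sin \<theta>)) k"
  shows "\<mu> \<in> rank_numerical_range k A"
proof -
  define B where "B = (\<lambda>i j. A $$ (i, j) + - \<mu> * (if i = j then 1 else 0))"
  interpret F: form_with_inner_product fscale "mform n B" "ip n" by (rule form_with_inner_product_ip)
  have B: "mform n B u v = mform n (\<lambda>i j. A $$ (i, j)) u v - \<mu> * ip n u v" for u v
    unfolding B_def mform_add mform_cmult mform_delta by simp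
  \<comment> \<open>Fewer than \<open>k\<close> functionals have a common zero in the span of the
    top \<open>k\<close> eigenvectors; there the strict inequality makes the form of
    \<open>A - \<mu>\<close> positive in direction \<theta>.\<close>
  have pos: "F.positive_rank (F.rot \<theta>) (supported n) k" for \<theta>
    unfolding F.positive_rank_def
  proof (intro allI impI)
    fix \<phi>s assume len: "length \<phi>s < k" and fn: "\<forall>\<phi>\<in>set \<phi>s. F.functional \<phi>"
    let ?M = "pencil A (cos \<theta>) (sin \<theta>)"
    obtain e where e: "eigenbasis n ?M e" using eigenbasis_exists[OF hermitian_pencil[OF A]] by blast
    have "{..<k} \<subseteq> {..<n}" "length \<phi>s < card {..<k}" using k len by auto
    from eigenbasis_kernel_vector[OF e this] F.functional_sum fn
    obtain u where u: "u \<in> supported n" "sqnorm n u > 0" "\<forall>\<phi>\<in>set \<phi>s. \<phi> u = 0"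
      "\<forall>i<n. i \<notin> {..<k} \<longrightarrow> ip n (e i) u = 0" by blast
    obtain m where m: "k = Suc m" "m < n" using k by (cases k) auto
    have "eigval ?M k * sqnorm n u \<le> mq n ?M u"
      using rayleigh(1)[OF e u(1) m(2)] u(4) m by auto
    moreover have "(cos \<theta> * Re \<mu> + sin \<theta> * Im \<mu>) * sqnorm n u < eigval ?M k * sqnorm n u"
      using strict[of \<theta>] u(2) by (intro mult_strict_right_mono)
    ultimately have "(cos \<theta> * Re \<mu> + sin \<theta> * Im \<mu>) * sqnorm n u < mq n ?M u" by simp
    then have "F.rot \<theta> u > 0"
      unfolding F.rot_def B ip_self pencil_rot[OF A] by (simp add: algebra_simps)
    then show "\<exists>u\<in>supported n. (\<forall>\<phi>\<in>set \<phi>s. \<phi> u = 0) \<and> F.rot \<theta> u > 0" using u by blast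
  qed
  have "ip n x x \<noteq> 0" if "x \<in> supported n" "x \<noteq> 0" for x
    using that sqnorm_eq_0_iff[of x n] by (simp add: ip_self)
  from F.orthonormal_isotropic_family[OF finite_dim_supported this pos]
  obtain u where u: "\<forall>i<k. u i \<in> supported n"
    "\<forall>i<k. \<forall>j<k. ip n (u i) (u j) = (if i = j then 1 else 0) \<and> mform n B (u i) (u j) = 0"
    by blast
  define X where "X = mat n k (\<lambda>(i, j). u j i)"
  have X: "X \<in> carrier_mat n k" by (simp add: X_def)
  have col: "(\<lambda>l. if l < n then X $$ (l, i) else 0) = u i" if "i < k" for i
    using u(1) that by (auto simp: X_def supported_def fun_eq_iff)
  have "mat_adjoint X * X = 1\<^sub>m k" unfolding columns_isometry[OF X] using col u(2) by simp
  moreover have "mform n (\<lambda>i j. A $$ (i, j)) (u i) (u j) = (if i = j then \<mu> else 0)" if "i < k" "j < k" for i j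
    using u(2) that B[of "u i" "u j"] by auto
  then have "mat_adjoint X * A * X = \<mu> \<cdot>\<^sub>m 1\<^sub>m k" unfolding columns_compression[OF X A] using col by simp
  ultimately show ?thesis using X A unfolding rank_numerical_range_def by auto
qed

section \<open>Tight directions\<close>

definition dir :: "complex \<Rightarrow> real \<Rightarrow> real" where
  "dir p \<theta> = cos \<theta> * Re p + sin \<theta> * Im p"

lemma dir_linear [simp]: "dir (p + q) \<theta> = dir p \<theta> + dir q \<theta>" "dir (p - q) \<theta> = dir p \<theta> - dir q \<theta>"
    "dir (of_real r * p) \<theta> = r * dir p \<theta>" "dir (- p) \<theta> = - dir p \<theta>"
  by (simp_all add: dir_def algebra_simps)

lemma dir_le_cmod: "dir p \<theta> \<le> cmod p"
proof -
  have "dir p \<theta> = Re (cis (- \<theta>) * p)" by (simp add: dir_def)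
  also have "\<dots> \<le> cmod (cis (- \<theta>) * p)" by (rule complex_Re_le_cmod)
  finally show ?thesis by (simp add: norm_mult)
qed

lemma reduce_angle: "\<exists>t\<in>{0..<2 * pi}. cos t = cos \<theta> \<and> sin t = sin \<theta>"
  using sincos_total_2pi[of "cos \<theta>" "sin \<theta>"] by (metis atLeastLessThan_iff sin_cos_squared_add2)

locale thin_range =
  fixes A :: "complex mat" and n k :: nat
  assumes A: "A \<in> carrier_mat n n" and k: "1 \<le> k" "k \<le> n"
    and thin: "aff_dim (rank_numerical_range k A) \<in> {0, 1}"
    and separated: "\<forall>\<theta>\<in>{0..<2 * pi}. eigval_dir A k \<theta> \<noteq> eigval_dir A (n - k + 1) \<theta>"
begin

definition ev :: "real \<Rightarrow> real" where "ev \<theta> = eigval (pencil A (cos \<theta>) (sin \<theta>)) k"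

definition feasible :: "complex \<Rightarrow> bool" where "feasible p \<longleftrightarrow> (\<forall>\<theta>. dir p \<theta> \<le> ev \<theta>)"

lemma continuous_slack: "continuous_on S (\<lambda>\<theta>. ev \<theta> - dir p \<theta>)"
  unfolding ev_def dir_def by (intro continuous_intros continuous_eigval_pencil[OF A k])

lemma ev_cong: "cos t = cos \<theta> \<Longrightarrow> sin t = sin \<theta> \<Longrightarrow> ev t = ev \<theta> \<and> dir p t = dir p \<theta>"
  by (simp add: ev_def dir_def)

lemma feasible_range: "p \<in> rank_numerical_range k A \<Longrightarrow> feasible p"
  using rank_numerical_range_le_eigval[OF A k] by (simp add: feasible_def ev_def dir_def)

text \<open>Strictness has a positive margin by compactness, so it persists on a disc around \<mu>.
  The disc lies in the range and forces affine dimension 2.\<close>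

lemma not_strict: "\<exists>\<theta>. ev \<theta> \<le> dir \<mu> \<theta>"
proof (rule ccontr)
  assume "\<not> ?thesis"
  then have pos: "ev \<theta> - dir \<mu> \<theta> > 0" for \<theta> by (simp add: not_le)
  obtain t where t: "t \<in> {0..2 * pi}" "\<And>\<theta>. \<theta> \<in> {0..2 * pi} \<Longrightarrow> ev t - dir \<mu> t \<le> ev \<theta> - dir \<mu> \<theta>"
    using continuous_attains_inf[of "{0..2 * pi}", OF _ _ continuous_slack[of _ \<mu>]] by auto
  define \<delta> where "\<delta> = ev t - dir \<mu> t"
  have \<delta>: "\<delta> > 0" using pos by (simp add: \<delta>_def)
  have slack: "\<delta> \<le> ev \<theta> - dir \<mu> \<theta>" for \<theta>
  proof -
    obtain t' where "t' \<in> {0..<2 * pi}" "cos t' = cos \<theta>" "sin t' = sin \<theta>" using reduce_angle by blast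
    then show ?thesis using t(2)[of t'] ev_cong[of t' \<theta> \<mu>] by (simp add: \<delta>_def)
  qed
  have "{\<nu>. cmod (\<nu> - \<mu>) < \<delta>} \<subseteq> rank_numerical_range k A"
  proof
    fix \<nu> assume "\<nu> \<in> {\<nu>. cmod (\<nu> - \<mu>) < \<delta>}"
    then have d: "cmod (\<nu> - \<mu>) < \<delta>" by simp
    have "dir \<nu> \<theta> < ev \<theta>" for \<theta>
      using dir_le_cmod[of "\<nu> - \<mu>" \<theta>] d slack[of \<theta>] by simp
    then show "\<nu> \<in> rank_numerical_range k A"
      by (intro rank_numerical_range_strict[OF A k]) (simp add: dir_def ev_def)
  qed
  moreover define h where "h = \<delta> / 2"
  ultimately have in_range: "\<mu> \<in> rank_numerical_range k A" "\<mu> + of_real h \<in> rank_numerical_range k A"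
    "\<mu> + \<i> * of_real h \<in> rank_numerical_range k A"
    using \<delta> by (auto simp: norm_mult subset_iff)
  have "affine hull (rank_numerical_range k A) = UNIV"
  proof (intro UNIV_eq_I[symmetric])
    fix z
    define x y where "x = Re (z - \<mu>) / h" and "y = Im (z - \<mu>) / h"
    have "(1 - x - y) *\<^sub>R \<mu> + x *\<^sub>R (\<mu> + of_real h) + y *\<^sub>R (\<mu> + \<i> * of_real h) \<in> affine hull (rank_numerical_range k A)"
      by (rule mem_affine_3) (use in_range in \<open>auto intro: hull_inc\<close>)
    also have "(1 - x - y) *\<^sub>R \<mu> + x *\<^sub>R (\<mu> + of_real h) + y *\<^sub>R (\<mu> + \<i> * of_real h) = z"
      using \<delta> by (simp add: complex_eq_iff x_def y_def h_def algebra_simps)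
    finally show "z \<in> affine hull (rank_numerical_range k A)" .
  qed
  then have "aff_dim (rank_numerical_range k A) = 2"
    using aff_dim_affine_hull[of "rank_numerical_range k A"] by simp
  then show False using thin by simp
qed

text \<open>Otherwise a small move of \<open>p\<close> along \<open>w\<close> is strictly feasible:
  directions with \<open>dir w \<theta> < 0\<close> gain from it, and the others have uniform slack
  to spare.\<close>

lemma tight_direction:
  assumes p: "feasible p"
  shows "\<exists>\<theta>. dir p \<theta> = ev \<theta> \<and> 0 \<le> dir w \<theta>"
proof (rule ccontr)
  assume no: "\<not> ?thesis"
  have slack: "ev \<theta> - dir p \<theta> > 0" if "dir w \<theta> \<ge> 0" for \<theta>
    using no that p unfolding feasible_def by (metis diff_gt_0_iff_gt order_le_less)
  define K where "K = {0..2 * pi} \<inter> {\<theta>. 0 \<le> dir w \<theta>}"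
  have "closed {\<theta>. 0 \<le> dir w \<theta>}"
    unfolding dir_def by (intro closed_Collect_le continuous_intros)
  then have K: "compact K" unfolding K_def by (intro compact_Int_closed compact_Icc)
  have "\<exists>\<delta>>0. \<forall>\<theta>\<in>K. \<delta> \<le> ev \<theta> - dir p \<theta>"
  proof (cases "K = {}")
    case True
    then show ?thesis by (intro exI[of _ 1]) auto
  next
    case False
    then obtain t where "t \<in> K" "\<forall>\<theta>\<in>K. ev t - dir p t \<le> ev \<theta> - dir p \<theta>"
      using continuous_attains_inf[OF K _ continuous_slack[of _ p]] by blast
    then show ?thesis using slack[of t] by (intro exI[of _ "ev t - dir p t"]) (auto simp: K_def)
  qed
  then obtain \<delta> where \<delta>: "\<delta> > 0" "\<And>\<theta>. \<theta> \<in> K \<Longrightarrow> \<delta> \<le> ev \<theta> - dir p \<theta>" by blast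
  \<comment> \<open>The summand 1 covers \<open>w = 0\<close> and makes
    \<open>\<epsilon> * cmod w < \<delta>\<close> strict.\<close>
  define \<epsilon> where "\<epsilon> = \<delta> / (cmod w + 1)"
  have c: "cmod w + 1 > 0" by (simp add: add_nonneg_pos)
  have \<epsilon>: "\<epsilon> > 0" "\<epsilon> * cmod w < \<delta>" using \<delta>(1) c by (simp_all add: \<epsilon>_def field_simps)
  have "dir (p + of_real \<epsilon> * w) \<theta> < ev \<theta>" for \<theta>
  proof (cases "dir w \<theta> \<ge> 0")
    case True
    obtain t where t: "t \<in> {0..<2 * pi}" "cos t = cos \<theta>" "sin t = sin \<theta>" using reduce_angle by blast
    then have "t \<in> K" using True ev_cong[of t \<theta> w] by (simp add: K_def)
    then have "\<delta> \<le> ev \<theta> - dir p \<theta>" using \<delta>(2)[OF \<open>t \<in> K\<close>] t ev_cong[of t \<theta> p] by simp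
    moreover have "\<epsilon> * dir w \<theta> \<le> \<epsilon> * cmod w" using \<epsilon> dir_le_cmod by (intro mult_left_mono) auto
    ultimately show ?thesis using \<epsilon>(2) unfolding dir_linear by linarith
  next
    case False
    then have "\<epsilon> * dir w \<theta> < 0" using \<epsilon> by (simp add: mult_pos_neg)
    moreover have "dir p \<theta> \<le> ev \<theta>" using p by (simp add: feasible_def)
    ultimately show ?thesis by simp
  qed
  then show False using not_strict[of "p + of_real \<epsilon> * w"] by (metis not_le)
qed

text \<open>Reversing the direction turns the \<open>k\<close>-th eigenvalue into minus the
  \<open>(n - k + 1)\<close>-th, and \<open>dir p\<close> just changes sign, so two tight antipodal
  directions would make these eigenvalues equal.\<close>

lemma tight_not_antipodal:
  assumes tight: "dir p \<theta> = ev \<theta>" "dir p \<theta>' = ev \<theta>'" and opp: "cos \<theta>' = - cos \<theta>" "sin \<theta>' = - sin \<theta>"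
  shows False
proof -
  obtain t where t: "t \<in> {0..<2 * pi}" "cos t = cos \<theta>" "sin t = sin \<theta>" using reduce_angle by blast
  have "eigval_dir A (n - k + 1) t = - ev \<theta>'"
    unfolding eigval_dir_pencil eigval_pencil_opposite[OF A k] by (simp add: ev_def t opp)
  also have "\<dots> = dir p \<theta>" using tight opp by (simp add: dir_def)
  also have "\<dots> = eigval_dir A k t" using tight t by (simp add: eigval_dir_pencil ev_def)
  finally show False using bspec[OF separated t(1)] by simp
qed

lemma tight_not_opposite:
  assumes "dir p \<theta> = ev \<theta>" "dir p \<theta>' = ev \<theta>'"
  shows "cos (\<theta> - \<theta>') \<noteq> - 1"
proof
  assume c: "cos (\<theta> - \<theta>') = - 1"
  have "(cos \<theta> + cos \<theta>')\<^sup>2 + (sin \<theta> + sin \<theta>')\<^sup>2 = 2 + 2 * cos (\<theta> - \<theta>')"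
  proof -
    have "(cos \<theta> + cos \<theta>')\<^sup>2 + (sin \<theta> + sin \<theta>')\<^sup>2 =
      ((cos \<theta>)\<^sup>2 + (sin \<theta>)\<^sup>2) + ((cos \<theta>')\<^sup>2 + (sin \<theta>')\<^sup>2) + 2 * (cos \<theta> * cos \<theta>' + sin \<theta> * sin \<theta>')"
    proof -
      have "(a + b)\<^sup>2 + (c + d)\<^sup>2 = (a\<^sup>2 + c\<^sup>2) + (b\<^sup>2 + d\<^sup>2) + 2 * (a * b + c * d)" for a b c d :: real
        by (simp add: power2_eq_square algebra_simps)
      then show ?thesis .
    qed
    then show ?thesis by (simp only: sin_cos_squared_add2 cos_diff)
  qed
  then have "cos \<theta> + cos \<theta>' = 0" "sin \<theta> + sin \<theta>' = 0" using c by (simp_all add: sum_power2_eq_zero_iff)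
  then show False using tight_not_antipodal[OF assms] by simp
qed

text \<open>A direction tight at the midpoint is tight at both points, hence perpendicular to
  \<open>q - p\<close>. Looking for tight directions on either side of the line through them yields
  both normals, which are antipodal.\<close>

lemma range_subsingleton:
  assumes "p \<in> rank_numerical_range k A" "q \<in> rank_numerical_range k A"
  shows "p = q"
proof (rule ccontr)
  assume "p \<noteq> q"
  define d where "d = q - p"
  have d0: "d \<noteq> 0" using \<open>p \<noteq> q\<close> by (simp add: d_def)
  define m where "m = p + of_real (1 / 2) * d"
  have fp: "dir p \<theta> \<le> ev \<theta>" "dir q \<theta> \<le> ev \<theta>" for \<theta>
    using assms feasible_range by (auto simp: feasible_def)
  have dm: "dir m \<theta> = (dir p \<theta> + dir q \<theta>) / 2" for \<theta>
    by (simp add: m_def d_def del: of_real_divide)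
  have "feasible m" unfolding feasible_def dm using fp by (metis (no_types) add_mono field_sum_of_halves divide_right_mono add_divide_distrib order.trans zero_le_numeral)
  obtain \<theta>1 where 1: "dir m \<theta>1 = ev \<theta>1" "0 \<le> dir (\<i> * d) \<theta>1" using tight_direction[OF \<open>feasible m\<close>] by blast
  obtain \<theta>2 where 2: "dir m \<theta>2 = ev \<theta>2" "0 \<le> dir (- (\<i> * d)) \<theta>2" using tight_direction[OF \<open>feasible m\<close>] by blast
  have perp: "dir d \<theta> = 0" if "dir m \<theta> = ev \<theta>" for \<theta>
    using that fp[of \<theta>] unfolding dm by (simp add: d_def)
  \<comment> \<open>Expansion of \<open>cis \<theta>\<close> in the orthogonal basis
    \<open>d\<close>, \<open>\<i> * d\<close>, given that the first component vanishes.\<close>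
  have u: "cos \<theta> * (cmod d)\<^sup>2 = - Im d * dir (\<i> * d) \<theta>" "sin \<theta> * (cmod d)\<^sup>2 = Re d * dir (\<i> * d) \<theta>"
    "(dir (\<i> * d) \<theta>)\<^sup>2 = (cmod d)\<^sup>2" if "dir d \<theta> = 0" for \<theta>
  proof -
    have z: "cos \<theta> * Re d = - (sin \<theta> * Im d)" using that by (simp add: dir_def)
    have "cos \<theta> * (cmod d)\<^sup>2 = Re d * (cos \<theta> * Re d) + cos \<theta> * (Im d)\<^sup>2"
      unfolding cmod_power2 by (simp add: power2_eq_square algebra_simps)
    also have "\<dots> = - Im d * dir (\<i> * d) \<theta>" unfolding z by (simp add: dir_def power2_eq_square algebra_simps)
    finally show "cos \<theta> * (cmod d)\<^sup>2 = - Im d * dir (\<i> * d) \<theta>" .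
    have "sin \<theta> * (cmod d)\<^sup>2 = sin \<theta> * (Re d)\<^sup>2 - Im d * - (sin \<theta> * Im d)"
      unfolding cmod_power2 by (simp add: power2_eq_square algebra_simps)
    also have "\<dots> = Re d * dir (\<i> * d) \<theta>" unfolding z[symmetric] by (simp add: dir_def power2_eq_square algebra_simps)
    finally show "sin \<theta> * (cmod d)\<^sup>2 = Re d * dir (\<i> * d) \<theta>" .
    have "(a * - e + b * c)\<^sup>2 + (a * c + b * e)\<^sup>2 = (a\<^sup>2 + b\<^sup>2) * (c\<^sup>2 + e\<^sup>2)" for a b c e :: real
      by (simp add: power2_eq_square algebra_simps)
    moreover have "Re (\<i> * d) = - Im d" "Im (\<i> * d) = Re d" by simp_all
    ultimately have "(dir (\<i> * d) \<theta>)\<^sup>2 + (dir d \<theta>)\<^sup>2 = ((cos \<theta>)\<^sup>2 + (sin \<theta>)\<^sup>2) * (cmod d)\<^sup>2"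
      unfolding cmod_power2 dir_def by (simp only:)
    then show "(dir (\<i> * d) \<theta>)\<^sup>2 = (cmod d)\<^sup>2" using that by simp
  qed
  have t1: "dir (\<i> * d) \<theta>1 = cmod d" by (rule power2_eq_imp_eq[OF u(3)[OF perp[OF 1(1)]] 1(2) norm_ge_zero])
  have t2: "- dir (\<i> * d) \<theta>2 = cmod d" 
    by (rule power2_eq_imp_eq) (use u(3)[OF perp[OF 2(1)]] 2(2) in auto)
  then have t2': "dir (\<i> * d) \<theta>2 = - cmod d" by simp
  have "cos \<theta>2 * (cmod d)\<^sup>2 = - cos \<theta>1 * (cmod d)\<^sup>2" "sin \<theta>2 * (cmod d)\<^sup>2 = - sin \<theta>1 * (cmod d)\<^sup>2"
    by (simp_all add: u(1,2)[OF perp[OF 1(1)]] u(1,2)[OF perp[OF 2(1)]] t1 t2')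
  then have "cos \<theta>2 = - cos \<theta>1" "sin \<theta>2 = - sin \<theta>1" using d0 by (simp_all only: mult_right_cancel power_eq_0_iff norm_eq_zero simp_thms)
  then show False using tight_not_antipodal[OF 1(1) 2(1)] by simp
qed

theorem singleton_with_three_tight_directions:
  "\<exists>p \<theta>1 \<theta>2 \<theta>3. rank_numerical_range k A = {p} \<and>
     dir p \<theta>1 = ev \<theta>1 \<and> dir p \<theta>2 = ev \<theta>2 \<and> dir p \<theta>3 = ev \<theta>3 \<and>
     sin (\<theta>1 - \<theta>2) \<noteq> 0 \<and> sin (\<theta>1 - \<theta>3) \<noteq> 0 \<and> sin (\<theta>2 - \<theta>3) \<noteq> 0"
proof -
  have "rank_numerical_range k A \<noteq> {}" using thin by auto
  then obtain p where p: "p \<in> rank_numerical_range k A" by blast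
  then have single: "rank_numerical_range k A = {p}" using range_subsingleton by blast
  have f: "feasible p" using p by (rule feasible_range)
  have cis: "dir (cis t) \<theta> = cos (t - \<theta>)" for t \<theta> by (simp add: dir_def cos_diff mult.commute)
  have pm: "cos x = 1 \<or> cos x = - 1" if "sin x = 0" for x :: real
    using sin_cos_squared_add[of x] that by (simp add: power2_eq_1_iff)
  obtain \<theta>1 where 1: "dir p \<theta>1 = ev \<theta>1" using tight_direction[OF f] by blast
  obtain \<theta>2 where 2: "dir p \<theta>2 = ev \<theta>2" "cos (\<theta>1 - \<theta>2) \<le> 0"
    using tight_direction[OF f, of "- cis \<theta>1"] cis by auto
  \<comment> \<open>The half-plane opposite to the bisector of the first two directions. Parallel to
    one of them, the third would have to equal it and then be opposite to the other.\<close>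
  obtain \<theta>3 where 3: "dir p \<theta>3 = ev \<theta>3" "cos (\<theta>1 - \<theta>3) + cos (\<theta>2 - \<theta>3) \<le> 0"
    using tight_direction[OF f, of "- (cis \<theta>1 + cis \<theta>2)"] cis by fastforce
  have "sin (\<theta>1 - \<theta>2) \<noteq> 0" using pm[of "\<theta>1 - \<theta>2"] 2 tight_not_opposite[OF 1 2(1)] by auto
  have key: "sin (s - \<theta>3) \<noteq> 0"
    if s: "dir p s = ev s" "dir p s' = ev s'" "cos (s - \<theta>3) + cos (s' - \<theta>3) \<le> 0" for s s'
  proof
    assume z: "sin (s - \<theta>3) = 0"
    then have c: "cos (s - \<theta>3) = 1" using pm tight_not_opposite[OF s(1) 3(1)] by blast
    then have "cos (s' - \<theta>3) \<le> - 1" using s(3) by simp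
    then have "cos (s' - \<theta>3) = - 1" using cos_ge_minus_one[of "s' - \<theta>3"] by linarith
    then show False using tight_not_opposite[OF s(2) 3(1)] by simp
  qed
  have "sin (\<theta>1 - \<theta>3) \<noteq> 0" using key[OF 1 2(1)] 3(2) by simp
  moreover have "sin (\<theta>2 - \<theta>3) \<noteq> 0" using key[OF 2(1) 1] 3(2) by (simp add: add.commute)
  ultimately show ?thesis using single 1 2(1) 3(1) \<open>sin (\<theta>1 - \<theta>2) \<noteq> 0\<close> by blast
qed

end

section \<open>Tangency\<close>

definition eval3 :: "poly_txy \<Rightarrow> complex \<Rightarrow> complex \<Rightarrow> complex \<Rightarrow> complex" where
  "eval3 f t x y = poly (poly (poly f [:[:t:]:]) [:x:]) y"

definition eval2 :: "poly_xy \<Rightarrow> complex \<Rightarrow> complex \<Rightarrow> complex" where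
  "eval2 g x y = poly (poly g [:x:]) y"

lemma eval3_hom [simp]:
  "eval3 0 t x y = 0" "eval3 1 t x y = 1" "eval3 (f + g) t x y = eval3 f t x y + eval3 g t x y"
  "eval3 (f * g) t x y = eval3 f t x y * eval3 g t x y"
  by (simp_all add: eval3_def)

lemma eval2_mult [simp]: "eval2 (f * g) x y = eval2 f x y * eval2 g x y"
  by (simp add: eval2_def)

lemma eval3_vars [simp]:
  "eval3 var_t t x y = t" "eval3 var_x t x y = x" "eval3 var_y t x y = y" "eval3 (const_txy c) t x y = c"
  by (simp_all add: eval3_def var_t_def var_x_def var_y_def const_txy_def)

lemma eval2_linear_form [simp]: "eval2 (linear_form_xy a b) x y = a * x + b * y"
  by (simp add: eval2_def linear_form_xy_def)

lemma eval2_substitute: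
  "eval2 (poly f (- linear_form_xy a b)) x y = eval3 f (- (a * x + b * y)) x y"
proof (induction f)
  case (pCons c f)
  then show ?case by (simp add: eval2_def eval3_def linear_form_xy_def algebra_simps)
qed (simp add: eval2_def eval3_def)

lemma comm_ring_hom_eval3: "comm_ring_hom (\<lambda>f. eval3 f t x y)"
  by unfold_locales simp_all

lemma eval3_kippenhahn:
  assumes A: "A \<in> carrier_mat n n"
  shows "eval3 (kippenhahn_poly A) t x y =
    Determinant.det (t \<cdot>\<^sub>m 1\<^sub>m n + x \<cdot>\<^sub>m re_mat A + y \<cdot>\<^sub>m im_mat A)"
proof -
  interpret comm_ring_hom "\<lambda>f. eval3 f t x y" by (rule comm_ring_hom_eval3)
  have "map_mat (\<lambda>f. eval3 f t x y) (var_t \<cdot>\<^sub>m 1\<^sub>m (dim_row A)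
        + var_x \<cdot>\<^sub>m map_mat const_txy (re_mat A)
        + var_y \<cdot>\<^sub>m map_mat const_txy (im_mat A)) = t \<cdot>\<^sub>m 1\<^sub>m n + x \<cdot>\<^sub>m re_mat A + y \<cdot>\<^sub>m im_mat A"
  proof (rule eq_matI)
    fix i j assume "i < dim_row (t \<cdot>\<^sub>m 1\<^sub>m n + x \<cdot>\<^sub>m re_mat A + y \<cdot>\<^sub>m im_mat A)"
      "j < dim_col (t \<cdot>\<^sub>m 1\<^sub>m n + x \<cdot>\<^sub>m re_mat A + y \<cdot>\<^sub>m im_mat A)"
    then have "i < n" "j < n" using carrier_matD[OF im_mat_carrier[OF A]] by auto
    then show "map_mat (\<lambda>f. eval3 f t x y) (var_t \<cdot>\<^sub>m 1\<^sub>m (dim_row A)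
        + var_x \<cdot>\<^sub>m map_mat const_txy (re_mat A)
        + var_y \<cdot>\<^sub>m map_mat const_txy (im_mat A)) $$ (i, j) =
        (t \<cdot>\<^sub>m 1\<^sub>m n + x \<cdot>\<^sub>m re_mat A + y \<cdot>\<^sub>m im_mat A) $$ (i, j)"
      using carrier_matD[OF A] carrier_matD[OF re_mat_carrier[OF A]] carrier_matD[OF im_mat_carrier[OF A]]
      by simp
  qed (use carrier_matD[OF im_mat_carrier[OF A]] in auto)
  then show ?thesis unfolding kippenhahn_poly_def hom_det[symmetric] by simp
qed

lemma eval3_kippenhahn_eigval:
  assumes A: "A \<in> carrier_mat n n" and k: "1 \<le> k" "k \<le> n"
  shows "eval3 (kippenhahn_poly A) (- of_real (eigval (pencil A x y) k)) (of_real x) (of_real y) = 0"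
proof -
  let ?M = "pencil A x y"
  interpret H: sesquilinear_form fscale "mform n (\<lambda>i j. ?M $$ (i, j))" by (rule sesquilinear_mform)
  interpret I: sesquilinear_form fscale "ip n" by (rule sesquilinear_ip)
  obtain m where m: "k = Suc m" "m < n" using k by (cases k) auto
  obtain e where e: "eigenbasis n ?M e" using eigenbasis_exists[OF hermitian_pencil[OF A]] by blast
  define l where "l = complex_of_real (eigval ?M k)"
  \<comment> \<open>The defect of the eigenvector equation for \<open>e m\<close>; as
    \<open>eigenbasis\<close> only speaks about the form, it is tested against the whole
    basis.\<close>
  define f where "f = (\<lambda>i. if i < n then (\<Sum>j<n. ?M $$ (i, j) * e m j) - l * e m i else 0)"
  have fs: "f \<in> supported n" by (simp add: f_def supported_def)
  have "ip n (e i) f = 0" if "i < n" for i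
  proof -
    have "ip n (e i) f = (\<Sum>h<n. cnj (e i h) * (\<Sum>j<n. ?M $$ (h, j) * e m j)) - l * ip n (e i) (e m)"
      by (simp add: ip_def f_def right_diff_distrib sum_subtractf sum_distrib_left mult.left_commute)
    also have "(\<Sum>h<n. cnj (e i h) * (\<Sum>j<n. ?M $$ (h, j) * e m j)) = mform n (\<lambda>i j. ?M $$ (i, j)) (e i) (e m)"
      by (simp add: mform_def sum_distrib_left mult.assoc)
    finally show ?thesis using e that m by (simp add: eigenbasis_def l_def)
  qed
  note ip0 = this
  have "f = (\<Sum>j<n. fscale (ip n (e j) f) (e j))" using e fs unfolding eigenbasis_def by blast
  also have "\<dots> = (\<Sum>j<n. 0)" by (intro sum.cong refl) (simp add: ip0 fscale_def zero_fun_def)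
  finally have "f = 0" by simp
  define v where "v = vec n (e m)"
  let ?N = "(- l) \<cdot>\<^sub>m 1\<^sub>m n + of_real x \<cdot>\<^sub>m re_mat A + of_real y \<cdot>\<^sub>m im_mat A"
  have N: "?N \<in> carrier_mat n n" using A by simp
  have Nij: "?N $$ (i, j) = ?M $$ (i, j) - (if i = j then l else 0)" if "i < n" "j < n" for i j
    using that carrier_matD[OF re_mat_carrier[OF A]] carrier_matD[OF im_mat_carrier[OF A]]
    by (simp add: pencil_index[OF A])
  have "?N *\<^sub>v v = 0\<^sub>v n"
  proof (rule eq_vecI)
    fix i assume "i < dim_vec (0\<^sub>v n)"
    then have i: "i < n" by simp
    have "(?N *\<^sub>v v) $ i = (\<Sum>j<n. ?N $$ (i, j) * e m j)"
      using i N by (simp add: v_def scalar_prod_def atLeast0LessThan del: index_add_mat index_smult_mat)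
    also have "\<dots> = (\<Sum>j<n. ?M $$ (i, j) * e m j - (if i = j then l * e m j else 0))"
      using Nij[OF i] by (intro sum.cong) (auto simp: left_diff_distrib)
    also have "\<dots> = f i" using i by (simp add: f_def sum_subtractf)
    finally show "(?N *\<^sub>v v) $ i = 0\<^sub>v n $ i" using i \<open>f = 0\<close> by simp
  qed (use carrier_matD[OF im_mat_carrier[OF A]] in simp)
  moreover have "v \<noteq> 0\<^sub>v n"
  proof
    assume "v = 0\<^sub>v n"
    then have "e m j = 0" if "j < n" for j using that by (metis index_vec index_zero_vec(1) v_def)
    then have "ip n (e m) (e m) = 0" by (simp add: ip_def)
    then show False using e m by (simp add: eigenbasis_def)
  qed
  moreover have "v \<in> carrier_vec n" by (simp add: v_def)
  ultimately have "Determinant.det ?N = 0" using det_0_iff_vec_prod_zero_field[OF N] by blast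
  then show ?thesis unfolding eval3_kippenhahn[OF A] l_def .
qed

lemma kippenhahn_poly_nonzero:
  assumes "A \<in> carrier_mat n n"
  shows "kippenhahn_poly A \<noteq> 0"
proof -
  have "1 \<cdot>\<^sub>m 1\<^sub>m n + 0 \<cdot>\<^sub>m re_mat A + 0 \<cdot>\<^sub>m im_mat A = 1\<^sub>m n"
    using re_mat_carrier[OF assms] im_mat_carrier[OF assms] by (intro eq_matI) auto
  then have "eval3 (kippenhahn_poly A) 1 0 0 = 1" by (simp add: eval3_kippenhahn[OF assms])
  then show ?thesis by auto
qed

text \<open>A zero of the factorization is a zero of some prime factor, and each of these occurs
  once in the square-free part.\<close>

lemma eval3_squarefree_part:
  assumes "f \<noteq> 0" "eval3 f t x y = 0"
  shows "eval3 (squarefree_part f) t x y = 0"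
proof -
  have mset0: "\<exists>p\<in>#P. eval3 p t x y = 0" if "eval3 (prod_mset P) t x y = 0" for P
    using that by (induction P) auto
  have "f dvd prod_mset (prime_factorization f)"
    using prod_mset_prime_factorization_weak[OF assms(1)] by (metis associatedD2)
  then obtain g where "prod_mset (prime_factorization f) = f * g" by (elim dvdE)
  then have "eval3 (prod_mset (prime_factorization f)) t x y = 0" using assms(2) by simp
  then obtain p where p: "p \<in> prime_factors f" "eval3 p t x y = 0" using mset0 by blast
  have "squarefree_part f = p * \<Prod>(prime_factors f - {p})"
    unfolding squarefree_part_def using p(1) by (simp add: prod.remove)
  then show ?thesis using p(2) by simp
qed

section \<open>Divisibility by linear forms from zeros on rays\<close>

lemma poly_zero_of_infinite:
  assumes "infinite S" "\<And>x. x \<in> S \<Longrightarrow> poly p x = (0 :: 'a :: {comm_ring_1, ring_no_zero_divisors})"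
  shows "p = 0"
proof (rule ccontr)
  assume "p \<noteq> 0"
  then have "finite {x. poly p x = 0}" by (rule poly_roots_finite)
  then show False using assms finite_subset[of S "{x. poly p x = 0}"] by blast
qed

text \<open>Half a line already has infinitely many points, so substituting \<open>x = c * y\<close>
  gives the zero polynomial and the factor theorem applies. If \<open>sin \<theta> = 0\<close> the
  line is \<open>y = 0\<close>, and instead every coefficient is divisible by
  \<open>y\<close>.\<close>

lemma linear_form_dvd:
  assumes "\<And>r. r > 0 \<Longrightarrow> eval2 q (of_real (r * cos \<theta>)) (of_real (r * sin \<theta>)) = 0"
  shows "linear_form_xy (of_real (sin \<theta>)) (- of_real (cos \<theta>)) dvd q"
proof (cases "sin \<theta> = 0")
  case False
  define c where "c = complex_of_real (cos \<theta> / sin \<theta>)"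
  have "poly (poly q [:0, c:]) y = 0" if y: "y \<in> (\<lambda>r. of_real (r * sin \<theta>)) ` {0<..}" for y
  proof -
    obtain r where r: "r > 0" "y = of_real (r * sin \<theta>)" using y by auto
    have ev: "poly (poly g [:0, c:]) y = poly (poly g [:c * y:]) y" for g
      by (induction g) (simp_all add: mult.commute)
    have "c * y = of_real (r * cos \<theta>)" using False r by (simp add: c_def)
    then have "poly (poly q [:0, c:]) y = eval2 q (of_real (r * cos \<theta>)) y" by (simp only: ev eval2_def)
    then show ?thesis using assms[OF r(1)] r(2) by simp
  qed
  moreover have "infinite ((\<lambda>r. complex_of_real (r * sin \<theta>)) ` {0<..})"
    using False by (subst finite_image_iff) (auto simp: inj_on_def infinite_Ioi)
  ultimately have "poly q [:0, c:] = 0"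
    by (rule poly_zero_of_infinite[rotated])
  then have "[:- [:0, c:], 1:] dvd q" by (simp add: poly_eq_0_iff_dvd)
  moreover have "linear_form_xy (of_real (sin \<theta>)) (- of_real (cos \<theta>)) = [:[:of_real (sin \<theta>):]:] * [:- [:0, c:], 1:]"
    using False by (simp add: linear_form_xy_def c_def)
  moreover have "is_unit [:[:complex_of_real (sin \<theta>):]:]" using False by (simp add: is_unit_const_poly_iff)
  ultimately show ?thesis by (metis mult_unit_dvd_iff')
next
  case True
  then have c: "cos \<theta> \<noteq> 0" using sin_cos_squared_add[of \<theta>] by auto
  have "poly (map_poly (\<lambda>p. poly p 0) q) x = 0" if x: "x \<in> (\<lambda>r. of_real (r * cos \<theta>)) ` {0<..}" for x
  proof -
    obtain r where r: "r > 0" "x = of_real (r * cos \<theta>)" using x by auto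
    have "poly (map_poly (\<lambda>p. poly p 0) g) x = eval2 g x 0" for g
      by (induction g) (simp_all add: eval2_def map_poly_pCons)
    then show ?thesis using assms[OF r(1)] True r by simp
  qed
  moreover have "infinite ((\<lambda>r. complex_of_real (r * cos \<theta>)) ` {0<..})"
    using c by (subst finite_image_iff) (auto simp: inj_on_def infinite_Ioi)
  ultimately have "map_poly (\<lambda>p. poly p 0) q = 0"
    by (rule poly_zero_of_infinite[rotated])
  then have "poly (coeff q i) 0 = 0" for i
    using coeff_map_poly[of "\<lambda>p. poly p 0" q i] by simp
  then have "[:0, 1:] dvd coeff q i" for i using poly_eq_0_iff_dvd[of "coeff q i" 0] by simp
  then have "[:[:0, 1:]:] dvd q" by (simp add: const_poly_dvd_iff)
  moreover have "linear_form_xy (of_real (sin \<theta>)) (- of_real (cos \<theta>)) = [:[:- complex_of_real (cos \<theta>):]:] * [:[:0, 1:]:]"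
    using True by (simp add: linear_form_xy_def)
  moreover have "is_unit [:[:- complex_of_real (cos \<theta>):]:]" using c by (simp add: is_unit_const_poly_iff)
  ultimately show ?thesis by (metis mult_unit_dvd_iff')
qed

text \<open>Functions with a continuous difference quotient in the second variable; being closed under
  sums and products, they include all polynomial functions.\<close>

definition quotient_cont :: "(real \<Rightarrow> real \<Rightarrow> complex) \<Rightarrow> bool" where
  "quotient_cont P \<longleftrightarrow> continuous_on UNIV (\<lambda>z. P (fst z) (snd z)) \<and>
     (\<exists>D :: real \<times> real \<times> real \<Rightarrow> complex. continuous_on UNIV D \<and>
        (\<forall>s u u'. P s u - P s u' = of_real (u - u') * D (s, u, u')))"

lemma quotient_cont_affine: "quotient_cont (\<lambda>s u. a + b * of_real s + c * of_real u)"
  unfolding quotient_cont_def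
  by (intro conjI exI[of _ "\<lambda>_. c"] continuous_intros) (simp add: algebra_simps)

lemma quotient_cont_add:
  assumes "quotient_cont P" "quotient_cont Q"
  shows "quotient_cont (\<lambda>s u. P s u + Q s u)"
proof -
  obtain D where D: "continuous_on UNIV D" "\<And>s u u'. P s u - P s u' = of_real (u - u') * D (s, u, u')"
    using assms(1) unfolding quotient_cont_def by blast
  obtain E where E: "continuous_on UNIV E" "\<And>s u u'. Q s u - Q s u' = of_real (u - u') * E (s, u, u')"
    using assms(2) unfolding quotient_cont_def by blast
  have "(P s u + Q s u) - (P s u' + Q s u') = of_real (u - u') * (D (s, u, u') + E (s, u, u'))" for s u u'
    using D(2)[of s u u'] E(2)[of s u u'] by (simp add: algebra_simps)
  then show ?thesis using assms D(1) E(1) unfolding quotient_cont_def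
    by (intro conjI exI[of _ "\<lambda>z. D z + E z"]) (auto intro!: continuous_intros)
qed

lemma quotient_cont_mult:
  assumes "quotient_cont P" "quotient_cont Q"
  shows "quotient_cont (\<lambda>s u. P s u * Q s u)"
proof -
  obtain D where D: "continuous_on UNIV D" "\<And>s u u'. P s u - P s u' = of_real (u - u') * D (s, u, u')"
    using assms(1) unfolding quotient_cont_def by blast
  obtain E where E: "continuous_on UNIV E" "\<And>s u u'. Q s u - Q s u' = of_real (u - u') * E (s, u, u')"
    using assms(2) unfolding quotient_cont_def by blast
  have cont: "continuous_on UNIV (\<lambda>z. P (fst z) (snd z))" "continuous_on UNIV (\<lambda>z. Q (fst z) (snd z))"
    using assms by (auto simp: quotient_cont_def)
  define F where "F = (\<lambda>z. D z * Q (fst z) (fst (snd z)) + P (fst z) (snd (snd z)) * E z)"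
  have "continuous_on UNIV (\<lambda>z :: real \<times> real \<times> real. (fst z, fst (snd z)))"
    "continuous_on UNIV (\<lambda>z :: real \<times> real \<times> real. (fst z, snd (snd z)))"
    by (intro continuous_intros)+
  from continuous_on_compose2[OF cont(2) this(1)] continuous_on_compose2[OF cont(1) this(2)]
  have "continuous_on UNIV F" unfolding F_def using D(1) E(1) by (intro continuous_intros) auto
  moreover have "P s u * Q s u - P s u' * Q s u' = of_real (u - u') * F (s, u, u')" for s u u'
  proof -
    have "P s u * Q s u - P s u' * Q s u' = (P s u - P s u') * Q s u + P s u' * (Q s u - Q s u')"
      by (simp add: algebra_simps)
    then show ?thesis unfolding D(2) E(2) by (simp add: F_def algebra_simps)
  qed
  ultimately show ?thesis using cont unfolding quotient_cont_def
    by (intro conjI exI[of _ F]) (auto intro!: continuous_intros)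
qed

lemma quotient_cont_eval3:
  assumes "quotient_cont T" "quotient_cont X" "quotient_cont Y"
  shows "quotient_cont (\<lambda>s u. eval3 f (T s u) (X s u) (Y s u))"
proof -
  have const: "quotient_cont (\<lambda>_ _. c)" for c using quotient_cont_affine[of c 0 0] by simp
  have 1: "quotient_cont (\<lambda>s u. poly p (Y s u))" for p
    by (induction p) (auto intro!: const quotient_cont_add quotient_cont_mult assms)
  have 2: "quotient_cont (\<lambda>s u. poly (poly p [:X s u:]) (Y s u))" for p
    by (induction p) (auto intro!: const 1 quotient_cont_add quotient_cont_mult assms)
  have "quotient_cont (\<lambda>s u. poly (poly (poly p [:[:T s u:]:]) [:X s u:]) (Y s u))" for p
    by (induction p) (auto intro!: const 2 quotient_cont_add quotient_cont_mult assms)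
  then show ?thesis by (simp add: eval3_def)
qed

text \<open>A value slightly above the minimum is attained on both sides of 0 by the intermediate
  value theorem.\<close>

lemma no_injective_minimum:
  fixes \<sigma> :: "real \<Rightarrow> real"
  assumes "\<eta> > 0" and cont: "continuous_on {- \<eta>..\<eta>} \<sigma>" and inj: "inj_on \<sigma> {- \<eta>..\<eta>}"
    and min: "\<And>u. u \<in> {- \<eta>..\<eta>} \<Longrightarrow> \<sigma> 0 \<le> \<sigma> u"
  shows False
proof -
  have lt: "\<sigma> 0 < \<sigma> u" if "u \<in> {- \<eta>..\<eta>}" "u \<noteq> 0" for u
    using min[OF that(1)] inj_onD[OF inj, of 0 u] that \<open>\<eta> > 0\<close> by force
  define m where "m = (\<sigma> 0 + Min {\<sigma> \<eta>, \<sigma> (- \<eta>)}) / 2"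
  have m: "\<sigma> 0 < m" "m \<le> \<sigma> \<eta>" "m \<le> \<sigma> (- \<eta>)"
    using lt[of \<eta>] lt[of "- \<eta>"] \<open>\<eta> > 0\<close> by (auto simp: m_def min_def field_simps)
  obtain u where u: "0 \<le> u" "u \<le> \<eta>" "\<sigma> u = m"
    using IVT'[of \<sigma> 0 m \<eta>] m \<open>\<eta> > 0\<close> continuous_on_subset[OF cont, of "{0..\<eta>}"] by auto
  obtain v where v: "- \<eta> \<le> v" "v \<le> 0" "\<sigma> v = m"
    using IVT2'[of \<sigma> 0 m "- \<eta>"] m \<open>\<eta> > 0\<close> continuous_on_subset[OF cont, of "{- \<eta>..0}"] by auto
  have "u = v" using inj_onD[OF inj, of u v] u v by auto
  then have "u = 0" using u v by simp
  then show False using u m by simp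
qed

text \<open>If \<open>q\<close> did not vanish then the zero set of \<open>F\<close> near the point would be a graph over
  the \<open>t\<close>-direction, so the eigenvalue \<open>\<sigma> + const\<close>, which has a local minimum there, would be
  locally injective.\<close>

lemma tangent_cofactor_vanishes:
  assumes A: "A \<in> carrier_mat n n" and k: "1 \<le> k" "k \<le> n"
    and zero: "\<And>x y. eval3 F (- of_real (eigval (pencil A x y) k)) (of_real x) (of_real y) = 0"
    and le: "\<And>x y. a * x + b * y \<le> eigval (pencil A x y) k"
    and tight: "eigval (pencil A (cos \<theta>) (sin \<theta>)) k = a * cos \<theta> + b * sin \<theta>"
    and fac: "poly F (- linear_form_xy (of_real a) (of_real b)) =
       linear_form_xy (of_real (sin \<theta>)) (- of_real (cos \<theta>)) * q"
    and "r > 0"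
  shows "eval2 q (of_real (r * cos \<theta>)) (of_real (r * sin \<theta>)) = 0"
proof (rule ccontr)
  assume q0: "\<not> ?thesis"
  \<comment> \<open>The line through the tight point \<open>r * cis \<theta>\<close>, perpendicular
    to it, with coordinate \<open>u\<close>.\<close>
  define x y where "x = (\<lambda>u. r * cos \<theta> - u * sin \<theta>)" and "y = (\<lambda>u. r * sin \<theta> + u * cos \<theta>)"
  define \<sigma> where "\<sigma> = (\<lambda>u. eigval (pencil A (x u) (y u)) k - (a * x u + b * y u))"
  \<comment> \<open>\<open>s\<close> measures the distance in \<open>t\<close> from the plane
    \<open>t + a x + b y = 0\<close>: at \<open>s = \<sigma> u\<close> the eigenvalue makes
    \<open>P\<close> vanish, at \<open>s = 0\<close> it is the restriction to that plane.\<close>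
  define P where "P = (\<lambda>s u. eval3 F (of_real (- (a * x u + b * y u) - s)) (of_real (x u)) (of_real (y u)))"
  have zP: "P (\<sigma> u) u = 0" for u using zero[of "x u" "y u"] by (simp add: P_def \<sigma>_def)
  have \<sigma>0: "\<sigma> 0 = 0"
    unfolding \<sigma>_def x_def y_def
    by (simp add: eigval_pencil_scale[OF A k \<open>r > 0\<close>] tight) (simp add: algebra_simps)
  have \<sigma>ge: "\<sigma> u \<ge> 0" for u using le by (simp add: \<sigma>_def)
  have \<sigma>cont: "continuous_on S \<sigma>" for S
    unfolding \<sigma>_def x_def y_def by (intro continuous_intros continuous_eigval_pencil[OF A k])
  have t: "(\<lambda>s u. complex_of_real (- (a * x u + b * y u) - s)) =
      (\<lambda>s u. of_real (- (a * r * cos \<theta> + b * r * sin \<theta>)) + (- 1) * of_real s + of_real (a * sin \<theta> - b * cos \<theta>) * of_real u)"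
    by (intro ext) (simp add: x_def y_def algebra_simps)
  have xx: "(\<lambda>s u. complex_of_real (x u)) = (\<lambda>s u. of_real (r * cos \<theta>) + 0 * of_real s + of_real (- sin \<theta>) * of_real u)"
    by (intro ext) (simp add: x_def algebra_simps)
  have yy: "(\<lambda>s u. complex_of_real (y u)) = (\<lambda>s u. of_real (r * sin \<theta>) + 0 * of_real s + of_real (cos \<theta>) * of_real u)"
    by (intro ext) (simp add: y_def algebra_simps)
  have eval: "quotient_cont (\<lambda>s u. eval3 f (of_real (- (a * x u + b * y u) - s)) (of_real (x u)) (of_real (y u)))" for f
    by (rule quotient_cont_eval3) (simp_all only: t xx yy quotient_cont_affine)
  from eval[of F] have "quotient_cont P" by (simp only: P_def)
  then obtain D :: "real \<times> real \<times> real \<Rightarrow> complex" where D: "continuous_on UNIV D"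
    and PD: "\<And>s u u'. P s u - P s u' = of_real (u - u') * D (s, u, u')"
    unfolding quotient_cont_def by blast
  define Q where "Q = (\<lambda>u. eval2 q (of_real (x u)) (of_real (y u)))"
  have P0: "P 0 u = - of_real u * Q u" for u
  proof -
    have "P 0 u = eval2 (poly F (- linear_form_xy (of_real a) (of_real b))) (of_real (x u)) (of_real (y u))"
      by (simp add: P_def eval2_substitute)
    also have "\<dots> = (of_real (sin \<theta>) * of_real (x u) - of_real (cos \<theta>) * of_real (y u)) * Q u"
      unfolding fac by (simp add: Q_def)
    also have "of_real (sin \<theta>) * of_real (x u) - of_real (cos \<theta>) * of_real (y u) = complex_of_real (- u)"
    proof -
      have "s * (r * c - u * s) - c * (r * s + u * c) = - u * (s\<^sup>2 + c\<^sup>2)" for s c :: real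
        by (simp add: power2_eq_square algebra_simps)
      from this[of "sin \<theta>" "cos \<theta>"] have "sin \<theta> * x u - cos \<theta> * y u = - u" by (simp add: x_def y_def)
      then show ?thesis by (simp only: of_real_mult[symmetric] of_real_diff[symmetric])
    qed
    finally show ?thesis by simp
  qed
  \<comment> \<open>Division by \<open>u\<close> gives this away from 0; continuity extends it to
    \<open>D (0, 0, 0) = - Q 0\<close>.\<close>
  have DQ: "D (0, u, 0) = - Q u" if "u \<noteq> 0" for u
  proof -
    have "of_real u * D (0, u, 0) = of_real u * (- Q u)" using PD[of 0 u 0] by (simp add: P0)
    moreover have "complex_of_real u \<noteq> 0" using that by simp
    ultimately show ?thesis by (metis mult_left_cancel)
  qed
  have contD: "isCont (\<lambda>u. D (0, u, 0)) 0"
    using continuous_on_compose2[OF D, of UNIV "\<lambda>u. (0, u, 0)"]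
    by (simp add: continuous_on_eq_continuous_at continuous_intros)
  have "quotient_cont (\<lambda>s u. Q u)" using eval[of "[:q:]"] by (simp add: eval3_def eval2_def Q_def)
  then have "continuous_on UNIV (\<lambda>z :: real \<times> real. Q (snd z))" by (simp add: quotient_cont_def)
  from continuous_on_compose2[OF this, of UNIV "\<lambda>u. (0, u)"] have contQ: "isCont Q 0"
    by (simp add: continuous_on_eq_continuous_at continuous_intros)
  have "(\<lambda>u. D (0, u, 0)) \<midarrow>0\<rightarrow> D (0, 0, 0)" using contD by (simp add: isCont_def)
  moreover have "(\<lambda>u. D (0, u, 0)) \<midarrow>0\<rightarrow> - Q 0"
  proof (rule Lim_transform_eventually)
    show "(\<lambda>u. - Q u) \<midarrow>0\<rightarrow> - Q 0" using contQ by (intro tendsto_minus) (simp add: isCont_def)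
    show "\<forall>\<^sub>F u in at 0. - Q u = D (0, u, 0)" using DQ by (auto simp: eventually_at_filter)
  qed
  ultimately have "D (0, 0, 0) = - Q 0" by (rule LIM_unique)
  moreover have "Q 0 \<noteq> 0" using q0 by (simp add: Q_def x_def y_def)
  ultimately have "D (0, 0, 0) \<noteq> 0" by simp
  then have "\<forall>\<^sub>F z in nhds (0, 0, 0). D z \<noteq> 0"
    using D by (intro tendsto_imp_eventually_ne[where c = "D (0, 0, 0)"])
      (auto simp: continuous_on_def tendsto_at_iff_tendsto_nhds)
  then obtain \<delta>1 where \<delta>1: "\<delta>1 > 0" "\<And>z. dist z (0, 0, 0) < \<delta>1 \<Longrightarrow> D z \<noteq> 0"
    unfolding eventually_nhds_metric by blast
  define \<delta> where "\<delta> = \<delta>1 / 3"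
  have \<delta>: "\<delta> > 0" using \<delta>1 by (simp add: \<delta>_def)
  have near: "D (s, u, u') \<noteq> 0" if "\<bar>s\<bar> < \<delta>" "\<bar>u\<bar> < \<delta>" "\<bar>u'\<bar> < \<delta>" for s u u'
  proof (rule \<delta>1(2))
    have "dist (s, u, u') (0, 0, 0) = norm (s, u, u')" by (simp add: dist_norm zero_prod_def[symmetric])
    also have "\<dots> \<le> norm s + norm (u, u')" by (rule norm_Pair_le)
    also have "norm (u, u') \<le> norm u + norm u'" by (rule norm_Pair_le)
    finally show "dist (s, u, u') (0, 0, 0) < \<delta>1" using that by (simp add: \<delta>_def)
  qed
  have "isCont \<sigma> 0" using \<sigma>cont[of UNIV] by (simp add: continuous_on_eq_continuous_at)
  then have "\<sigma> \<midarrow>0\<rightarrow> 0" by (simp add: isCont_def \<sigma>0)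
  from LIM_D[OF this \<delta>] obtain \<eta>1 where \<eta>1: "\<eta>1 > 0" and "\<And>u. u \<noteq> 0 \<Longrightarrow> \<bar>u\<bar> < \<eta>1 \<Longrightarrow> \<bar>\<sigma> u\<bar> < \<delta>"
    by auto
  then have \<sigma>small: "\<bar>\<sigma> u\<bar> < \<delta>" if "\<bar>u\<bar> < \<eta>1" for u using that \<sigma>0 \<delta> by (cases "u = 0") auto
  define \<eta> where "\<eta> = min \<eta>1 \<delta> / 2"
  have \<eta>: "\<eta> > 0" "\<eta> < \<eta>1" "\<eta> < \<delta>" using \<eta>1 \<delta> by (auto simp: \<eta>_def min_def)
  \<comment> \<open>At equal \<open>\<sigma>\<close> values both values of \<open>P\<close> vanish,
    and the difference quotient is nonzero near the origin, so the points agree. This replaces the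
    implicit function theorem.\<close>
  have "inj_on \<sigma> {- \<eta>..\<eta>}"
  proof (rule inj_onI)
    fix u u' assume u: "u \<in> {- \<eta>..\<eta>}" "u' \<in> {- \<eta>..\<eta>}" "\<sigma> u = \<sigma> u'"
    have "of_real (u - u') * D (\<sigma> u, u, u') = 0" unfolding PD[symmetric] using zP[of u] zP[of u'] u(3) by simp
    moreover have "D (\<sigma> u, u, u') \<noteq> 0" using u \<eta> \<sigma>small[of u] by (intro near) auto
    ultimately show "u = u'" by simp
  qed
  then show False using no_injective_minimum[OF \<eta>(1) \<sigma>cont] \<sigma>0 \<sigma>ge by metis
qed

section \<open>Extraction of the three double linear factors\<close>

theorem theorem6p3:
  fixes A :: "complex mat" and n k :: nat
  assumes "A \<in> carrier_mat n n"
    and "1 \<le> k" and "k \<le> n"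
    and "aff_dim (rank_numerical_range k A) \<in> {0, 1}"
    and "\<forall>\<theta>\<in>{0..<2 * pi}. eigval_dir A k \<theta> \<noteq> eigval_dir A (n - k + 1) \<theta>"
  shows "\<exists>a b :: real.
           rank_numerical_range k A = {complex_of_real a + \<i> * complex_of_real b} \<and>
           (tritangent (complex_of_real a) (complex_of_real b) (kippenhahn_poly A) \<or>
            line_form (complex_of_real a) (complex_of_real b) dvd kippenhahn_poly A)"
proof -
  interpret thin_range A n k using assms by unfold_locales
  obtain p \<theta>1 \<theta>2 \<theta>3 where single: "rank_numerical_range k A = {p}"
    and tight: "dir p \<theta>1 = ev \<theta>1" "dir p \<theta>2 = ev \<theta>2" "dir p \<theta>3 = ev \<theta>3"
    and indep: "sin (\<theta>1 - \<theta>2) \<noteq> 0" "sin (\<theta>1 - \<theta>3) \<noteq> 0" "sin (\<theta>2 - \<theta>3) \<noteq> 0"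
    using singleton_with_three_tight_directions by blast
  define a b where "a = Re p" and "b = Im p"
  define F where "F = squarefree_part (kippenhahn_poly A)"
  define g where "g = poly F (- linear_form_xy (of_real a) (of_real b))"
  define lf where "lf = (\<lambda>\<theta>. linear_form_xy (of_real (sin \<theta>)) (- of_real (cos \<theta>)))"
  define ray where "ray = (\<lambda>h \<theta>. \<forall>r>0. eval2 h (of_real (r * cos \<theta>)) (of_real (r * sin \<theta>)) = 0)"
  have zero: "eval3 F (- of_real (eigval (pencil A x y) k)) (of_real x) (of_real y) = 0" for x y
    unfolding F_def by (intro eval3_squarefree_part kippenhahn_poly_nonzero[OF A] eval3_kippenhahn_eigval[OF A k])
  have le: "a * x + b * y \<le> eigval (pencil A x y) k" for x y
    using rank_numerical_range_le_eigval[OF A k, of p x y] single by (simp add: a_def b_def mult.commute)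
  have tight': "eigval (pencil A (cos \<theta>) (sin \<theta>)) k = a * cos \<theta> + b * sin \<theta>" if "dir p \<theta> = ev \<theta>" for \<theta>
    using that by (simp add: dir_def ev_def a_def b_def mult.commute)
  have on_ray: "ray g \<theta>" if "dir p \<theta> = ev \<theta>" for \<theta>
    unfolding ray_def
  proof (intro allI impI)
    fix r :: real assume "r > 0"
    have "eigval (pencil A (r * cos \<theta>) (r * sin \<theta>)) k = a * (r * cos \<theta>) + b * (r * sin \<theta>)"
      by (simp add: eigval_pencil_scale[OF A k \<open>r > 0\<close>] tight'[OF that]) (simp add: algebra_simps)
    then show "eval2 g (of_real (r * cos \<theta>)) (of_real (r * sin \<theta>)) = 0"
      using zero[of "r * cos \<theta>" "r * sin \<theta>"] by (simp add: g_def eval2_substitute)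
  qed
  have dvd: "\<exists>h. q = lf \<theta> * h" if "ray q \<theta>" for q \<theta>
    using linear_form_dvd[of q \<theta>] that unfolding ray_def lf_def dvd_def by blast
  have cofactor: "ray q \<theta>" if "dir p \<theta> = ev \<theta>" "g = lf \<theta> * q" for q \<theta>
    using tangent_cofactor_vanishes[OF A k zero le tight'[OF that(1)], of q] that(2)
    unfolding ray_def g_def lf_def by blast
  \<comment> \<open>At \<open>r * cis \<theta>\<close> the form \<open>lf \<theta>'\<close> has the
    value \<open>r * sin (\<theta>' - \<theta>)\<close>, which is nonzero for independent
    directions.\<close>
  have cancel: "ray q \<theta>" if "ray (lf \<theta>' * q) \<theta>" "sin (\<theta>' - \<theta>) \<noteq> 0" for q \<theta> \<theta>'
  proof -
    have "eval2 (lf \<theta>') (of_real (r * cos \<theta>)) (of_real (r * sin \<theta>)) = of_real (r * sin (\<theta>' - \<theta>))" for r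
      by (simp add: lf_def sin_diff algebra_simps)
    then show ?thesis using that unfolding ray_def by (simp del: of_real_mult)
  qed
  obtain q1 where "g = lf \<theta>1 * q1" using dvd[OF on_ray[OF tight(1)]] by blast
  moreover from cofactor[OF tight(1) this] obtain h1 where "q1 = lf \<theta>1 * h1" using dvd by blast
  ultimately have g1: "g = lf \<theta>1 * (lf \<theta>1 * h1)" by simp
  have "ray h1 \<theta>2" using on_ray[OF tight(2)] cancel indep(1) unfolding g1 by blast
  then obtain q2 where "h1 = lf \<theta>2 * q2" using dvd by blast
  \<comment> \<open>The new factor goes to the front because \<open>cofactor\<close> needs all of
    \<open>g\<close> written as \<open>lf\<close> times a cofactor; the older factors are then
    cancelled along the ray.\<close>
  then have g2: "g = lf \<theta>2 * (lf \<theta>1 * (lf \<theta>1 * q2))" unfolding g1 by (simp add: mult.left_commute)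
  have "ray q2 \<theta>2" using cofactor[OF tight(2) g2] cancel indep(1) by blast
  then obtain h2 where "q2 = lf \<theta>2 * h2" using dvd by blast
  then have g3: "g = lf \<theta>2 * (lf \<theta>1 * (lf \<theta>1 * (lf \<theta>2 * h2)))" unfolding g2 by simp
  have "ray h2 \<theta>3" using on_ray[OF tight(3)] cancel indep(2,3) unfolding g3 by blast
  then obtain q3 where "h2 = lf \<theta>3 * q3" using dvd by blast
  then have g4: "g = lf \<theta>3 * (lf \<theta>2 * (lf \<theta>1 * (lf \<theta>1 * (lf \<theta>2 * q3))))"
    unfolding g3 by (simp add: mult.left_commute)
  have "ray q3 \<theta>3" using cofactor[OF tight(3) g4] cancel indep(2,3) by blast
  then obtain h3 where "q3 = lf \<theta>3 * h3" using dvd by blast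
  then have "g = (lf \<theta>1 * lf \<theta>2 * lf \<theta>3)\<^sup>2 * h3"
    unfolding g4 by (simp add: power2_eq_square mult.left_commute mult.assoc)
  then have "tritangent (of_real a) (of_real b) (kippenhahn_poly A)"
    unfolding tritangent_def g_def F_def lf_def by blast
  moreover have "p = of_real a + \<i> * of_real b" by (simp add: complex_eq_iff a_def b_def)
  ultimately show ?thesis using single by blast
qed

end
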